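(* There exists a compact (pointed) metric space $K$ such that the free space $\mathfrak{F}(K)$ fails the approximation property.
   Context: A pointed metric space is a metric space $(M,d)$ with a distinguished point $0\in M$. $\mathrm{Lip}_0(M)$ is the Banach space of real-valued Lipschitz functions $f$ on $M$ with $f(0)=0$, with norm $\|f\|_L=\sup\{|f(x)-f(y)|/d(x,y): x\ne y\in M\}$. For $x\in M$, $\delta(x)\in \mathrm{Lip}_0(M)^*$ is the evaluation $f\mapsto f(x)$. The free space $\mathfrak{F}(M)$ is the closed linear span of $\{\delta(x): x\in M\}$ in $\mathrm{Lip}_0(M)^*$, with the induced norm. A Banach space $X$ has the approximation property (AP) if the identity $\mathrm{id}_X$ is in the closure of the set of finite rank bounded linear operators on $X$ for the topology of uniform convergence on compact sets. *)

theory Defs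
  imports "HOL-Analysis.Analysis" "HOL-Library.Function_Algebras"
begin

instantiation "fun" :: (type, real_vector) real_vector
begin

definition scaleR_fun :: "real \<Rightarrow> ('a \<Rightarrow> 'b) \<Rightarrow> 'a \<Rightarrow> 'b"
  where "scaleR_fun c f = (\<lambda>x. c *\<^sub>R f x)"

instance
  by standard (simp_all add: scaleR_fun_def fun_eq_iff scaleR_add_right scaleR_add_left)

end

lemma scaleR_fun_apply [simp]: "(c *\<^sub>R f) x = c *\<^sub>R f x"
  by (simp add: scaleR_fun_def)


text \<open>A normed space is given by a linear subspace \<open>X\<close> of an ambient real vector space together
  with a function \<open>n\<close> whose values matter on \<open>X\<close> only.\<close>

locale normed_carrier =
  fixes X :: "'v::real_vector set" and n :: "'v \<Rightarrow> real"
  assumes subspace: "subspace X"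
    and norm_ge_0: "x \<in> X \<Longrightarrow> 0 \<le> n x"
    and norm_eq_0_iff: "x \<in> X \<Longrightarrow> n x = 0 \<longleftrightarrow> x = 0"
    and norm_scale: "x \<in> X \<Longrightarrow> n (c *\<^sub>R x) = \<bar>c\<bar> * n x"
    and norm_triangle: "x \<in> X \<Longrightarrow> y \<in> X \<Longrightarrow> n (x + y) \<le> n x + n y"

text \<open>The value off \<open>X\<close> is set to \<open>0\<close> because \<^locale>\<open>Metric_space\<close> requires a distance that is
  nonnegative and symmetric on the whole type.\<close>

definition norm_metric :: "'v::real_vector set \<Rightarrow> ('v \<Rightarrow> real) \<Rightarrow> 'v metric"
  where "norm_metric X n = metric (X, \<lambda>x y. if x \<in> X \<and> y \<in> X then n (x - y) else 0)"

definition linear_map_on :: "'v::real_vector set \<Rightarrow> ('v \<Rightarrow> 'w::real_vector) \<Rightarrow> bool"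
  where "linear_map_on X T \<longleftrightarrow>
    (\<forall>x\<in>X. \<forall>y\<in>X. T (x + y) = T x + T y) \<and> (\<forall>c. \<forall>x\<in>X. T (c *\<^sub>R x) = c *\<^sub>R T x)"

text \<open>Functionals are normalised to vanish off \<open>X\<close>, so that equality of functionals is equality of
  functions and the dual is a linear subspace of the function space.\<close>

definition dual_space :: "'v::real_vector set \<Rightarrow> ('v \<Rightarrow> real) \<Rightarrow> ('v \<Rightarrow> real) set"
  where "dual_space X n =
    {\<phi>. linear_map_on X \<phi> \<and> (\<exists>B. \<forall>x\<in>X. \<bar>\<phi> x\<bar> \<le> B * n x) \<and> (\<forall>x. x \<notin> X \<longrightarrow> \<phi> x = 0)}"

definition dual_norm :: "'v::real_vector set \<Rightarrow> ('v \<Rightarrow> real) \<Rightarrow> ('v \<Rightarrow> real) \<Rightarrow> real"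
  where "dual_norm X n \<phi> = Sup {\<bar>\<phi> x\<bar> | x. x \<in> X \<and> n x \<le> 1}"


definition bounded_operators :: "'v::real_vector set \<Rightarrow> ('v \<Rightarrow> real) \<Rightarrow> ('v \<Rightarrow> 'v) set"
  where "bounded_operators X n =
    {T \<in> X \<rightarrow>\<^sub>E X. linear_map_on X T \<and> (\<exists>B. \<forall>x\<in>X. n (T x) \<le> B * n x)}"

definition finite_rank_operators :: "'v::real_vector set \<Rightarrow> ('v \<Rightarrow> real) \<Rightarrow> ('v \<Rightarrow> 'v) set"
  where "finite_rank_operators X n =
    {T \<in> bounded_operators X n. \<exists>B. finite B \<and> T ` X \<subseteq> span B}"

definition compact_convergence_open ::
    "'v::real_vector set \<Rightarrow> ('v \<Rightarrow> real) \<Rightarrow> ('v \<Rightarrow> 'v) set \<Rightarrow> bool"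
  where "compact_convergence_open X n U \<longleftrightarrow>
    U \<subseteq> bounded_operators X n \<and>
    (\<forall>S\<in>U. \<exists>C \<epsilon>. compactin (mtopology_of (norm_metric X n)) C \<and> \<epsilon> > 0 \<and>
       {T \<in> bounded_operators X n. \<forall>x\<in>C. n (T x - S x) < \<epsilon>} \<subseteq> U)"

definition compact_convergence_topology ::
    "'v::real_vector set \<Rightarrow> ('v \<Rightarrow> real) \<Rightarrow> ('v \<Rightarrow> 'v) topology"
  where "compact_convergence_topology X n = topology (compact_convergence_open X n)"

definition approximation_property :: "'v::real_vector set \<Rightarrow> ('v \<Rightarrow> real) \<Rightarrow> bool"
  where "approximation_property X n \<longleftrightarrow>
    restrict id X \<in> compact_convergence_topology X n closure_of finite_rank_operators X n"


text \<open>Functions on the metric space are normalised to vanish off its carrier.\<close>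

definition Lip0 :: "'a metric \<Rightarrow> 'a \<Rightarrow> ('a \<Rightarrow> real) set"
  where "Lip0 M z =
    {f. Lipschitz_continuous_map M euclidean_metric f \<and> f z = 0 \<and> (\<forall>x. x \<notin> mspace M \<longrightarrow> f x = 0)}"

text \<open>Inserting \<open>0\<close> only matters for a one-point space, where the set of quotients is empty.\<close>

definition Lip_norm :: "'a metric \<Rightarrow> ('a \<Rightarrow> real) \<Rightarrow> real"
  where "Lip_norm M f =
    Sup (insert 0 {\<bar>f x - f y\<bar> / mdist M x y | x y. x \<in> mspace M \<and> y \<in> mspace M \<and> x \<noteq> y})"

definition Lip0_dual :: "'a metric \<Rightarrow> 'a \<Rightarrow> (('a \<Rightarrow> real) \<Rightarrow> real) set"
  where "Lip0_dual M z = dual_space (Lip0 M z) (Lip_norm M)"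

definition free_norm :: "'a metric \<Rightarrow> 'a \<Rightarrow> (('a \<Rightarrow> real) \<Rightarrow> real) \<Rightarrow> real"
  where "free_norm M z = dual_norm (Lip0 M z) (Lip_norm M)"

definition point_evaluation :: "'a metric \<Rightarrow> 'a \<Rightarrow> 'a \<Rightarrow> ('a \<Rightarrow> real) \<Rightarrow> real"
  where "point_evaluation M z x = (\<lambda>f. if f \<in> Lip0 M z then f x else 0)"

definition free_space :: "'a metric \<Rightarrow> 'a \<Rightarrow> (('a \<Rightarrow> real) \<Rightarrow> real) set"
  where "free_space M z =
    mtopology_of (norm_metric (Lip0_dual M z) (free_norm M z))
      closure_of span (point_evaluation M z ` mspace M)"


text \<open>The notions above are well behaved: the topologies and norms are genuine.\<close>

lemma istopology_compact_convergence: "istopology (compact_convergence_open X n)"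
  unfolding istopology_def
proof (intro conjI allI impI)
  fix U V assume U: "compact_convergence_open X n U" and V: "compact_convergence_open X n V"
  show "compact_convergence_open X n (U \<inter> V)"
    unfolding compact_convergence_open_def
  proof (intro conjI ballI)
    show "U \<inter> V \<subseteq> bounded_operators X n"
      using U by (auto simp: compact_convergence_open_def)
    fix S assume "S \<in> U \<inter> V"
    then have S: "S \<in> U" "S \<in> V" by auto
    obtain C \<epsilon> where
      C: "compactin (mtopology_of (norm_metric X n)) C" "\<epsilon> > 0"
        "{T \<in> bounded_operators X n. \<forall>x\<in>C. n (T x - S x) < \<epsilon>} \<subseteq> U"
      using U S(1) unfolding compact_convergence_open_def by blast
    obtain C' \<epsilon>' where
      C': "compactin (mtopology_of (norm_metric X n)) C'" "\<epsilon>' > 0"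
        "{T \<in> bounded_operators X n. \<forall>x\<in>C'. n (T x - S x) < \<epsilon>'} \<subseteq> V"
      using V S(2) unfolding compact_convergence_open_def by blast
    have "compactin (mtopology_of (norm_metric X n)) (C \<union> C')"
      using C C' by (simp add: compactin_Un)
    moreover have "min \<epsilon> \<epsilon>' > 0"
      using C C' by simp
    moreover have "{T \<in> bounded_operators X n. \<forall>x\<in>C \<union> C'. n (T x - S x) < min \<epsilon> \<epsilon>'} \<subseteq> U \<inter> V"
      using C(3) C'(3) by auto
    ultimately show "\<exists>C \<epsilon>. compactin (mtopology_of (norm_metric X n)) C \<and> \<epsilon> > 0 \<and>
       {T \<in> bounded_operators X n. \<forall>x\<in>C. n (T x - S x) < \<epsilon>} \<subseteq> U \<inter> V"
      by blast
  qed
next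
  fix \<U> assume \<U>: "\<forall>U\<in>\<U>. compact_convergence_open X n U"
  show "compact_convergence_open X n (\<Union>\<U>)"
    unfolding compact_convergence_open_def
  proof (intro conjI ballI)
    show "\<Union>\<U> \<subseteq> bounded_operators X n"
      using \<U> by (auto simp: compact_convergence_open_def)
    fix S assume "S \<in> \<Union>\<U>"
    then obtain U where "U \<in> \<U>" "S \<in> U" by blast
    then have "compact_convergence_open X n U" using \<U> by blast
    with \<open>S \<in> U\<close> obtain C \<epsilon> where "compactin (mtopology_of (norm_metric X n)) C" "\<epsilon> > 0"
        "{T \<in> bounded_operators X n. \<forall>x\<in>C. n (T x - S x) < \<epsilon>} \<subseteq> U"
      unfolding compact_convergence_open_def by blast
    moreover have "U \<subseteq> \<Union>\<U>" using \<open>U \<in> \<U>\<close> by blast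
    ultimately show "\<exists>C \<epsilon>. compactin (mtopology_of (norm_metric X n)) C \<and> \<epsilon> > 0 \<and>
       {T \<in> bounded_operators X n. \<forall>x\<in>C. n (T x - S x) < \<epsilon>} \<subseteq> \<Union>\<U>"
      by (meson subset_trans)
  qed
qed

lemma openin_compact_convergence:
  "openin (compact_convergence_topology X n) = compact_convergence_open X n"
  by (simp add: compact_convergence_topology_def istopology_compact_convergence)

lemma topspace_compact_convergence:
  "topspace (compact_convergence_topology X n) = bounded_operators X n"
proof -
  have "compact_convergence_open X n (bounded_operators X n)"
    unfolding compact_convergence_open_def
    by (metis (lifting) compactin_empty mem_Collect_eq order_refl subsetI zero_less_one)
  then show ?thesis
    unfolding topspace_def openin_compact_convergence
    using compact_convergence_open_def by blast
qed

context normed_carrier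
begin

lemma norm_zero: "n 0 = 0"
  using norm_eq_0_iff subspace subspace_0 by blast

lemma norm_minus_commute: assumes "x \<in> X" "y \<in> X" shows "n (x - y) = n (y - x)"
  using norm_scale[of "x - y" "-1"] subspace_diff[OF subspace assms] by simp

lemma norm_diff_triangle:
  assumes "x \<in> X" "y \<in> X" "w \<in> X" shows "n (x - w) \<le> n (x - y) + n (y - w)"
  using norm_triangle[of "x - y" "y - w"] subspace_diff[OF subspace] assms by simp

lemma Metric_space_norm: "Metric_space X (\<lambda>x y. if x \<in> X \<and> y \<in> X then n (x - y) else 0)"
proof
  fix x y :: 'v
  show "0 \<le> (if x \<in> X \<and> y \<in> X then n (x - y) else 0)"
    using norm_ge_0 subspace_diff[OF subspace] by simp
  show "(if x \<in> X \<and> y \<in> X then n (x - y) else 0) = (if y \<in> X \<and> x \<in> X then n (y - x) else 0)"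
    using norm_minus_commute by simp
  show "x \<in> X \<Longrightarrow> y \<in> X \<Longrightarrow> (if x \<in> X \<and> y \<in> X then n (x - y) else 0) = 0 \<longleftrightarrow> x = y"
    using norm_eq_0_iff subspace_diff[OF subspace] by simp
  fix w
  show "x \<in> X \<Longrightarrow> y \<in> X \<Longrightarrow> w \<in> X \<Longrightarrow>
      (if x \<in> X \<and> w \<in> X then n (x - w) else 0) \<le>
      (if x \<in> X \<and> y \<in> X then n (x - y) else 0) + (if y \<in> X \<and> w \<in> X then n (y - w) else 0)"
    using norm_diff_triangle by simp
qed

lemma mspace_norm_metric: "mspace (norm_metric X n) = X"
  unfolding norm_metric_def using Metric_space.mspace_metric[OF Metric_space_norm] by simp

lemma mdist_norm_metric: "x \<in> X \<Longrightarrow> y \<in> X \<Longrightarrow> mdist (norm_metric X n) x y = n (x - y)"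
  unfolding norm_metric_def using Metric_space.mdist_metric[OF Metric_space_norm] by simp

lemma id_in_bounded_operators: "restrict id X \<in> bounded_operators X n"
  unfolding bounded_operators_def linear_map_on_def
  using subspace by (auto simp: subspace_add subspace_scale intro!: exI[of _ 1])

theorem approximation_property_iff:
  "approximation_property X n \<longleftrightarrow>
    (\<forall>C \<epsilon>. compactin (mtopology_of (norm_metric X n)) C \<longrightarrow> \<epsilon> > 0 \<longrightarrow>
      (\<exists>T \<in> finite_rank_operators X n. \<forall>x\<in>C. n (T x - x) < \<epsilon>))"
proof
  assume AP: "approximation_property X n"
  show "\<forall>C \<epsilon>. compactin (mtopology_of (norm_metric X n)) C \<longrightarrow> \<epsilon> > 0 \<longrightarrow>
      (\<exists>T \<in> finite_rank_operators X n. \<forall>x\<in>C. n (T x - x) < \<epsilon>)"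
  proof (intro allI impI)
    fix C and \<epsilon> :: real
    assume C: "compactin (mtopology_of (norm_metric X n)) C" and \<epsilon>: "\<epsilon> > 0"
    have CX: "C \<subseteq> X"
      using compactin_subset_topspace[OF C] by (simp add: mspace_norm_metric)
    define W where "W = {T \<in> bounded_operators X n. \<exists>r<\<epsilon>. \<forall>x\<in>C. n (T x - x) \<le> r}"
    have "compact_convergence_open X n W"
      unfolding compact_convergence_open_def
    proof (intro conjI ballI)
      show "W \<subseteq> bounded_operators X n" by (auto simp: W_def)
      fix S assume "S \<in> W"
      then obtain r where S: "S \<in> bounded_operators X n"
        and r: "r < \<epsilon>" "\<And>x. x \<in> C \<Longrightarrow> n (S x - x) \<le> r" by (auto simp: W_def)
      have "T \<in> W" if T: "T \<in> bounded_operators X n"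
        and TS: "\<And>x. x \<in> C \<Longrightarrow> n (T x - S x) < (\<epsilon> - r) / 2" for T
      proof -
        have "n (T x - x) \<le> (\<epsilon> - r) / 2 + r" if "x \<in> C" for x
        proof -
          have "x \<in> X" "S x \<in> X" "T x \<in> X"
            using that CX S T by (auto simp: bounded_operators_def)
          then show ?thesis
            using norm_diff_triangle[of "T x" "S x" x] TS[OF that] r(2)[OF that] by linarith
        qed
        moreover have "(\<epsilon> - r) / 2 + r < \<epsilon>" using r(1) by (simp add: field_simps)
        ultimately show ?thesis using T unfolding W_def by blast
      qed
      then show "\<exists>C \<epsilon>. compactin (mtopology_of (norm_metric X n)) C \<and> \<epsilon> > 0 \<and>
          {T \<in> bounded_operators X n. \<forall>x\<in>C. n (T x - S x) < \<epsilon>} \<subseteq> W"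
        using C r(1) by (intro exI[of _ C] exI[of _ "(\<epsilon> - r) / 2"]) auto
    qed
    moreover have "restrict id X \<in> W"
      using id_in_bounded_operators \<epsilon> CX norm_zero by (auto simp: W_def intro!: exI[of _ 0])
    ultimately obtain T where "T \<in> finite_rank_operators X n" "T \<in> W"
      using AP unfolding approximation_property_def in_closure_of openin_compact_convergence
      by blast
    then show "\<exists>T \<in> finite_rank_operators X n. \<forall>x\<in>C. n (T x - x) < \<epsilon>"
      unfolding W_def by force
  qed
next
  assume R: "\<forall>C \<epsilon>. compactin (mtopology_of (norm_metric X n)) C \<longrightarrow> \<epsilon> > 0 \<longrightarrow>
      (\<exists>T \<in> finite_rank_operators X n. \<forall>x\<in>C. n (T x - x) < \<epsilon>)"
  show "approximation_property X n"
    unfolding approximation_property_def in_closure_of openin_compact_convergence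
      topspace_compact_convergence
  proof (intro conjI allI impI id_in_bounded_operators)
    fix U assume "restrict id X \<in> U \<and> compact_convergence_open X n U"
    then obtain C \<epsilon> where C: "compactin (mtopology_of (norm_metric X n)) C" "\<epsilon> > 0"
      "{T \<in> bounded_operators X n. \<forall>x\<in>C. n (T x - restrict id X x) < \<epsilon>} \<subseteq> U"
      unfolding compact_convergence_open_def by blast
    have CX: "C \<subseteq> X"
      using compactin_subset_topspace[OF C(1)] by (simp add: mspace_norm_metric)
    obtain T where T: "T \<in> finite_rank_operators X n" "\<forall>x\<in>C. n (T x - x) < \<epsilon>"
      using R C by blast
    have "\<forall>x\<in>C. n (T x - restrict id X x) < \<epsilon>" using T(2) CX by auto
    moreover have "T \<in> bounded_operators X n" using T(1) by (simp add: finite_rank_operators_def)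
    ultimately have "T \<in> U" using C(3) by blast
    then show "\<exists>T. T \<in> finite_rank_operators X n \<and> T \<in> U" using T(1) by blast
  qed
qed

lemma subspace_dual: "subspace (dual_space X n)"
proof (rule subspaceI)
  show "0 \<in> dual_space X n"
    by (auto simp: dual_space_def linear_map_on_def intro!: exI[of _ 0])
  fix \<phi> \<psi> assume \<phi>: "\<phi> \<in> dual_space X n" and \<psi>: "\<psi> \<in> dual_space X n"
  obtain B B' where B: "\<forall>x\<in>X. \<bar>\<phi> x\<bar> \<le> B * n x" "\<forall>x\<in>X. \<bar>\<psi> x\<bar> \<le> B' * n x"
    using \<phi> \<psi> by (auto simp: dual_space_def)
  have "\<forall>x\<in>X. \<bar>(\<phi> + \<psi>) x\<bar> \<le> (B + B') * n x"
    using B by (fastforce simp: distrib_right)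
  then have "\<exists>B. \<forall>x\<in>X. \<bar>(\<phi> + \<psi>) x\<bar> \<le> B * n x" by blast
  moreover have "linear_map_on X (\<phi> + \<psi>)"
    using \<phi> \<psi> unfolding dual_space_def linear_map_on_def by (simp add: algebra_simps)
  ultimately show "\<phi> + \<psi> \<in> dual_space X n"
    using \<phi> \<psi> by (simp add: dual_space_def)
next
  fix c \<phi> assume \<phi>: "\<phi> \<in> dual_space X n"
  obtain B where B: "\<forall>x\<in>X. \<bar>\<phi> x\<bar> \<le> B * n x"
    using \<phi> by (auto simp: dual_space_def)
  have "\<forall>x\<in>X. \<bar>(c *\<^sub>R \<phi>) x\<bar> \<le> (\<bar>c\<bar> * B) * n x"
    using B by (auto simp: abs_mult mult.assoc mult_left_mono)
  then have "\<exists>B. \<forall>x\<in>X. \<bar>(c *\<^sub>R \<phi>) x\<bar> \<le> B * n x" by blast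
  moreover have "linear_map_on X (c *\<^sub>R \<phi>)"
    using \<phi> unfolding dual_space_def linear_map_on_def by (simp add: algebra_simps)
  ultimately show "c *\<^sub>R \<phi> \<in> dual_space X n"
    using \<phi> by (simp add: dual_space_def)
qed

lemma dual_norm_set:
  assumes "\<phi> \<in> dual_space X n"
  shows "bdd_above {\<bar>\<phi> x\<bar> | x. x \<in> X \<and> n x \<le> 1}" "{\<bar>\<phi> x\<bar> | x. x \<in> X \<and> n x \<le> 1} \<noteq> {}"
proof -
  obtain B where B: "\<forall>x\<in>X. \<bar>\<phi> x\<bar> \<le> B * n x"
    using assms by (auto simp: dual_space_def)
  have "\<bar>\<phi> x\<bar> \<le> \<bar>B\<bar>" if "x \<in> X" "n x \<le> 1" for x
  proof -
    have "\<bar>\<phi> x\<bar> \<le> \<bar>B\<bar> * n x"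
      using B that norm_ge_0 by (meson abs_ge_self mult_right_mono order_trans)
    also have "\<dots> \<le> \<bar>B\<bar> * 1" using that by (intro mult_left_mono) auto
    finally show ?thesis by simp
  qed
  then show "bdd_above {\<bar>\<phi> x\<bar> | x. x \<in> X \<and> n x \<le> 1}" by (auto intro!: bdd_aboveI)
  show "{\<bar>\<phi> x\<bar> | x. x \<in> X \<and> n x \<le> 1} \<noteq> {}"
    using subspace_0[OF subspace] norm_zero by force
qed

lemma dual_norm_upper: 
  assumes "\<phi> \<in> dual_space X n" "x \<in> X" "n x \<le> 1" shows "\<bar>\<phi> x\<bar> \<le> dual_norm X n \<phi>"
  unfolding dual_norm_def using assms dual_norm_set(1)[OF assms(1)] by (auto intro!: cSup_upper)

lemma dual_norm_least:
  assumes "\<phi> \<in> dual_space X n" "\<And>x. x \<in> X \<Longrightarrow> n x \<le> 1 \<Longrightarrow> \<bar>\<phi> x\<bar> \<le> B"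
  shows "dual_norm X n \<phi> \<le> B"
  unfolding dual_norm_def using assms(2) dual_norm_set(2)[OF assms(1)]
  by (auto intro!: cSup_least)

lemma dual_norm_ge_0: assumes "\<phi> \<in> dual_space X n" shows "0 \<le> dual_norm X n \<phi>"
  using dual_norm_upper[OF assms subspace_0[OF subspace]] norm_zero by simp

lemma dual_norm_bound:
  assumes "\<phi> \<in> dual_space X n" "x \<in> X" shows "\<bar>\<phi> x\<bar> \<le> dual_norm X n \<phi> * n x"
proof (cases "x = 0")
  case True
  have "\<phi> (0 *\<^sub>R x) = 0 *\<^sub>R \<phi> x"
    using assms unfolding dual_space_def linear_map_on_def by blast
  then show ?thesis using True norm_zero by simp
next
  case False
  then have pos: "n x > 0" using assms(2) norm_ge_0 norm_eq_0_iff by fastforce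
  let ?y = "(1 / n x) *\<^sub>R x"
  have "?y \<in> X" using assms(2) subspace by (simp add: subspace_scale)
  moreover have "n ?y \<le> 1" using norm_scale[OF assms(2)] pos by simp
  moreover have "\<phi> ?y = (1 / n x) * \<phi> x"
    using assms by (simp add: dual_space_def linear_map_on_def)
  ultimately have "\<bar>(1 / n x) * \<phi> x\<bar> \<le> dual_norm X n \<phi>"
    using dual_norm_upper[OF assms(1), of ?y] by metis
  then show ?thesis using pos by (simp add: abs_mult divide_le_eq)
qed

lemma normed_carrier_dual: "normed_carrier (dual_space X n) (dual_norm X n)"
proof
  show "Real_Vector_Spaces.subspace (dual_space X n)" by (rule subspace_dual)
  fix \<phi> \<psi> and c :: real assume \<phi>: "\<phi> \<in> dual_space X n"
  show "0 \<le> dual_norm X n \<phi>" using dual_norm_ge_0[OF \<phi>] .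
  have "dual_norm X n 0 \<le> 0"
    using dual_norm_least[OF subspace_0[OF subspace_dual]] by simp
  moreover have "\<phi> = 0" if "dual_norm X n \<phi> = 0"
  proof
    fix x show "\<phi> x = 0 x"
      using dual_norm_bound[OF \<phi>, of x] that \<phi> by (cases "x \<in> X") (auto simp: dual_space_def)
  qed
  ultimately show "dual_norm X n \<phi> = 0 \<longleftrightarrow> \<phi> = 0"
    using dual_norm_ge_0 \<phi> by (metis order_antisym)
  have le: "dual_norm X n (c *\<^sub>R \<phi>) \<le> \<bar>c\<bar> * dual_norm X n \<phi>" if "\<phi> \<in> dual_space X n" for c \<phi>
    using that subspace_scale[OF subspace_dual that]
    by (auto intro!: dual_norm_least simp: abs_mult dual_norm_upper mult_left_mono)
  show "dual_norm X n (c *\<^sub>R \<phi>) = \<bar>c\<bar> * dual_norm X n \<phi>"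
  proof (cases "c = 0")
    case True
    then show ?thesis
      using le[OF \<phi>, of c] dual_norm_ge_0[OF subspace_scale[OF subspace_dual \<phi>, of c]] by simp
  next
    case False
    have "\<bar>c\<bar> * dual_norm X n \<phi> = \<bar>c\<bar> * dual_norm X n ((1/c) *\<^sub>R (c *\<^sub>R \<phi>))"
      using False by simp
    also have "\<dots> \<le> \<bar>c\<bar> * (\<bar>1/c\<bar> * dual_norm X n (c *\<^sub>R \<phi>))"
      by (intro mult_left_mono le subspace_scale[OF subspace_dual \<phi>]) simp
    also have "\<dots> = dual_norm X n (c *\<^sub>R \<phi>)" using False by simp
    finally show ?thesis using le[OF \<phi>, of c] by simp
  qed
  assume \<psi>: "\<psi> \<in> dual_space X n"
  show "dual_norm X n (\<phi> + \<psi>) \<le> dual_norm X n \<phi> + dual_norm X n \<psi>"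
  proof (rule dual_norm_least[OF subspace_add[OF subspace_dual \<phi> \<psi>]])
    fix x assume "x \<in> X" "n x \<le> 1"
    then show "\<bar>(\<phi> + \<psi>) x\<bar> \<le> dual_norm X n \<phi> + dual_norm X n \<psi>"
      using dual_norm_upper[OF \<phi>, of x] dual_norm_upper[OF \<psi>, of x] by simp
  qed
qed

lemma normed_carrier_subspace:
  assumes "Y \<subseteq> X" "Real_Vector_Spaces.subspace Y" shows "normed_carrier Y n"
  using assms norm_ge_0 norm_eq_0_iff norm_scale norm_triangle by unfold_locales blast+

lemma in_closure_iff:
  assumes "Y \<subseteq> X"
  shows "x \<in> mtopology_of (norm_metric X n) closure_of Y \<longleftrightarrow>
    x \<in> X \<and> (\<forall>\<epsilon>>0. \<exists>y\<in>Y. n (x - y) < \<epsilon>)"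
proof -
  interpret N: Metric_space X "mdist (norm_metric X n)"
    using Metric_space_mspace_mdist[of "norm_metric X n"] by (simp add: mspace_norm_metric)
  have eq: "mtopology_of (norm_metric X n) = N.mtopology"
    by (simp add: mtopology_of_def mspace_norm_metric)
  show ?thesis
    unfolding eq N.metric_closure_of using assms mdist_norm_metric by (auto simp: subset_iff) metis+
qed

lemma subspace_closure:
  assumes Y: "Y \<subseteq> X" "Real_Vector_Spaces.subspace Y"
  shows "Real_Vector_Spaces.subspace (mtopology_of (norm_metric X n) closure_of Y)"
proof (rule subspaceI)
  show "0 \<in> mtopology_of (norm_metric X n) closure_of Y"
    unfolding in_closure_iff[OF Y(1)] using subspace_0[OF Y(2)] subspace_0[OF subspace] norm_zero
    by force
  fix x y assume x: "x \<in> mtopology_of (norm_metric X n) closure_of Y"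
    and y: "y \<in> mtopology_of (norm_metric X n) closure_of Y"
  show "x + y \<in> mtopology_of (norm_metric X n) closure_of Y"
    unfolding in_closure_iff[OF Y(1)]
  proof (intro conjI allI impI)
    show "x + y \<in> X" using x y in_closure_iff[OF Y(1)] subspace_add[OF subspace] by blast
    fix \<epsilon> :: real assume "\<epsilon> > 0"
    then obtain x' y' where *: "x' \<in> Y" "y' \<in> Y" "n (x - x') < \<epsilon>/2" "n (y - y') < \<epsilon>/2"
      using x y unfolding in_closure_iff[OF Y(1)] by (meson half_gt_zero)
    have "x - x' \<in> X" "y - y' \<in> X"
      using * x y Y(1) in_closure_iff[OF Y(1)] subspace_diff[OF subspace] by blast+
    then have "n ((x + y) - (x' + y')) < \<epsilon>"
      using norm_triangle[of "x - x'" "y - y'"] * by (simp add: algebra_simps)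
    then show "\<exists>w\<in>Y. n ((x + y) - w) < \<epsilon>" using * subspace_add[OF Y(2)] by blast
  qed
next
  fix c x assume x: "x \<in> mtopology_of (norm_metric X n) closure_of Y"
  show "c *\<^sub>R x \<in> mtopology_of (norm_metric X n) closure_of Y"
    unfolding in_closure_iff[OF Y(1)]
  proof (intro conjI allI impI)
    show "c *\<^sub>R x \<in> X" using x in_closure_iff[OF Y(1)] subspace_scale[OF subspace] by blast
    fix \<epsilon> :: real assume \<epsilon>: "\<epsilon> > 0"
    then have "\<epsilon> / (\<bar>c\<bar> + 1) > 0" by simp
    then obtain x' where *: "x' \<in> Y" "n (x - x') < \<epsilon> / (\<bar>c\<bar> + 1)"
      using x unfolding in_closure_iff[OF Y(1)] by blast
    have X: "x - x' \<in> X"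
      using * x Y(1) in_closure_iff[OF Y(1)] subspace_diff[OF subspace] by blast
    have "n (c *\<^sub>R x - c *\<^sub>R x') = \<bar>c\<bar> * n (x - x')"
      using norm_scale[OF X] by (simp add: scaleR_diff_right)
    also have "\<dots> \<le> (\<bar>c\<bar> + 1) * n (x - x')" using norm_ge_0[OF X] by (simp add: distrib_right)
    also have "\<dots> < \<epsilon>" using * by (simp add: field_simps)
    finally show "\<exists>w\<in>Y. n (c *\<^sub>R x - w) < \<epsilon>" using * subspace_scale[OF Y(2)] by blast
  qed
qed

end

lemma Lip0_D:
  assumes "f \<in> Lip0 M z"
  obtains B where "B \<ge> 0"
    "\<And>x y. x \<in> mspace M \<Longrightarrow> y \<in> mspace M \<Longrightarrow> \<bar>f x - f y\<bar> \<le> B * mdist M x y"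
proof -
  obtain B where "B > 0"
    "\<forall>x\<in>mspace M. \<forall>y\<in>mspace M. \<bar>f x - f y\<bar> \<le> B * mdist M x y"
    using assms unfolding Lip0_def Lipschitz_continuous_map_pos by (auto simp: dist_real_def)
  then show thesis by (intro that[of B]) auto
qed

lemma Lip0_I:
  assumes "\<And>x y. x \<in> mspace M \<Longrightarrow> y \<in> mspace M \<Longrightarrow> \<bar>f x - f y\<bar> \<le> B * mdist M x y"
    and "f z = 0" "\<And>x. x \<notin> mspace M \<Longrightarrow> f x = 0"
  shows "f \<in> Lip0 M z"
  using assms unfolding Lip0_def Lipschitz_continuous_map_def by (auto simp: dist_real_def)

lemma Lip_norm_least:
  assumes "B \<ge> 0" "\<And>x y. x \<in> mspace M \<Longrightarrow> y \<in> mspace M \<Longrightarrow> \<bar>f x - f y\<bar> \<le> B * mdist M x y"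
  shows "Lip_norm M f \<le> B"
  unfolding Lip_norm_def using assms
  by (intro cSup_least) (auto simp: divide_le_eq Metric_space.mdist_pos_less[OF Metric_space_mspace_mdist])

lemma bdd_above_Lip_quotients:
  assumes "f \<in> Lip0 M z"
  shows "bdd_above (insert 0
    {\<bar>f x - f y\<bar> / mdist M x y | x y. x \<in> mspace M \<and> y \<in> mspace M \<and> x \<noteq> y})"
proof -
  obtain B where "B \<ge> 0"
    "\<And>x y. x \<in> mspace M \<Longrightarrow> y \<in> mspace M \<Longrightarrow> \<bar>f x - f y\<bar> \<le> B * mdist M x y"
    by (rule Lip0_D[OF assms]) blast
  then show ?thesis
    by (intro bdd_aboveI[of _ B]) (auto simp: divide_le_eq Metric_space.mdist_pos_less[OF Metric_space_mspace_mdist])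
qed

lemma Lip_norm_ge_0: assumes "f \<in> Lip0 M z" shows "0 \<le> Lip_norm M f"
  unfolding Lip_norm_def by (rule cSup_upper[OF _ bdd_above_Lip_quotients[OF assms]]) simp

lemma Lip_norm_bound:
  assumes f: "f \<in> Lip0 M z" and xy: "x \<in> mspace M" "y \<in> mspace M"
  shows "\<bar>f x - f y\<bar> \<le> Lip_norm M f * mdist M x y"
proof (cases "x = y")
  case True
  then show ?thesis
    using xy by (simp add: Metric_space.mdist_zero[OF Metric_space_mspace_mdist])
next
  case False
  have "\<bar>f x - f y\<bar> / mdist M x y \<le> Lip_norm M f"
    unfolding Lip_norm_def using False xy
    by (intro cSup_upper[OF _ bdd_above_Lip_quotients[OF f]]) auto
  then show ?thesis using False xy by (simp add: divide_le_eq Metric_space.mdist_pos_less[OF Metric_space_mspace_mdist])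
qed

lemma normed_carrier_Lip0:
  assumes z: "z \<in> mspace M" shows "normed_carrier (Lip0 M z) (Lip_norm M)"
proof
  have add: "\<bar>(f + g) x - (f + g) y\<bar> \<le> (Lip_norm M f + Lip_norm M g) * mdist M x y"
    if "f \<in> Lip0 M z" "g \<in> Lip0 M z" "x \<in> mspace M" "y \<in> mspace M" for f g x y
    using Lip_norm_bound[OF that(1,3,4)] Lip_norm_bound[OF that(2,3,4)]
    by (simp add: distrib_right)
  have scale: "\<bar>(c *\<^sub>R f) x - (c *\<^sub>R f) y\<bar> \<le> (\<bar>c\<bar> * Lip_norm M f) * mdist M x y"
    if "f \<in> Lip0 M z" "x \<in> mspace M" "y \<in> mspace M" for c f x y
    using mult_left_mono[OF Lip_norm_bound[OF that], of "\<bar>c\<bar>"]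
    by (simp add: abs_mult[symmetric] right_diff_distrib mult.assoc)
  show sub: "subspace (Lip0 M z)"
  proof (rule subspaceI)
    show "0 \<in> Lip0 M z" by (rule Lip0_I[where B = 0]) auto
    show "f + g \<in> Lip0 M z" if "f \<in> Lip0 M z" "g \<in> Lip0 M z" for f g
      by (rule Lip0_I[OF add[OF that]]) (use that in \<open>auto simp: Lip0_def\<close>)
    show "c *\<^sub>R f \<in> Lip0 M z" if "f \<in> Lip0 M z" for c f
      by (rule Lip0_I[OF scale[OF that]]) (use that in \<open>auto simp: Lip0_def\<close>)
  qed
  fix f g and c :: real assume f: "f \<in> Lip0 M z"
  show "0 \<le> Lip_norm M f" using Lip_norm_ge_0[OF f] .
  have 0: "0 \<in> Lip0 M z" using subspace_0[OF sub] .
  have "Lip_norm M 0 \<le> 0" by (rule Lip_norm_least) auto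
  moreover have "f = 0" if "Lip_norm M f = 0"
  proof
    fix x show "f x = 0 x"
      using Lip_norm_bound[OF f _ z, of x] that f by (cases "x \<in> mspace M") (auto simp: Lip0_def)
  qed
  ultimately show "Lip_norm M f = 0 \<longleftrightarrow> f = 0"
    using Lip_norm_ge_0[OF 0] by (metis order_antisym)
  have le: "Lip_norm M (c *\<^sub>R f) \<le> \<bar>c\<bar> * Lip_norm M f" if "f \<in> Lip0 M z" for c f
    by (rule Lip_norm_least) (use Lip_norm_ge_0[OF that] scale[OF that] in auto)
  show "Lip_norm M (c *\<^sub>R f) = \<bar>c\<bar> * Lip_norm M f"
  proof (cases "c = 0")
    case True
    then show ?thesis
      using le[OF f, of c] Lip_norm_ge_0[OF subspace_scale[OF sub f, of c]] by simp
  next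
    case False
    have "\<bar>c\<bar> * Lip_norm M f = \<bar>c\<bar> * Lip_norm M ((1/c) *\<^sub>R (c *\<^sub>R f))"
      using False by simp
    also have "\<dots> \<le> \<bar>c\<bar> * (\<bar>1/c\<bar> * Lip_norm M (c *\<^sub>R f))"
      by (intro mult_left_mono le subspace_scale[OF sub f]) simp
    also have "\<dots> = Lip_norm M (c *\<^sub>R f)" using False by simp
    finally show ?thesis using le[OF f, of c] by simp
  qed
  assume g: "g \<in> Lip0 M z"
  show "Lip_norm M (f + g) \<le> Lip_norm M f + Lip_norm M g"
    by (rule Lip_norm_least) (use Lip_norm_ge_0[OF f] Lip_norm_ge_0[OF g] add[OF f g] in auto)
qed

lemma point_evaluation_in_dual:
  assumes z: "z \<in> mspace M" and x: "x \<in> mspace M"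
  shows "point_evaluation M z x \<in> Lip0_dual M z"
proof -
  interpret normed_carrier "Lip0 M z" "Lip_norm M" using normed_carrier_Lip0[OF z] .
  have "\<bar>f x\<bar> \<le> mdist M x z * Lip_norm M f" if "f \<in> Lip0 M z" for f
    using Lip_norm_bound[OF that x z] that by (simp add: Lip0_def mult.commute)
  then show ?thesis
    unfolding Lip0_dual_def dual_space_def linear_map_on_def point_evaluation_def
    using subspace_add[OF subspace] subspace_scale[OF subspace] by auto
qed

theorem normed_carrier_free_space:
  assumes "z \<in> mspace M" shows "normed_carrier (free_space M z) (free_norm M z)"
proof -
  interpret L: normed_carrier "Lip0 M z" "Lip_norm M" using normed_carrier_Lip0[OF assms] .
  interpret D: normed_carrier "Lip0_dual M z" "free_norm M z"
    unfolding Lip0_dual_def free_norm_def by (rule L.normed_carrier_dual)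
  have Y: "span (point_evaluation M z ` mspace M) \<subseteq> Lip0_dual M z"
    using point_evaluation_in_dual[OF assms] by (intro span_minimal D.subspace) auto
  show ?thesis
    unfolding free_space_def
    by (rule D.normed_carrier_subspace[OF _ D.subspace_closure[OF Y subspace_span]])
       (auto simp: D.in_closure_iff[OF Y])
qed

end

(*
The space is a compact cube in a Banach space failing the approximation property, following
Davie's construction of such a space and Godefroy and Ozawa's transfer to free spaces.

On the summable sequences consider the norm p x = max |x 0| (sup |row k g x|), where the row
functionals on the dyadic levels k and k + 1 are built from two disjoint families of columns of a Hadamard matrix,
chosen by a derandomised sign argument so that all cross correlations are O((3/4)^k). K is the cube
|x i| <= 2 * (1/2)^i with the distance p (x - y).

The unit vectors lift to elements of the free space of K: the average of f over translates of a
smaller cube is differentiable in every coordinate direction, and its derivatives define functionals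
whose linear combinations have norm at most p of the coefficient sequence.

The averages beta k of the diagonal entries of an operator on the lifts of level k equal 1 at the
identity and tend to 0 at every finite rank operator, while beta (k + 1) - beta k is controlled by
the values of the operator on finitely many vectors of norm O((3/4)^k). Rescaling these vectors to
a null sequence gives a compact set on which no finite rank operator is close to the identity.
*)

theory Submission
  imports Defs "HOL-Probability.Infinite_Product_Measure"
begin

section \<open>Balanced orthogonal systems\<close>

text \<open>Point evaluations embed a metric space into its free space in a nonlinear way, so an
  operator on the free space cannot simply be restricted to the sequence space. The lifted unit
  vectors are a linear substitute: they are biorthogonal to the coordinate functions on the cube.
  With lifts and coordinates in the roles of a basis and its functionals, the trace argument runs
  inside the free space itself, and no complemented copy of a Banach space has to be split off and
  completed. The number 3/4 comes from sign balancing: sums of about 2^k bounded terms, under about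
  4^k simultaneous constraints, can be brought down to order sqrt(k 2^k). Any ratio strictly between
  1/sqrt 2 and 1 absorbs the factor sqrt k in the resulting means, at the price of other constants.
  Two consecutive levels have 3 * 2^k indices, which is not a power of two; therefore a Hadamard
  matrix of order 2^(k+2) is used and a quarter of its columns is dropped.\<close>

lemma exp_average_le:
  fixes y :: real
  assumes "\<bar>y\<bar> \<le> 1"
  shows "exp y + exp (- y) \<le> 2 * exp (y\<^sup>2)"
proof -
  \<comment> \<open>Degree two suffices: \<open>exp (- x)\<close> is at most the reciprocal of
    \<open>1 + x\<close>, hence at most 1 - x + x^2, and the linear terms cancel.\<close>
  have *: "exp x + exp (- x) \<le> 2 * (1 + x\<^sup>2)" if "0 \<le> x" "x \<le> 1" for x :: real
  proof -
    have "1 + x > 0" using that by simp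
    have "exp (- x) \<le> 1 / (1 + x)"
      using exp_ge_add_one_self[of x] \<open>1 + x > 0\<close> by (simp add: exp_minus field_simps)
    also have "\<dots> \<le> 1 - x + x\<^sup>2"
      using \<open>1 + x > 0\<close> that by (simp add: field_simps power2_eq_square)
    finally show ?thesis using exp_bound[OF that] by simp
  qed
  have "exp y + exp (- y) \<le> 2 * (1 + y\<^sup>2)"
    using *[of y] *[of "- y"] assms by (cases "y \<ge> 0") auto
  also have "\<dots> \<le> 2 * exp (y\<^sup>2)"
    by (intro mult_left_mono exp_ge_add_one_self) simp
  finally show ?thesis .
qed

text \<open>Method of conditional expectations. The left side is a potential, a sum of terms 2 cosh
  over the constraints. Averaged over the two signs of a new index it grows by at most the factor
  exp(t^2), so one of the signs respects that growth.\<close>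

lemma signs_exponential_sum:
  fixes v :: "'r \<Rightarrow> 'i \<Rightarrow> real"
  assumes "finite I" "\<And>r i. r \<in> R \<Longrightarrow> i \<in> I \<Longrightarrow> \<bar>v r i\<bar> \<le> 1" and t: "0 \<le> t" "t \<le> 1"
  shows "\<exists>\<epsilon>. (\<forall>i. \<epsilon> i \<in> {1, - 1}) \<and>
    (\<Sum>r\<in>R. exp (t * (\<Sum>i\<in>I. \<epsilon> i * v r i)) + exp (- (t * (\<Sum>i\<in>I. \<epsilon> i * v r i))))
      \<le> 2 * real (card R) * exp (t\<^sup>2 * real (card I))"
  using assms(1,2)
proof (induction I rule: finite_induct)
  case empty
  show ?case by (intro exI[of _ "\<lambda>_. 1"]) simp
next
  case (insert i I)
  obtain \<epsilon> :: "'i \<Rightarrow> real" where \<epsilon>: "\<forall>i. \<epsilon> i \<in> {1, - 1}"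
    and le: "(\<Sum>r\<in>R. exp (t * (\<Sum>i\<in>I. \<epsilon> i * v r i)) + exp (- (t * (\<Sum>i\<in>I. \<epsilon> i * v r i))))
      \<le> 2 * real (card R) * exp (t\<^sup>2 * real (card I))"
    using insert by auto
  define s where "s r = t * (\<Sum>i\<in>I. \<epsilon> i * v r i)" for r
  define y where "y r = t * v r i" for r
  define P where "P e = (\<Sum>r\<in>R. exp (s r + e * y r) + exp (- (s r + e * y r)))" for e
  \<comment> \<open>Summing over both signs factorises each term into a product of two hyperbolic
    cosines, old sum and new summand.\<close>
  have "P 1 + P (- 1) = (\<Sum>r\<in>R. (exp (s r) + exp (- s r)) * (exp (y r) + exp (- y r)))"
    unfolding P_def sum.distrib[symmetric]
    by (intro sum.cong refl) (simp add: algebra_simps exp_add[symmetric])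
  also have "\<dots> \<le> (\<Sum>r\<in>R. (exp (s r) + exp (- s r)) * (2 * exp (t\<^sup>2)))"
  proof (intro sum_mono mult_left_mono)
    fix r assume "r \<in> R"
    then have v: "\<bar>v r i\<bar> \<le> 1" using insert.prems by simp
    have "\<bar>y r\<bar> \<le> 1" unfolding y_def abs_mult using v t by (simp add: mult_le_one)
    moreover have "(y r)\<^sup>2 \<le> t\<^sup>2"
      unfolding y_def power_mult_distrib using v t by (simp add: mult_left_le abs_square_le_1)
    ultimately have "exp (y r) + exp (- y r) \<le> 2 * exp ((y r)\<^sup>2)" "exp ((y r)\<^sup>2) \<le> exp (t\<^sup>2)"
      by (auto intro: exp_average_le)
    then show "exp (y r) + exp (- y r) \<le> 2 * exp (t\<^sup>2)"
      by (rule order_trans[OF _ mult_left_mono]) simp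
  qed (simp add: add_nonneg_nonneg)
  also have "\<dots> \<le> (2 * real (card R) * exp (t\<^sup>2 * real (card I))) * (2 * exp (t\<^sup>2))"
    unfolding sum_distrib_right[symmetric] using le by (intro mult_right_mono) (auto simp: s_def)
  also have "\<dots> = 2 * (2 * real (card R) * exp (t\<^sup>2 * real (card (insert i I))))"
    using insert.hyps by (simp add: algebra_simps exp_add)
  finally have "P 1 \<le> 2 * real (card R) * exp (t\<^sup>2 * real (card (insert i I))) \<or>
      P (- 1) \<le> 2 * real (card R) * exp (t\<^sup>2 * real (card (insert i I)))"
    by linarith
  then obtain e where e: "e \<in> {1, - 1 :: real}"
    and Pe: "P e \<le> 2 * real (card R) * exp (t\<^sup>2 * real (card (insert i I)))"
    by blast
  have "s r + e * y r = t * (\<Sum>j\<in>insert i I. (\<epsilon>(i := e)) j * v r j)" for r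
  proof -
    have "(\<Sum>j\<in>I. (\<epsilon>(i := e)) j * v r j) = (\<Sum>j\<in>I. \<epsilon> j * v r j)"
      using insert.hyps by (intro sum.cong) auto
    then have eq: "(\<Sum>j\<in>insert i I. (\<epsilon>(i := e)) j * v r j) = e * v r i + (\<Sum>j\<in>I. \<epsilon> j * v r j)"
      unfolding sum.insert[OF insert.hyps] by (simp only: fun_upd_same)
    have "s r + e * y r = t * (e * v r i + (\<Sum>j\<in>I. \<epsilon> j * v r j))"
      unfolding s_def y_def distrib_left by (simp only: mult.left_commute add.commute)
    also note eq[symmetric]
    finally show ?thesis .
  qed
  then show ?case
    using Pe \<epsilon> e unfolding P_def by (intro exI[of _ "\<epsilon>(i := e)"]) auto
qed

text \<open>A single term of the potential dominates exp(t |S|), so logarithms turn the bound on the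
  potential into one on every sum. The parameter \<open>t\<close> trades the two error terms against
  each other.\<close>

lemma balancing_signs:
  fixes v :: "'r \<Rightarrow> 'i \<Rightarrow> real"
  assumes I: "finite I" and R: "finite R" and v: "\<And>r i. r \<in> R \<Longrightarrow> i \<in> I \<Longrightarrow> \<bar>v r i\<bar> \<le> 1"
    and t: "0 < t" "t \<le> 1"
  obtains \<epsilon> where "\<And>i. \<epsilon> i \<in> {1, - 1}"
    "\<And>r. r \<in> R \<Longrightarrow> \<bar>\<Sum>i\<in>I. \<epsilon> i * v r i\<bar> \<le> ln (2 * real (card R)) / t + t * real (card I)"
proof -
  define P where "P \<epsilon> = (\<Sum>r\<in>R. exp (t * (\<Sum>i\<in>I. \<epsilon> i * v r i)) + exp (- (t * (\<Sum>i\<in>I. \<epsilon> i * v r i))))" for \<epsilon>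
  have "\<exists>\<epsilon>. (\<forall>i. \<epsilon> i \<in> {1, - 1}) \<and> P \<epsilon> \<le> 2 * real (card R) * exp (t\<^sup>2 * real (card I))"
    unfolding P_def using I v t by (intro signs_exponential_sum) auto
  then obtain \<epsilon> :: "'i \<Rightarrow> real" where \<epsilon>: "\<forall>i. \<epsilon> i \<in> {1, - 1}"
    and le: "P \<epsilon> \<le> 2 * real (card R) * exp (t\<^sup>2 * real (card I))"
    by blast
  have "\<bar>\<Sum>i\<in>I. \<epsilon> i * v r i\<bar> \<le> ln (2 * real (card R)) / t + t * real (card I)"
    if r: "r \<in> R" for r
  proof -
    define S where "S = (\<Sum>i\<in>I. \<epsilon> i * v r i)"
    have card: "real (card R) > 0" using r R by (auto simp: card_gt_0_iff)
    define g where "g r = exp (t * (\<Sum>i\<in>I. \<epsilon> i * v r i)) + exp (- (t * (\<Sum>i\<in>I. \<epsilon> i * v r i)))" for r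
    have "exp (t * \<bar>S\<bar>) \<le> exp (t * S) + exp (- (t * S))"
      by (cases "S \<ge> 0") simp_all
    also have "\<dots> = g r" by (simp add: g_def S_def)
    also have "\<dots> \<le> (\<Sum>r\<in>R. g r)"
      using r R by (intro member_le_sum) (simp_all add: g_def add_nonneg_nonneg)
    also have "\<dots> \<le> exp (ln (2 * real (card R)) + t\<^sup>2 * real (card I))"
      using le card by (simp add: exp_add g_def P_def)
    finally have "t * \<bar>S\<bar> \<le> ln (2 * real (card R)) + t\<^sup>2 * real (card I)" by simp
    then show ?thesis using t unfolding S_def[symmetric]
      by (simp add: field_simps power2_eq_square)
  qed
  with \<epsilon> show thesis using that by blast
qed

text \<open>Taking one member of each consecutive pair differs from taking half of both by a signed
  sum of half differences, so balanced signs select half of the functions with all sums nearly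
  halved.\<close>

lemma balanced_halving:
  fixes F :: "nat \<Rightarrow> 'r \<Rightarrow> real"
  assumes R: "finite R" and F: "\<And>c r. r \<in> R \<Longrightarrow> c < 2 * n \<Longrightarrow> \<bar>F c r\<bar> \<le> 1"
    and t: "0 < t" "t \<le> 1"
  obtains s where "\<And>i. s i \<in> {2 * i, 2 * i + 1}"
    "\<And>r. r \<in> R \<Longrightarrow> \<bar>(\<Sum>i<n. F (s i) r) - (\<Sum>c<2 * n. F c r) / 2\<bar> \<le> ln (2 * real (card R)) / t + t * real n"
proof -
  define v where "v r i = (F (2 * i) r - F (2 * i + 1) r) / 2" for r i
  have "\<bar>v r i\<bar> \<le> 1" if "r \<in> R" "i \<in> {..<n}" for r i
    using F[OF that(1), of "2 * i"] F[OF that(1), of "2 * i + 1"] that(2) unfolding v_def by auto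
  then obtain \<epsilon> where \<epsilon>: "\<And>i. \<epsilon> i \<in> {1, - 1}"
    and le: "\<And>r. r \<in> R \<Longrightarrow> \<bar>\<Sum>i<n. \<epsilon> i * v r i\<bar> \<le> ln (2 * real (card R)) / t + t * real n"
    using balancing_signs[of "{..<n}" R v t] R t by (metis card_lessThan finite_lessThan)
  define s where "s i = (if \<epsilon> i = 1 then 2 * i else 2 * i + 1)" for i
  have "(\<Sum>i<n. F (s i) r) - (\<Sum>c<2 * n. F c r) / 2 = (\<Sum>i<n. \<epsilon> i * v r i)" for r
  proof -
    have "(\<Sum>c<2 * n. F c r) = (\<Sum>i<n. F (2 * i) r + F (2 * i + 1) r)"
      by (induction n) (auto simp: algebra_simps)
    moreover have "F (s i) r - (F (2 * i) r + F (2 * i + 1) r) / 2 = \<epsilon> i * v r i" for i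
      using \<epsilon>[of i] unfolding s_def v_def by (auto simp: field_simps)
    ultimately show ?thesis by (simp add: sum_divide_distrib sum_subtractf[symmetric])
  qed
  then show thesis using le by (intro that[of s]) (auto simp: s_def)
qed

section \<open>Sylvester matrices and the selection of their columns\<close>

text \<open>Sylvester's construction: for indices below \<open>2 ^ n\<close> the entry is -1 or 1
  according to the parity of the number of binary digits 1 that \<open>i\<close> and
  \<open>j\<close> share.\<close>

fun hadamard :: "nat \<Rightarrow> nat \<Rightarrow> nat \<Rightarrow> real" where
  "hadamard 0 i j = 1"
| "hadamard (Suc n) i j =
    hadamard n (i mod 2 ^ n) (j mod 2 ^ n) * (if 2 ^ n \<le> i \<and> 2 ^ n \<le> j then - 1 else 1)"

lemma hadamard_values: "hadamard n i j \<in> {1, - 1}"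
  by (induction n arbitrary: i j) auto

lemma sum_lessThan_double: "(\<Sum>k<2 * (m::nat). f k) = (\<Sum>k<m. f k + f (m + k) :: real)"
proof -
  have "(\<Sum>k<m + m. f k) = (\<Sum>k<m. f k) + (\<Sum>k<m. f (m + k))"
    by (subst lessThan_atLeast0, subst sum.atLeastLessThan_concat[of 0 m "m + m", symmetric])
      (auto simp: sum.shift_bounds_nat_ivl[of f 0 m m, simplified] lessThan_atLeast0 add.commute)
  then show ?thesis by (simp add: mult_2 sum.distrib)
qed

lemma hadamard_orthogonal:
  assumes "i < 2 ^ n" "j < 2 ^ n"
  shows "(\<Sum>k<2 ^ n. hadamard n i k * hadamard n j k) = (if i = j then 2 ^ n else 0)"
  using assms
proof (induction n arbitrary: i j)
  case 0
  then show ?case by simp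
next
  case (Suc n)
  let ?i = "i mod 2 ^ n" and ?j = "j mod 2 ^ n"
  define a where "a = (if 2 ^ n \<le> i then - 1 else 1 :: real)"
  define b where "b = (if 2 ^ n \<le> j then - 1 else 1 :: real)"
  \<comment> \<open>The second half of each row repeats the first up to the sign given by the top
    digit, so the two halves together give the factor \<open>1 + a * b\<close>.\<close>
  have "(\<Sum>k<2 ^ Suc n. hadamard (Suc n) i k * hadamard (Suc n) j k)
      = (\<Sum>k<2 ^ n. hadamard n ?i k * hadamard n ?j k * (1 + a * b))"
    unfolding power_Suc sum_lessThan_double
    by (intro sum.cong refl) (auto simp: a_def b_def)
  also have "\<dots> = (if ?i = ?j then 2 ^ n else 0) * (1 + a * b)"
    unfolding sum_distrib_right[symmetric] by (subst Suc.IH) auto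
  also have "\<dots> = (if i = j then 2 ^ Suc n else 0)"
  proof (cases "2 ^ n \<le> i \<longleftrightarrow> 2 ^ n \<le> j")
    case True
    then have "?i = ?j \<longleftrightarrow> i = j"
      using Suc.prems by (cases "2 ^ n \<le> i") (auto simp: le_mod_geq)
    then show ?thesis using True by (auto simp: a_def b_def)
  next
    case False
    then show ?thesis by (auto simp: a_def b_def)
  qed
  finally show ?case .
qed

text \<open>The ratio 9/8 is 2 * (3/4)^2, and it exceeds 1 because 3/4 exceeds 1/sqrt 2.\<close>

lemma linear_le_geometric: "2 * real k + 16 \<le> 16 * (9 / 8) ^ k"
  using Bernoulli_inequality[of "1/8 :: real" k] by simp

text \<open>With \<open>t\<close> set to (3/4)^k, the logarithmic error of
  \<open>balancing_signs\<close> gets the same order as its other term. \<open>N\<close> stands for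
  twice the number of constraints, which is a constant times 4^k.\<close>

lemma balancing_error_le:
  assumes "real N \<le> 2 ^ (2 * k + 16)" "0 < N"
  shows "ln (real N) / (3 / 4) ^ k \<le> 16 * ((3 / 4) ^ k * 2 ^ k)"
proof -
  have "ln (real N) \<le> ln (2 ^ (2 * k + 16))"
    using assms by (subst ln_le_cancel_iff) auto
  also have "\<dots> = (2 * real k + 16) * ln 2"
    by (subst ln_realpow) auto
  also have "\<dots> \<le> (2 * real k + 16) * 1"
    using ln_2_less_1 by (intro mult_left_mono) auto
  also have "\<dots> \<le> 16 * (9 / 8) ^ k"
    using linear_le_geometric[of k] by simp
  also have "(9 / 8 :: real) ^ k = (3 / 4) ^ k * 2 ^ k * (3 / 4) ^ k"
    by (simp flip: power_mult_distrib)
  finally show ?thesis by (simp add: divide_le_eq)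
qed

text \<open>The last clause compares two mean correlations instead of bounding each of them: for
  \<open>g = h\<close> both means equal 1, so only their difference can be small.\<close>

definition balanced_systems :: "nat \<Rightarrow> (nat \<Rightarrow> nat \<Rightarrow> real) \<Rightarrow> (nat \<Rightarrow> nat \<Rightarrow> real) \<Rightarrow> bool" where
  "balanced_systems k \<sigma> \<tau> \<longleftrightarrow>
    (\<forall>j g. \<bar>\<sigma> j g\<bar> = 1) \<and> (\<forall>j g. \<bar>\<tau> j g\<bar> = 1) \<and>
    (\<forall>i<2 ^ k. \<forall>j<2 ^ k. (\<Sum>g<2 ^ (k + 2). \<sigma> i g * \<sigma> j g) = (if i = j then 2 ^ (k + 2) else 0)) \<and>
    (\<forall>i<2 ^ (k + 1). \<forall>j<2 ^ (k + 1). (\<Sum>g<2 ^ (k + 2). \<tau> i g * \<tau> j g) = (if i = j then 2 ^ (k + 2) else 0)) \<and>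
    (\<forall>i<2 ^ k. \<forall>j<2 ^ (k + 1). (\<Sum>g<2 ^ (k + 2). \<sigma> i g * \<tau> j g) = 0) \<and>
    (\<forall>g<2 ^ (k + 2). \<forall>h<2 ^ (k + 2).
      \<bar>(\<Sum>j<2 ^ (k + 1). \<tau> j g * \<tau> j h) / 2 ^ (k + 1) - (\<Sum>j<2 ^ k. \<sigma> j g * \<sigma> j h) / 2 ^ k\<bar> \<le> 35 * (3 / 4) ^ k)"

lemma balanced_systemsD:
  assumes "balanced_systems k \<sigma> \<tau>"
  shows "\<bar>\<sigma> j g\<bar> = 1" "\<bar>\<tau> j g\<bar> = 1"
    "i < 2 ^ k \<Longrightarrow> j < 2 ^ k \<Longrightarrow> (\<Sum>g<2 ^ (k + 2). \<sigma> i g * \<sigma> j g) = (if i = j then 2 ^ (k + 2) else 0)"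
    "i < 2 ^ (k + 1) \<Longrightarrow> j < 2 ^ (k + 1) \<Longrightarrow> (\<Sum>g<2 ^ (k + 2). \<tau> i g * \<tau> j g) = (if i = j then 2 ^ (k + 2) else 0)"
    "i < 2 ^ k \<Longrightarrow> j < 2 ^ (k + 1) \<Longrightarrow> (\<Sum>g<2 ^ (k + 2). \<sigma> i g * \<tau> j g) = 0"
    "g < 2 ^ (k + 2) \<Longrightarrow> h < 2 ^ (k + 2) \<Longrightarrow>
      \<bar>(\<Sum>j<2 ^ (k + 1). \<tau> j g * \<tau> j h) / 2 ^ (k + 1) - (\<Sum>j<2 ^ k. \<sigma> j g * \<sigma> j h) / 2 ^ k\<bar> \<le> 35 * (3 / 4) ^ k"
  using assms unfolding balanced_systems_def by simp_all

text \<open>Halving twice: a first selection gives \<open>\<tau>\<close>, and halving its complement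
  gives \<open>\<sigma>\<close>, so both receive a nearly proportional share of every correlation
  sum. In units of (3/4)^k the two errors are 16 + 2 and 16 + 1, in total 35.\<close>

lemma balanced_systems_exist: "\<exists>\<sigma> \<tau>. balanced_systems k \<sigma> \<tau>"
proof -
  define D :: nat where "D = 2 ^ k"
  define t :: real where "t = (3 / 4) ^ k"
  have t: "0 < t" "t \<le> 1" by (auto simp: t_def power_le_one)
  define H where "H c g = hadamard (k + 2) c g" for c g
  define R where "R = {..<4 * D} \<times> {..<4 * D}"
  have N: "4 * D = 2 ^ (k + 2)" and N2: "2 * D = 2 ^ (k + 1)" by (auto simp: D_def)
  have "real D * real D = 2 ^ (2 * k)" by (simp add: D_def mult_2 power_add)
  then have R: "finite R" "2 * real (card R) \<le> 2 ^ (2 * k + 16)" "0 < 2 * card R"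
    by (simp_all add: R_def power_add) (simp add: D_def)
  have B: "ln (2 * real (card R)) / t \<le> 16 * (t * D)"
    using balancing_error_le[of "2 * card R" k] R unfolding t_def D_def by simp
  have orth: "(\<Sum>g<4 * D. H c g * H d g) = (if c = d then 4 * D else 0)" if "c < 4 * D" "d < 4 * D" for c d
    using hadamard_orthogonal[of c "k + 2" d] that unfolding H_def N by simp
  have H1: "H c g \<in> {1, - 1}" for c g unfolding H_def by (rule hadamard_values)
  define F where "F c = (\<lambda>(g, h). H c g * H c h)" for c
  have F: "\<bar>F c r\<bar> \<le> 1" for c r
    using H1[of c "fst r"] H1[of c "snd r"] by (cases r) (auto simp: F_def)
  obtain s where s: "\<And>i. s i \<in> {2 * i, 2 * i + 1}"
    and s_le: "\<And>r. r \<in> R \<Longrightarrow> \<bar>(\<Sum>i<2 * D. F (s i) r) - (\<Sum>c<2 * (2 * D). F c r) / 2\<bar>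
      \<le> ln (2 * real (card R)) / t + t * real (2 * D)"
    using balanced_halving[of R "2 * D" F t] R t F by blast
  \<comment> \<open>The members of a pair add up to \<open>4 * i + 1\<close>, so \<open>s'\<close>
    picks the other one.\<close>
  define s' where "s' i = 4 * i + 1 - s i" for i
  have s': "s' i \<in> {2 * i, 2 * i + 1}" "s' i \<noteq> s i" for i
    using s[of i] by (auto simp: s'_def)
  have s'_sum: "(\<Sum>i<n. F (s' i) r) = (\<Sum>c<2 * n. F c r) - (\<Sum>i<n. F (s i) r)" for r n
  proof (induction n)
    case (Suc n)
    have "F (s n) r + F (s' n) r = F (2 * n) r + F (2 * n + 1) r"
      using s[of n] by (auto simp: s'_def)
    then show ?case using Suc by simp
  qed simp
  obtain u where u: "\<And>i. u i \<in> {2 * i, 2 * i + 1}"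
    and u_le: "\<And>r. r \<in> R \<Longrightarrow> \<bar>(\<Sum>i<D. F (s' (u i)) r) - (\<Sum>c<2 * D. F (s' c) r) / 2\<bar>
      \<le> ln (2 * real (card R)) / t + t * real D"
    using balanced_halving[of R D "\<lambda>c. F (s' c)" t] R t F by blast
  define \<tau> where "\<tau> j = H (s j)" for j
  define \<sigma> where "\<sigma> j = H (s' (u j))" for j
  \<comment> \<open>Division by 2 recovers the pair from the selected member; injectivity and
    disjointness of the selections follow.\<close>
  have half: "c div 2 = i" if "c \<in> {2 * i, 2 * i + 1}" for c i :: nat using that by auto
  have s_inj: "s i = s j \<longleftrightarrow> i = j" for i j using half[OF s] by metis
  have u_inj: "s' (u i) = s' (u j) \<longleftrightarrow> i = j" for i j using half[OF s'(1)] half[OF u] by metis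
  have su: "s' (u i) \<noteq> s j" for i j using half[OF s'(1)] half[OF s] s'(2) by metis
  have s_lt: "s i < 4 * D" if "i < 2 * D" for i using s[of i] that by auto
  have u_lt: "s' (u i) < 4 * D" if "i < D" for i using s'(1)[of "u i"] u[of i] that by auto
  have "\<bar>(\<Sum>j<2 * D. \<tau> j g * \<tau> j h) / (2 * D) - (\<Sum>j<D. \<sigma> j g * \<sigma> j h) / D\<bar> \<le> 35 * t"
    if "g < 4 * D" "h < 4 * D" for g h
  proof -
    have r: "(g, h) \<in> R" using that by (simp add: R_def)
    define S where "S = (\<Sum>c<4 * D. F c (g, h))"
    define a where "a = (\<Sum>i<2 * D. F (s i) (g, h))"
    define b where "b = (\<Sum>i<D. F (s' (u i)) (g, h))"
    have a: "\<bar>a - S / 2\<bar> \<le> 16 * (t * D) + 2 * (t * D)"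
      using s_le[OF r] B unfolding a_def S_def by simp
    have b: "\<bar>b - (S - a) / 2\<bar> \<le> 16 * (t * D) + t * D"
      using u_le[OF r] B s'_sum[of "(g, h)" "2 * D"] unfolding a_def b_def S_def by simp
    \<comment> \<open>Both sums are compared with the same total \<open>S\<close>, which
      cancels.\<close>
    have "a / 2 - b = (a - S / 2) - (b - (S - a) / 2)"  by (simp add: field_simps)
    then have "\<bar>a / 2 - b\<bar> \<le> 35 * (t * D)" using a b by linarith
    moreover have "a / (2 * D) - b / D = (a / 2 - b) / D" by (simp add: D_def field_simps)
    ultimately have "\<bar>a / (2 * D) - b / D\<bar> \<le> 35 * t"
      by (simp add: abs_divide divide_le_eq D_def mult.assoc)
    then show ?thesis by (simp add: a_def b_def F_def \<tau>_def \<sigma>_def)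
  qed
  moreover have "\<bar>\<sigma> j g\<bar> = 1" "\<bar>\<tau> j g\<bar> = 1" for j g
    using H1[of "s j" g] H1[of "s' (u j)" g] by (auto simp: \<tau>_def \<sigma>_def)
  moreover have "(\<Sum>g<4 * D. \<sigma> i g * \<sigma> j g) = (if i = j then 4 * D else 0)" if "i < D" "j < D" for i j
    unfolding \<sigma>_def using orth[OF u_lt[OF that(1)] u_lt[OF that(2)]] u_inj by simp
  moreover have "(\<Sum>g<4 * D. \<tau> i g * \<tau> j g) = (if i = j then 4 * D else 0)" if "i < 2 * D" "j < 2 * D" for i j
    unfolding \<tau>_def using orth[OF s_lt[OF that(1)] s_lt[OF that(2)]] s_inj by simp
  moreover have "(\<Sum>g<4 * D. \<sigma> i g * \<tau> j g) = 0" if "i < D" "j < 2 * D" for i j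
    unfolding \<sigma>_def \<tau>_def using orth[OF u_lt[OF that(1)] s_lt[OF that(2)]] su by simp
  ultimately have "balanced_systems k \<sigma> \<tau>"
    unfolding balanced_systems_def N[symmetric] N2[symmetric] D_def[symmetric] t_def[symmetric]
    by (simp add: D_def)
  then show ?thesis by blast
qed

text \<open>Systems of different levels are unrelated, so the correlation of \<open>\<tau>\<close>
  with the next \<open>\<sigma>\<close> has to be made small separately. Signs on the columns of
  \<open>\<sigma>\<close> achieve it: they enter its own correlations squared and preserve
  orthogonality.\<close>

theorem davie_systems:
  obtains \<sigma> \<tau> :: "nat \<Rightarrow> nat \<Rightarrow> nat \<Rightarrow> real"
  where "\<And>k. balanced_systems k (\<sigma> k) (\<tau> k)"
    "\<And>k g h. g < 2 ^ (k + 2) \<Longrightarrow> h < 2 ^ (k + 3) \<Longrightarrow>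
      \<bar>(\<Sum>j<2 ^ (k + 1). \<tau> k j g * \<sigma> (k + 1) j h) / 2 ^ (k + 1)\<bar> \<le> 35 * (3 / 4) ^ k"
proof -
  obtain \<sigma> \<tau> :: "nat \<Rightarrow> nat \<Rightarrow> nat \<Rightarrow> real" where *: "\<And>k. balanced_systems k (\<sigma> k) (\<tau> k)"
    using balanced_systems_exist by metis
  have \<sigma>1: "\<bar>\<sigma> k j g\<bar> = 1" and \<tau>1: "\<bar>\<tau> k j g\<bar> = 1" for k j g
    by (rule balanced_systemsD[OF *])+
  define Q where "Q k \<theta> \<longleftrightarrow> (\<forall>j. \<theta> j \<in> {1, - 1 :: real}) \<and> (\<forall>g<2 ^ (k + 2). \<forall>h<2 ^ (k + 3).
      \<bar>(\<Sum>j<2 ^ (k + 1). \<tau> k j g * (\<theta> j * \<sigma> (k + 1) j h)) / 2 ^ (k + 1)\<bar> \<le> 35 * (3 / 4) ^ k)" for k \<theta>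
  have "\<exists>\<theta>. Q k \<theta>" for k
  proof -
    define R :: "(nat \<times> nat) set" where "R = {..<2 ^ (k + 2)} \<times> {..<2 ^ (k + 3)}"
    define t :: real where "t = (3 / 4) ^ k"
    have t: "0 < t" "t \<le> 1" by (auto simp: t_def power_le_one)
    define v where "v = (\<lambda>(g, h) j. \<tau> k j g * \<sigma> (k + 1) j h)"
    have v: "\<bar>v r j\<bar> \<le> 1" for r j by (cases r) (simp add: v_def abs_mult \<sigma>1 \<tau>1)
    have "2 ^ k * 2 ^ k = (2 :: real) ^ (2 * k)" by (simp add: mult_2 power_add)
    then have R: "finite R" "2 * real (card R) \<le> 2 ^ (2 * k + 16)" "0 < 2 * card R"
      by (simp_all add: R_def power_add)
    obtain \<theta> :: "nat \<Rightarrow> real" where \<theta>: "\<And>j. \<theta> j \<in> {1, - 1}"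
      and le: "\<And>r. r \<in> R \<Longrightarrow> \<bar>\<Sum>j<2 ^ (k + 1). \<theta> j * v r j\<bar>
        \<le> ln (2 * real (card R)) / t + t * real (card {..<2 ^ (k + 1) :: nat})"
      using balancing_signs[of "{..<2 ^ (k + 1)}" R v t] R v t by blast
    have "\<bar>(\<Sum>j<2 ^ (k + 1). \<tau> k j g * (\<theta> j * \<sigma> (k + 1) j h)) / 2 ^ (k + 1)\<bar> \<le> 35 * t"
      if "g < 2 ^ (k + 2)" "h < 2 ^ (k + 3)" for g h
    proof -
      have "(g, h) \<in> R" using that by (simp add: R_def)
      moreover have "(\<Sum>j<2 ^ (k + 1). \<theta> j * v (g, h) j) = (\<Sum>j<2 ^ (k + 1). \<tau> k j g * (\<theta> j * \<sigma> (k + 1) j h))"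
        by (intro sum.cong refl) (simp add: v_def)
      moreover have "ln (2 * real (card R)) / t \<le> 16 * (t * 2 ^ k)"
        using balancing_error_le[of "2 * card R" k] R by (simp add: t_def)
      ultimately have "\<bar>\<Sum>j<2 ^ (k + 1). \<tau> k j g * (\<theta> j * \<sigma> (k + 1) j h)\<bar>
          \<le> 16 * (t * 2 ^ k) + t * 2 ^ (k + 1)"
        using le[of "(g, h)"] by simp
      \<comment> \<open>The left side equals \<open>9 * t * 2 ^ (k + 1)\<close>; it is relaxed to
        share the constant of the balanced systems.\<close>
      also have "\<dots> \<le> 35 * t * 2 ^ (k + 1)" using t by simp
      finally show ?thesis by (simp add: abs_divide divide_le_eq)
    qed
    then have "\<forall>g<2 ^ (k + 2). \<forall>h<2 ^ (k + 3).
      \<bar>(\<Sum>j<2 ^ (k + 1). \<tau> k j g * (\<theta> j * \<sigma> (k + 1) j h)) / 2 ^ (k + 1)\<bar> \<le> 35 * (3 / 4) ^ k"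
      unfolding t_def by (intro allI impI)
    moreover have "\<forall>j. \<theta> j \<in> {1, - 1}" using \<theta> by (intro allI)
    ultimately show ?thesis unfolding Q_def by (intro exI[of _ \<theta>] conjI)
  qed
  then obtain \<theta> :: "nat \<Rightarrow> nat \<Rightarrow> real" where Q: "\<And>k. Q k (\<theta> k)" by metis
  then have \<theta>: "\<theta> k j \<in> {1, - 1}" for k j unfolding Q_def by blast
  have \<theta>_le: "\<bar>(\<Sum>j<2 ^ (k + 1). \<tau> k j g * (\<theta> k j * \<sigma> (k + 1) j h)) / 2 ^ (k + 1)\<bar> \<le> 35 * (3 / 4) ^ k"
    if "g < 2 ^ (k + 2)" "h < 2 ^ (k + 3)" for k g h
    using Q[of k] that unfolding Q_def by (elim conjE allE impE)
  \<comment> \<open>The signs \<open>\<theta> k\<close> couple level \<open>k\<close> to level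
    \<open>k + 1\<close>, so level \<open>k\<close> takes those of index \<open>k - 1\<close>. At
    level 0 this is again \<open>\<theta> 0\<close>, where any signs would do.\<close>
  define \<sigma>' where "\<sigma>' k j g = \<theta> (k - 1) j * \<sigma> k j g" for k j g
  have \<theta>2: "\<theta> k j * \<theta> k j = 1" and \<theta>1: "\<bar>\<theta> k j\<bar> = 1" for k j using \<theta>[of k j] by auto
  have "\<sigma>' k j g * \<sigma>' k j h = (\<theta> (k - 1) j * \<theta> (k - 1) j) * (\<sigma> k j g * \<sigma> k j h)" for k j g h
    by (simp add: \<sigma>'_def mult_ac)
  then have square: "\<sigma>' k j g * \<sigma>' k j h = \<sigma> k j g * \<sigma> k j h" for k j g h by (simp add: \<theta>2)
  have \<sigma>\<sigma>: "(\<Sum>g<2 ^ (k + 2). \<sigma>' k i g * \<sigma>' k j g) = (if i = j then 2 ^ (k + 2) else 0)"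
    if "i < 2 ^ k" "j < 2 ^ k" for k i j
  proof -
    have "(\<Sum>g<2 ^ (k + 2). \<sigma>' k i g * \<sigma>' k j g) =
        \<theta> (k - 1) i * \<theta> (k - 1) j * (\<Sum>g<2 ^ (k + 2). \<sigma> k i g * \<sigma> k j g)"
      by (simp add: \<sigma>'_def sum_distrib_left mult_ac)
    then show ?thesis using balanced_systemsD(3)[OF * that] by (simp add: \<theta>2 del: power_Suc)
  qed
  have \<sigma>\<tau>: "(\<Sum>g<2 ^ (k + 2). \<sigma>' k i g * \<tau> k j g) = 0"
    if "i < 2 ^ k" "j < 2 ^ (k + 1)" for k i j
  proof -
    have "(\<Sum>g<2 ^ (k + 2). \<sigma>' k i g * \<tau> k j g) =
        \<theta> (k - 1) i * (\<Sum>g<2 ^ (k + 2). \<sigma> k i g * \<tau> k j g)"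
      by (simp add: \<sigma>'_def sum_distrib_left mult_ac)
    then show ?thesis unfolding balanced_systemsD(5)[OF * that] by simp
  qed
  have \<sigma>'1: "\<bar>\<sigma>' k j g\<bar> = 1" for k j g by (simp add: \<sigma>'_def abs_mult \<sigma>1 \<theta>1)
  have "balanced_systems k (\<sigma>' k) (\<tau> k)" for k
    unfolding balanced_systems_def square
    by (rule conjI allI impI \<sigma>'1 \<sigma>\<sigma> \<sigma>\<tau> balanced_systemsD[OF *] | assumption)+
  moreover have "\<bar>(\<Sum>j<2 ^ (k + 1). \<tau> k j g * \<sigma>' (k + 1) j h) / 2 ^ (k + 1)\<bar> \<le> 35 * (3 / 4) ^ k"
    if "g < 2 ^ (k + 2)" "h < 2 ^ (k + 3)" for k g h
    unfolding \<sigma>'_def add_diff_cancel_right' by (rule \<theta>_le[OF that])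
  ultimately show thesis by (rule that)
qed

section \<open>Free spaces over compact metric spaces\<close>

lemma sum_fun_apply: "(\<Sum>a\<in>A. g a) x = (\<Sum>a\<in>A. g a x)"
  for g :: "'a \<Rightarrow> 'b \<Rightarrow> 'c::comm_monoid_add"
  by (induction A rule: infinite_finite_induct) auto

text \<open>Distance functions, shifted to vanish at the base point, express balls through members
  of \<open>Lip0\<close>; in this way measurability along Lipschitz functions yields measurable
  preimages of balls.\<close>

lemma Lip0_distance:
  fixes M :: "'a metric"
  assumes "z \<in> mspace M" "x \<in> mspace M"
  shows "(\<lambda>y. if y \<in> mspace M then mdist M x y - mdist M x z else 0) \<in> Lip0 M z"
proof (rule Lip0_I[where B = 1])
  fix a b assume ab: "a \<in> mspace M" "b \<in> mspace M"
  have "mdist M x a \<le> mdist M x b + mdist M b a" "mdist M x b \<le> mdist M x a + mdist M a b"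
    using ab assms by (auto intro: Metric_space.triangle[OF Metric_space_mspace_mdist])
  then show "\<bar>(if a \<in> mspace M then mdist M x a - mdist M x z else 0) -
      (if b \<in> mspace M then mdist M x b - mdist M x z else 0)\<bar> \<le> 1 * mdist M a b"
    using ab Metric_space.commute[OF Metric_space_mspace_mdist, of M b a] by auto
qed (use assms in auto)

lemma compact_finite_net:
  fixes M :: "'a metric"
  assumes "compact_space (mtopology_of M)" "0 < e"
  obtains C where "finite C" "C \<subseteq> mspace M" "\<And>y. y \<in> mspace M \<Longrightarrow> \<exists>x\<in>C. mdist M x y < e"
proof -
  interpret Metric_space "mspace M" "mdist M" by (rule Metric_space_mspace_mdist)
  have "mtotally_bounded (mspace M)"
    using assms(1) unfolding mtopology_of_def compact_space_eq_mcomplete_mtotally_bounded by simp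
  from this[unfolded mtotally_bounded_def, rule_format, OF assms(2)]
  obtain C where C: "finite C" "C \<subseteq> mspace M" "mspace M \<subseteq> (\<Union>x\<in>C. mball x e)"
    by blast
  have "\<exists>x\<in>C. mdist M x y < e" if "y \<in> mspace M" for y
  proof -
    from C(3) that obtain x where "x \<in> C" "y \<in> mball x e" by blast
    then show ?thesis by auto
  qed
  with C(1,2) show thesis by (rule that)
qed

lemma Lip0_bounded:
  assumes "compact_space (mtopology_of M)" "z \<in> mspace M"
  obtains D where "0 \<le> D" "\<And>f x. f \<in> Lip0 M z \<Longrightarrow> x \<in> mspace M \<Longrightarrow> \<bar>f x\<bar> \<le> D * Lip_norm M f"
proof -
  interpret Metric_space "mspace M" "mdist M" by (rule Metric_space_mspace_mdist)
  have "mbounded (mspace M)"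
    using assms(1) unfolding mtopology_of_def compact_space_eq_mcomplete_mtotally_bounded
    by (auto intro: mtotally_bounded_imp_mbounded)
  then obtain D where D: "0 \<le> D" "\<And>x. x \<in> mspace M \<Longrightarrow> mdist M x z \<le> D"
    unfolding mbounded_alt_pos using assms(2) by (metis less_imp_le)
  have "\<bar>f x\<bar> \<le> D * Lip_norm M f" if "f \<in> Lip0 M z" "x \<in> mspace M" for f x
  proof -
    have "\<bar>f x\<bar> \<le> Lip_norm M f * mdist M x z"
      using Lip_norm_bound[OF that(1,2) assms(2)] that(1) by (simp add: Lip0_def)
    also have "\<dots> \<le> Lip_norm M f * D"
      using D(2)[OF that(2)] Lip_norm_ge_0[OF that(1)] by (rule mult_left_mono)
    finally show ?thesis by (simp add: mult.commute)
  qed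
  with D(1) show thesis by (rule that)
qed

lemma span_point_evaluation_subset:
  assumes "z \<in> mspace M"
  shows "span (point_evaluation M z ` mspace M) \<subseteq> Lip0_dual M z"
proof (rule span_minimal)
  interpret normed_carrier "Lip0 M z" "Lip_norm M" using normed_carrier_Lip0[OF assms] .
  show "subspace (Lip0_dual M z)" unfolding Lip0_dual_def by (rule subspace_dual)
qed (use point_evaluation_in_dual[OF assms] in auto)

lemma in_free_space_iff:
  assumes "z \<in> mspace M"
  shows "\<mu> \<in> free_space M z \<longleftrightarrow> \<mu> \<in> Lip0_dual M z \<and>
    (\<forall>e>0. \<exists>\<nu>\<in>span (point_evaluation M z ` mspace M). free_norm M z (\<mu> - \<nu>) < e)"
proof -
  interpret L: normed_carrier "Lip0 M z" "Lip_norm M" using normed_carrier_Lip0[OF assms] .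
  interpret D: normed_carrier "Lip0_dual M z" "free_norm M z"
    unfolding Lip0_dual_def free_norm_def by (rule L.normed_carrier_dual)
  show ?thesis
    unfolding free_space_def by (rule D.in_closure_iff[OF span_point_evaluation_subset[OF assms]])
qed

lemma free_norm_le:
  assumes "z \<in> mspace M" "\<mu> \<in> Lip0_dual M z"
    and "\<And>f. f \<in> Lip0 M z \<Longrightarrow> Lip_norm M f \<le> 1 \<Longrightarrow> \<bar>\<mu> f\<bar> \<le> B"
  shows "free_norm M z \<mu> \<le> B"
  using normed_carrier.dual_norm_least[OF normed_carrier_Lip0[OF assms(1)]] assms(2,3)
  unfolding free_norm_def Lip0_dual_def by blast

lemma free_norm_bound:
  assumes "z \<in> mspace M" "\<mu> \<in> Lip0_dual M z" "f \<in> Lip0 M z"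
  shows "\<bar>\<mu> f\<bar> \<le> free_norm M z \<mu> * Lip_norm M f"
  using normed_carrier.dual_norm_bound[OF normed_carrier_Lip0[OF assms(1)]] assms(2,3)
  unfolding free_norm_def Lip0_dual_def by blast

lemma free_space_subset_dual:
  assumes "z \<in> mspace M" shows "free_space M z \<subseteq> Lip0_dual M z"
  using in_free_space_iff[OF assms] by blast

section \<open>Averages of point evaluations\<close>

text \<open>A Bochner integral of point evaluations, obtained from scalar integrals only. A finite
  net partitions the probability space, and weighting its points with the probabilities of the
  pieces approximates the mean uniformly over all 1-Lipschitz functions.\<close>

lemma average_in_free_space:
  fixes M :: "'a metric" and N :: "'b measure"
  assumes N: "prob_space N" and z: "z \<in> mspace M" and M: "compact_space (mtopology_of M)"
    and \<eta>: "\<And>\<omega>. \<eta> \<omega> \<in> mspace M"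
    and meas: "\<And>f. f \<in> Lip0 M z \<Longrightarrow> (\<lambda>\<omega>. f (\<eta> \<omega>)) \<in> borel_measurable N"
  shows "(\<lambda>f. if f \<in> Lip0 M z then \<integral>\<omega>. f (\<eta> \<omega>) \<partial>N else 0) \<in> free_space M z" (is "?\<Lambda> \<in> _")
proof -
  interpret prob_space N by fact
  interpret L: normed_carrier "Lip0 M z" "Lip_norm M" using normed_carrier_Lip0[OF z] .
  interpret D: normed_carrier "Lip0_dual M z" "free_norm M z"
    unfolding Lip0_dual_def free_norm_def by (rule L.normed_carrier_dual)
  obtain D where D: "0 \<le> D" "\<And>f x. f \<in> Lip0 M z \<Longrightarrow> x \<in> mspace M \<Longrightarrow> \<bar>f x\<bar> \<le> D * Lip_norm M f"
    using Lip0_bounded[OF M z] by blast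
  have int: "integrable N (\<lambda>\<omega>. f (\<eta> \<omega>))" if "f \<in> Lip0 M z" for f
    by (rule integrable_const_bound[where B = "D * Lip_norm M f"]) (use that D(2) \<eta> meas in auto)
  have bound: "\<bar>\<integral>\<omega>. f (\<eta> \<omega>) \<partial>N\<bar> \<le> D * Lip_norm M f" if "f \<in> Lip0 M z" for f
  proof -
    have "\<bar>\<integral>\<omega>. f (\<eta> \<omega>) \<partial>N\<bar> \<le> (\<integral>\<omega>. \<bar>f (\<eta> \<omega>)\<bar> \<partial>N)" by (rule integral_abs_bound)
    also have "\<dots> \<le> (\<integral>\<omega>. D * Lip_norm M f \<partial>N)"
      by (rule integral_mono) (use int that D(2) \<eta> in auto)
    finally show ?thesis by (simp add: prob_space)
  qed
  have dual: "?\<Lambda> \<in> Lip0_dual M z"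
    unfolding Lip0_dual_def dual_space_def linear_map_on_def
    using int bound subspace_add[OF L.subspace] subspace_scale[OF L.subspace] by auto
  have "\<exists>\<nu>\<in>span (point_evaluation M z ` mspace M). free_norm M z (?\<Lambda> - \<nu>) < e" if e: "0 < e" for e
  proof -
    obtain C where C: "finite C" "C \<subseteq> mspace M" "\<And>y. y \<in> mspace M \<Longrightarrow> \<exists>x\<in>C. mdist M x y < e / 2"
      using compact_finite_net[OF M, of "e / 2"] e by auto
    obtain n and c :: "nat \<Rightarrow> 'a" where c: "C = c ` {..<n}"
      using C(1) by (metis finite_conv_nat_seg_image lessThan_def)
    have cM: "c k \<in> mspace M" if "k < n" for k using that c C(2) by auto
    define B where "B k = {\<omega>\<in>space N. mdist M (c k) (\<eta> \<omega>) < e / 2}" for k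
    have B: "B k \<in> sets N" if "k < n" for k
    proof -
      let ?g = "\<lambda>y. if y \<in> mspace M then mdist M (c k) y - mdist M (c k) z else 0"
      have [measurable]: "(\<lambda>\<omega>. ?g (\<eta> \<omega>)) \<in> borel_measurable N"
        using meas Lip0_distance[OF z cM[OF that]] by blast
      have "B k = {\<omega>\<in>space N. ?g (\<eta> \<omega>) < e / 2 - mdist M (c k) z}"
        using \<eta> by (auto simp: B_def)
      also have "\<dots> \<in> sets N" by measurable
      finally show ?thesis .
    qed
    \<comment> \<open>Each sample is assigned to the first net point near it, which makes the pieces
      disjoint.\<close>
    define E where "E k = B k - (\<Union>j<k. B j)" for k
    have E: "E k \<in> sets N" if "k < n" for k
      unfolding E_def using that B by (intro sets.Diff sets.finite_UN) auto
    have approx: "\<bar>f (\<eta> \<omega>) - (\<Sum>k<n. indicator (E k) \<omega> * f (c k))\<bar> \<le> e / 2"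
      if f: "f \<in> Lip0 M z" "Lip_norm M f \<le> 1" and \<omega>: "\<omega> \<in> space N" for f \<omega>
    proof -
      have "\<exists>k<n. \<omega> \<in> B k" using C(3)[OF \<eta>[of \<omega>]] c \<omega> by (auto simp: B_def)
      then obtain k where k': "k < n \<and> \<omega> \<in> B k" "\<forall>j<k. \<not> (j < n \<and> \<omega> \<in> B j)"
        unfolding exists_least_iff[of "\<lambda>k. k < n \<and> \<omega> \<in> B k"] by blast
      have k: "\<omega> \<notin> B j" if "j < k" for j
        using k' that by auto
      have kn: "k < n" "\<omega> \<in> B k" using k' by auto
      have "indicator (E j) \<omega> * f (c j) = (if j = k then f (c k) else 0)" if "j < n" for j
        using k kn by (cases j k rule: linorder_cases) (auto simp: E_def indicator_def)
      then have "(\<Sum>j<n. indicator (E j) \<omega> * f (c j)) = (\<Sum>j<n. if j = k then f (c k) else 0)"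
        by (intro sum.cong) auto
      then have "(\<Sum>j<n. indicator (E j) \<omega> * f (c j)) = f (c k)"
        using kn by simp
      moreover have "\<bar>f (c k) - f (\<eta> \<omega>)\<bar> \<le> Lip_norm M f * mdist M (c k) (\<eta> \<omega>)"
        by (rule Lip_norm_bound[OF f(1) cM[OF kn(1)] \<eta>])
      moreover have "Lip_norm M f * mdist M (c k) (\<eta> \<omega>) \<le> 1 * (e / 2)"
        using kn(2) f(2) by (intro mult_mono Metric_space.nonneg[OF Metric_space_mspace_mdist]) (simp_all add: B_def)
      ultimately show ?thesis by linarith
    qed
    define \<nu> where "\<nu> = (\<Sum>k<n. prob (E k) *\<^sub>R point_evaluation M z (c k))"
    have \<nu>: "\<nu> \<in> span (point_evaluation M z ` mspace M)"
      unfolding \<nu>_def using cM by (intro span_sum span_scale span_base) auto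
    have "free_norm M z (?\<Lambda> - \<nu>) \<le> e / 2"
    proof (rule free_norm_le[OF z])
      show "?\<Lambda> - \<nu> \<in> Lip0_dual M z"
        using dual \<nu> span_point_evaluation_subset[OF z] subspace_diff[OF D.subspace] by blast
      fix f assume f: "f \<in> Lip0 M z" "Lip_norm M f \<le> 1"
      define s where "s \<omega> = (\<Sum>k<n. indicator (E k) \<omega> * f (c k))" for \<omega>
      have ind: "integrable N (\<lambda>\<omega>. indicator (E k) \<omega> * f (c k))" if "k < n" for k
        using E[OF that]
        by (intro integrable_mult_left integrable_real_indicator) (auto simp: emeasure_eq_measure)
      then have s: "integrable N s" unfolding s_def by (intro Bochner_Integration.integrable_sum) simp
      have "\<nu> f = (\<Sum>k<n. prob (E k) * f (c k))"
        using f by (simp add: \<nu>_def sum_fun_apply point_evaluation_def)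
      also have "\<dots> = (\<Sum>k<n. \<integral>\<omega>. indicator (E k) \<omega> * f (c k) \<partial>N)"
        using E by (intro sum.cong refl) simp
      also have "\<dots> = (\<integral>\<omega>. s \<omega> \<partial>N)"
        unfolding s_def using ind by (intro Bochner_Integration.integral_sum[symmetric]) simp
      finally have "(?\<Lambda> - \<nu>) f = (\<integral>\<omega>. f (\<eta> \<omega>) - s \<omega> \<partial>N)"
        using f(1) by (simp add: Bochner_Integration.integral_diff[OF int[OF f(1)] s])
      also have "\<bar>\<dots>\<bar> \<le> (\<integral>\<omega>. \<bar>f (\<eta> \<omega>) - s \<omega>\<bar> \<partial>N)"
        by (rule integral_abs_bound)
      also have "\<dots> \<le> (\<integral>\<omega>. e / 2 \<partial>N)"
      proof (rule integral_mono)
        show "integrable N (\<lambda>\<omega>. \<bar>f (\<eta> \<omega>) - s \<omega>\<bar>)"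
          by (intro Bochner_Integration.integrable_diff integrable_abs int f(1) s)
        show "\<bar>f (\<eta> \<omega>) - s \<omega>\<bar> \<le> e / 2" if "\<omega> \<in> space N" for \<omega>
          unfolding s_def by (rule approx[OF f that])
      qed simp
      finally show "\<bar>(?\<Lambda> - \<nu>) f\<bar> \<le> e / 2" by (simp add: prob_space)
    qed
    also have "e / 2 < e" using e by simp
    finally show ?thesis by (rule bexI[OF _ \<nu>])
  qed
  with dual show ?thesis unfolding in_free_space_iff[OF z] by (intro conjI allI impI)
qed

section \<open>Lifting unit vectors to the free space of a cube\<close>

text \<open>Clamping makes the integrand continuous on the whole line, hence measurable, without
  changing it on the support of the measure.\<close>

lemma uniform_integral:
  fixes q :: "real \<Rightarrow> real"
  assumes "0 < w" "continuous_on {0..w} q"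
  shows "(\<integral>s. q (max 0 (min w s)) \<partial>uniform_measure lborel {0..w}) = integral {0..w} q / w"
proof -
  let ?q = "\<lambda>s. q (max 0 (min w s))"
  have "continuous_on UNIV ?q"
    by (rule continuous_on_compose2[OF assms(2)]) (use assms(1) in \<open>auto intro!: continuous_intros\<close>)
  then have [measurable]: "?q \<in> borel_measurable borel" by (rule borel_measurable_continuous_onI)
  have "uniform_measure lborel {0..w} = density lborel (\<lambda>s. ennreal (indicator {0..w} s / w))"
    unfolding uniform_measure_def using assms(1)
    by (intro density_cong) (auto simp: divide_ennreal[symmetric] split: split_indicator)
  then have "(\<integral>s. ?q s \<partial>uniform_measure lborel {0..w}) = (\<integral>s. (indicator {0..w} s / w) * ?q s \<partial>lborel)"
    using assms(1) by (simp add: integral_density)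
  also have "\<dots> = (\<integral>s. indicator {0..w} s *\<^sub>R q s \<partial>lborel) / w"
    by (subst integral_divide_zero[symmetric]) (auto intro!: Bochner_Integration.integral_cong split: split_indicator)
  also have "(\<integral>s. indicator {0..w} s *\<^sub>R q s \<partial>lborel) = integral {0..w} q"
    using set_borel_integral_eq_integral(2)[OF borel_integrable_atLeastAtMost'[OF assms(2)]]
    by (simp add: set_lebesgue_integral_def)
  finally show ?thesis .
qed

text \<open>The middle portions of the shifted and the unshifted integral cancel, leaving end pieces
  of length \<open>h\<close> on which \<open>q\<close> is nearly constant. Averaging thus creates
  differentiability, with the difference of the end values as derivative.\<close>

lemma integral_shift_difference:
  fixes q :: "real \<Rightarrow> real"
  assumes w: "0 < w" and h: "0 \<le> h" and q: "continuous_on {0..w + h} q"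
    and A: "\<And>s. w \<le> s \<Longrightarrow> s \<le> w + h \<Longrightarrow> \<bar>q s - A\<bar> \<le> e"
    and B: "\<And>s. 0 \<le> s \<Longrightarrow> s \<le> h \<Longrightarrow> \<bar>q s - B\<bar> \<le> e"
  shows "\<bar>integral {0..w} (\<lambda>s. q (s + h) - q s) - h * (A - B)\<bar> \<le> 2 * h * e"
proof -
  have int: "q integrable_on {a..b}" if "0 \<le> a" "b \<le> w + h" for a b
    by (rule integrable_continuous_interval) (use that in \<open>auto intro: continuous_on_subset[OF q]\<close>)
  have shift: "integral {0..w} (\<lambda>s. q (s + h)) = integral {h..w + h} q" "(\<lambda>s. q (s + h)) integrable_on {0..w}"
    using integral_shift_Icc_real[of 0 w q h] integrable_on_shift_Icc_real[of q h 0 w] int[of h "w + h"] h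
    by (simp_all add: comp_def add.commute)
  have split1: "integral {0..h} q + integral {h..w + h} q = integral {0..w + h} q"
    using h w by (intro Henstock_Kurzweil_Integration.integral_combine int) auto
  have split2: "integral {0..w} q + integral {w..w + h} q = integral {0..w + h} q"
    using h w by (intro Henstock_Kurzweil_Integration.integral_combine int) auto
  have bound: "\<bar>integral {a..a + h} q - h * c\<bar> \<le> h * e"
    if "0 \<le> a" "a \<le> w" "\<And>s. a \<le> s \<Longrightarrow> s \<le> a + h \<Longrightarrow> \<bar>q s - c\<bar> \<le> e" for a c
  proof -
    have i: "q integrable_on {a..a + h}" using that h by (intro int) auto
    have "e \<ge> 0" using that(3)[of a] h by auto
    have "integral {a..a + h} (\<lambda>s. q s - c) = integral {a..a + h} q - h * c"
      using h by (subst Henstock_Kurzweil_Integration.integral_diff[OF i]) auto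
    moreover have "norm (integral {a..a + h} (\<lambda>s. q s - c)) \<le> e * (a + h - a)"
      by (rule integral_bound) (use that h in \<open>auto intro!: continuous_intros continuous_on_subset[OF q]\<close>)
    ultimately show ?thesis by (simp add: mult.commute)
  qed
  have "integral {0..w} (\<lambda>s. q (s + h) - q s) = integral {w..w + h} q - integral {0..h} q"
    using shift split1 split2 w h by (subst Henstock_Kurzweil_Integration.integral_diff) (auto intro: int)
  then show ?thesis
    using bound[of w A] bound[of 0 B] A B w h by (simp add: algebra_simps)
qed

lemma (in prob_space) abs_expectation_le:
  fixes f :: "'a \<Rightarrow> real"
  assumes "integrable M f" "\<And>x. x \<in> space M \<Longrightarrow> \<bar>f x\<bar> \<le> B"
  shows "\<bar>expectation f\<bar> \<le> B"
proof -
  have "\<bar>expectation f\<bar> \<le> expectation (\<lambda>x. \<bar>f x\<bar>)" by (rule integral_abs_bound)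
  also have "\<dots> \<le> expectation (\<lambda>x. B)"
    by (rule integral_mono) (use assms in auto)
  finally show ?thesis by (simp add: prob_space)
qed

text \<open>Fubini with coordinate \<open>i\<close> integrated first: a one-dimensional estimate,
  uniform in the remaining coordinates, carries over to the infinite product.\<close>

lemma PiM_abs_integral_le:
  fixes N :: "'i \<Rightarrow> 'a measure" and R :: "('i \<Rightarrow> 'a) \<Rightarrow> real"
  assumes N: "\<And>j. prob_space (N j)" and R: "integrable (PiM UNIV N) R"
    and le: "\<And>X. \<bar>\<integral>s. R (X(i := s)) \<partial>N i\<bar> \<le> e"
  shows "\<bar>\<integral>x. R x \<partial>PiM UNIV N\<bar> \<le> e"
proof -
  interpret Ni: prob_space "N i" by (rule N)
  interpret P: prob_space "PiM (- {i}) N" by (rule prob_space_PiM) (rule N)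
  interpret pair_sigma_finite "N i" "PiM (- {i}) N" ..
  have ins: "insert i (- {i}) = UNIV" by auto
  have meas: "(\<lambda>(s, X). X(i := s)) \<in> measurable (N i \<Otimes>\<^sub>M PiM (- {i}) N) (PiM UNIV N)"
    using measurable_compose[OF measurable_pair_swap' measurable_add_dim[of i "- {i}" N]]
    unfolding ins by (simp add: case_prod_beta')
  have distr: "distr (N i \<Otimes>\<^sub>M PiM (- {i}) N) (PiM UNIV N) (\<lambda>(s, X). X(i := s)) = PiM UNIV N"
    using distr_pair_PiM_eq_PiM[of "- {i}" N i] N unfolding ins by simp
  have int: "integrable (N i \<Otimes>\<^sub>M PiM (- {i}) N) (\<lambda>(s, X). R (X(i := s)))"
    using R integrable_distr[OF meas, of R] unfolding distr by (simp add: case_prod_beta')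
  have "(\<integral>x. R x \<partial>PiM UNIV N) = (\<integral>(s, X). R (X(i := s)) \<partial>(N i \<Otimes>\<^sub>M PiM (- {i}) N))"
    using R integral_distr[OF meas, of R] unfolding distr by (simp add: case_prod_beta')
  also have "\<dots> = (\<integral>X. (\<integral>s. R (X(i := s)) \<partial>N i) \<partial>PiM (- {i}) N)"
    by (rule integral_snd[symmetric, OF int])
  also have "\<bar>\<dots>\<bar> \<le> e"
    by (rule P.abs_expectation_le[OF integrable_snd[OF int] le])
  finally show ?thesis .
qed

section \<open>A compact cube with the metric of a norm\<close>

text \<open>Domination by the l1 sum makes the metric topology of the cube no finer than the product
  topology, hence compact; the lower bound makes the coordinates 1-Lipschitz.\<close>

locale norm_cube = normed_carrier "{x :: nat \<Rightarrow> real. summable (\<lambda>i. \<bar>x i\<bar>)}" p for p +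
  fixes w :: "nat \<Rightarrow> real"
  assumes w_pos: "0 < w i" and summable_w: "summable w"
    and norm_le_sum: "summable (\<lambda>i. \<bar>x i\<bar>) \<Longrightarrow> p x \<le> (\<Sum>i. \<bar>x i\<bar>)"
    and coordinate_le_norm: "summable (\<lambda>i. \<bar>x i\<bar>) \<Longrightarrow> \<bar>x i\<bar> \<le> p x"
begin

text \<open>The factor 2 leaves room: the box with sides \<open>{0..w i}\<close>, moved by at most
  \<open>w i\<close> in every coordinate, stays inside.\<close>

definition cube :: "(nat \<Rightarrow> real) set" where "cube = {x. \<forall>i. \<bar>x i\<bar> \<le> 2 * w i}"

definition K :: "(nat \<Rightarrow> real) metric"
  where "K = submetric (norm_metric {x. summable (\<lambda>i. \<bar>x i\<bar>)} p) cube"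

definition e :: "nat \<Rightarrow> nat \<Rightarrow> real" where "e i = (\<lambda>j. if j = i then 1 else 0)"

lemma summable_finite_support: "finite I \<Longrightarrow> summable (\<lambda>j. \<bar>if j \<in> I then c j else 0 :: real\<bar>)"
  by (rule summable_finite) auto

lemma summable_unit: "summable (\<lambda>j. \<bar>(t *\<^sub>R e i) j\<bar>)"
  by (rule summable_finite[of "{i}"]) (auto simp: e_def)

lemma norm_unit: "p (t *\<^sub>R e i) \<le> \<bar>t\<bar>"
proof -
  have "(\<Sum>j. \<bar>(t *\<^sub>R e i) j\<bar>) = \<bar>t\<bar>"
    by (subst suminf_finite[of "{i}"]) (auto simp: e_def)
  then show ?thesis using norm_le_sum[of "t *\<^sub>R e i", OF summable_unit] by (simp only:)
qed

lemma cube_summable: assumes "x \<in> cube" shows "summable (\<lambda>i. \<bar>x i\<bar>)"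
  by (rule summable_comparison_test'[OF summable_mult[OF summable_w, of 2], of 0])
    (use assms in \<open>auto simp: cube_def\<close>)

lemma mspace_K: "mspace K = cube"
  using cube_summable by (auto simp: K_def mspace_norm_metric)

lemma mdist_K: "x \<in> cube \<Longrightarrow> y \<in> cube \<Longrightarrow> mdist K x y = p (x - y)"
  using cube_summable by (simp add: K_def mdist_norm_metric)

lemma zero_in_cube: "0 \<in> cube"
  using w_pos by (auto simp: cube_def less_imp_le)

lemma zero_in_K: "0 \<in> mspace K"
  by (simp add: mspace_K zero_in_cube)

text \<open>Cube points differ by at most \<open>4 * w i\<close> in coordinate \<open>i\<close>, so
  a tail is uniformly small and finitely many coordinates decide. Compactness of \<open>K\<close>
  and Borel measurability of Lipschitz functions both rest on this.\<close>

lemma product_neighbourhood_in_ball: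
  assumes "x \<in> cube" "0 < r"
  shows "\<exists>U. open U \<and> x \<in> U \<and> (\<forall>y\<in>U \<inter> cube. p (x - y) < r)"
proof -
  obtain n where n: "(\<Sum>i. 4 * w (i + n)) < r / 2"
  proof -
    have "(\<lambda>n. \<Sum>i. 4 * w (i + n)) \<longlonglongrightarrow> 0"
      using suminf_exist_split2[OF summable_mult[OF summable_w, of 4]] by simp
    then have "\<forall>\<^sub>F n in sequentially. (\<Sum>i. 4 * w (i + n)) < r / 2"
      by (rule order_tendstoD) (use assms(2) in simp)
    then show thesis using that by (auto dest: eventually_happens)
  qed
  define U where "U = {y. (\<Sum>i<n. \<bar>x i - y i\<bar>) < r / 2}"
  have "open U"
    unfolding U_def by (intro open_Collect_less continuous_intros continuous_on_product_coordinates)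
  moreover have "x \<in> U" using assms(2) by (simp add: U_def)
  moreover have "p (x - y) < r" if y: "y \<in> U \<inter> cube" for y
  proof -
    have diff: "\<bar>x i - y i\<bar> \<le> 4 * w i" for i
    proof -
      have "\<bar>x i\<bar> \<le> 2 * w i" "\<bar>y i\<bar> \<le> 2 * w i" using y assms(1) by (auto simp: cube_def)
      then show ?thesis by linarith
    qed
    have s: "summable (\<lambda>i. \<bar>(x - y) i\<bar>)"
      by (rule summable_comparison_test'[OF summable_mult[OF summable_w, of 4], of 0])
        (use diff in auto)
    have "p (x - y) \<le> (\<Sum>i. \<bar>(x - y) i\<bar>)" by (rule norm_le_sum[OF s])
    also have "\<dots> = (\<Sum>i. \<bar>(x - y) (i + n)\<bar>) + (\<Sum>i<n. \<bar>(x - y) i\<bar>)"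
      by (rule suminf_split_initial_segment[OF s])
    also have "(\<Sum>i. \<bar>(x - y) (i + n)\<bar>) \<le> (\<Sum>i. 4 * w (i + n))"
      using diff s summable_w by (intro suminf_le summable_ignore_initial_segment summable_mult) auto
    finally show ?thesis using n y by (simp add: U_def)
  qed
  ultimately show ?thesis by blast
qed

lemma compact_cube: "compact cube"
proof -
  have "cube = PiE UNIV (\<lambda>i. {- (2 * w i)..2 * w i})" by (auto simp: cube_def abs_le_iff PiE_iff minus_le_iff)
  then have "compactin (product_topology (\<lambda>i. euclidean) UNIV) cube"
    by (auto simp: compactin_PiE)
  then show ?thesis by (simp add: euclidean_product_topology)
qed

lemma compact_K: "compact_space (mtopology_of K)"
proof -
  interpret M: Metric_space "cube" "mdist K"
    using Metric_space_mspace_mdist[of K] by (simp add: mspace_K)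
  have top: "mtopology_of K = M.mtopology" by (simp add: mtopology_of_def mspace_K)
  have "continuous_map (top_of_set cube) (mtopology_of K) id"
    unfolding top M.continuous_map_to_metric
  proof (intro ballI allI impI)
    fix x and r :: real assume x: "x \<in> topspace (top_of_set cube)" and r: "0 < r"
    then have x': "x \<in> cube" by simp
    obtain U where U: "open U" "x \<in> U" "\<And>y. y \<in> U \<inter> cube \<Longrightarrow> p (x - y) < r"
      using product_neighbourhood_in_ball[OF x' r] by blast
    show "\<exists>U. openin (top_of_set cube) U \<and> x \<in> U \<and> (\<forall>y\<in>U. id y \<in> M.mball (id x) r)"
      using U x' by (intro exI[of _ "cube \<inter> U"]) (auto simp: openin_open_Int mdist_K)
  qed
  then have "compactin (mtopology_of K) (id ` cube)"
    by (rule image_compactin[rotated]) (use compact_cube in simp)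
  then show ?thesis by (simp add: compact_space_def mspace_K)
qed

lemma Lip0_diff_le:
  assumes "f \<in> Lip0 K 0" "x \<in> cube" "y \<in> cube"
  shows "\<bar>f x - f y\<bar> \<le> Lip_norm K f * p (x - y)"
  using Lip_norm_bound[OF assms(1)] assms by (simp add: mspace_K mdist_K)

lemma Lip0_continuous_on:
  assumes f: "f \<in> Lip0 K 0" shows "continuous_on cube f"
  unfolding continuous_on_def tendsto_iff
proof (intro ballI allI impI)
  fix x and r :: real assume x: "x \<in> cube" and r: "0 < r"
  have L: "0 < Lip_norm K f + 1" using Lip_norm_ge_0[OF f] by simp
  obtain U where U: "open U" "x \<in> U" "\<And>y. y \<in> U \<inter> cube \<Longrightarrow> p (x - y) < r / (Lip_norm K f + 1)"
    using product_neighbourhood_in_ball[OF x, of "r / (Lip_norm K f + 1)"] r L by auto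
  have "dist (f y) (f x) < r" if y: "y \<in> U \<inter> cube" for y
  proof -
    have "\<bar>f x - f y\<bar> \<le> Lip_norm K f * p (x - y)" using Lip0_diff_le[OF f x] y by blast
    also have "\<dots> \<le> (Lip_norm K f + 1) * p (x - y)"
      using norm_ge_0[of "x - y"] subspace_diff[OF subspace] x y cube_summable
      by (intro mult_right_mono) auto
    also have "\<dots> < r" using U(3)[OF y] L by (simp add: field_simps)
    finally show ?thesis by (simp add: dist_real_def abs_minus_commute)
  qed
  then show "\<forall>\<^sub>F y in at x within cube. dist (f y) (f x) < r"
    unfolding eventually_at_topological using U by (intro exI[of _ U]) auto
qed

section \<open>Random points of the box and the lifted unit vectors\<close>

definition P :: "(nat \<Rightarrow> real) measure" where "P = PiM UNIV (\<lambda>i. uniform_measure lborel {0..w i})"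

lemma prob_space_uniform: "prob_space (uniform_measure lborel {0..w i})"
  using w_pos[of i] by (intro prob_space_uniform_measure) auto

lemma prob_space_P: "prob_space P"
  unfolding P_def by (rule prob_space_PiM) (rule prob_space_uniform)

lemma sets_P: "sets P = sets borel"
proof -
  have "sets P = sets (PiM UNIV (\<lambda>i :: nat. borel :: real measure))"
    unfolding P_def by (rule sets_PiM_cong) auto
  then show ?thesis by (simp add: sets_PiM_equal_borel)
qed

lemma continuous_measurable_P: "continuous_on UNIV h \<Longrightarrow> h \<in> borel_measurable P" for h :: "_ \<Rightarrow> real"
  using measurable_cong_sets[OF sets_P refl] borel_measurable_continuous_onI by blast

text \<open>The measure \<open>P\<close> is carried by the box, but points at which a Lipschitz
  function is evaluated must lie in the cube always, not just almost surely. Clamping is the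
  identity on the box and ensures this.\<close>

definition cl :: "(nat \<Rightarrow> real) \<Rightarrow> nat \<Rightarrow> real" where "cl x = (\<lambda>i. max 0 (min (w i) (x i)))"

lemma cl_bounds: "0 \<le> cl x i" "cl x i \<le> w i"
  using w_pos[of i] by (auto simp: cl_def)

lemma cl_add_in_cube: "(\<And>j. \<bar>c j\<bar> \<le> w j) \<Longrightarrow> cl x + c \<in> cube"
proof -
  assume c: "\<bar>c j\<bar> \<le> w j" for j
  have "\<bar>(cl x + c) j\<bar> \<le> 2 * w j" for j
    using c[of j] cl_bounds[of x j] by (simp add: abs_le_iff)
  then show ?thesis by (simp add: cube_def)
qed

definition face :: "nat \<Rightarrow> (nat \<Rightarrow> real) \<Rightarrow> nat \<Rightarrow> real" where "face i x = (cl x)(i := 0)"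

lemma face_in_cube:
  assumes "\<And>j. \<bar>c j\<bar> \<le> w j" "- w i \<le> s + c i" "s + c i \<le> 2 * w i"
  shows "face i x + c + s *\<^sub>R e i \<in> cube"
  unfolding cube_def
proof (intro CollectI allI)
  fix j
  show "\<bar>(face i x + c + s *\<^sub>R e i) j\<bar> \<le> 2 * w j"
    using assms(1)[of j] assms(2,3) cl_bounds[of x j] w_pos[of j]
    by (cases "j = i") (auto simp: face_def e_def abs_le_iff)
qed

lemma continuous_coordinatewise:
  assumes "\<And>i. continuous_on UNIV (\<lambda>x. \<eta> x i)"
  shows "continuous_on UNIV (\<eta> :: (nat \<Rightarrow> real) \<Rightarrow> nat \<Rightarrow> real)"
  by (rule continuous_on_coordinatewise_then_product) (rule assms)

lemma continuous_cl_add: "continuous_on UNIV (\<lambda>x. cl x + c)"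
  by (rule continuous_coordinatewise) (auto simp: cl_def intro!: continuous_intros)

lemma continuous_face_add: "continuous_on UNIV (\<lambda>x. face i x + c)"
proof (rule continuous_coordinatewise)
  fix j show "continuous_on UNIV (\<lambda>x. (face i x + c) j)"
    by (cases "j = i") (auto simp: face_def cl_def intro!: continuous_intros)
qed

lemma Lip0_comp_measurable:
  assumes "f \<in> Lip0 K 0" "continuous_on UNIV \<eta>" "\<And>x. \<eta> x \<in> cube"
  shows "(\<lambda>x. f (\<eta> x)) \<in> borel_measurable P"
  by (rule continuous_measurable_P, rule continuous_on_compose2[OF Lip0_continuous_on[OF assms(1)] assms(2)])
    (use assms(3) in auto)

lemma Lip0_comp_integrable:
  assumes "f \<in> Lip0 K 0" "continuous_on UNIV \<eta>" "\<And>x. \<eta> x \<in> cube"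
  shows "integrable P (\<lambda>x. f (\<eta> x))"
proof -
  interpret prob_space P by (rule prob_space_P)
  obtain D where "\<And>f x. f \<in> Lip0 K 0 \<Longrightarrow> x \<in> mspace K \<Longrightarrow> \<bar>f x\<bar> \<le> D * Lip_norm K f"
    using Lip0_bounded[OF compact_K zero_in_K] by blast
  then show ?thesis
    using assms Lip0_comp_measurable[OF assms]
    by (intro integrable_const_bound[where B = "D * Lip_norm K f"]) (auto simp: mspace_K)
qed

lemma face_ends_in_cube: "face i x \<in> cube" "face i x + w i *\<^sub>R e i \<in> cube"
  using face_in_cube[of 0 i 0 x] face_in_cube[of 0 i "w i" x] w_pos
  by (auto simp: less_imp_le)

lemma continuous_face_ends:
  "continuous_on UNIV (face i)" "continuous_on UNIV (\<lambda>x. face i x + w i *\<^sub>R e i)"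
  using continuous_face_add[of i 0] continuous_face_add[of i "w i *\<^sub>R e i"] by simp_all

text \<open>\<open>lift i f\<close> is the derivative at \<open>0\<close> in direction \<open>e i\<close> of the mean of the translates of \<open>f\<close> over
  the cube with sides \<open>{0..w j}\<close>. This mean is differentiable for every Lipschitz \<open>f\<close>, so \<open>lift\<close> extends to
  a contractive linear map on the finitely supported sequences with norm \<open>p\<close>.\<close>

definition lift :: "nat \<Rightarrow> ((nat \<Rightarrow> real) \<Rightarrow> real) \<Rightarrow> real"
  where "lift i f = (if f \<in> Lip0 K 0 then
    (\<integral>x. f (face i x + w i *\<^sub>R e i) - f (face i x) \<partial>P) / w i else 0)"

text \<open>Up to a factor it is the difference of two averages over opposite faces of the box. A
  pointwise limit of difference quotients alone would place it only in the dual of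
  \<open>Lip0\<close>.\<close>

lemma lift_in_free_space: "lift i \<in> free_space K 0"
proof -
  interpret F: normed_carrier "free_space K 0" "free_norm K 0"
    by (rule normed_carrier_free_space[OF zero_in_K])
  define \<Lambda> where "\<Lambda> \<eta> = (\<lambda>f. if f \<in> Lip0 K 0 then \<integral>x. f (\<eta> x) \<partial>P else 0)" for \<eta>
  have \<Lambda>: "\<Lambda> \<eta> \<in> free_space K 0" if "continuous_on UNIV \<eta>" "\<And>x. \<eta> x \<in> cube" for \<eta>
    unfolding \<Lambda>_def
    by (rule average_in_free_space[OF prob_space_P zero_in_K compact_K])
      (use that Lip0_comp_measurable mspace_K in auto)
  have "lift i = (1 / w i) *\<^sub>R (\<Lambda> (\<lambda>x. face i x + w i *\<^sub>R e i) - \<Lambda> (face i))"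
    using Lip0_comp_integrable[OF _ continuous_face_ends(1) face_ends_in_cube(1)]
      Lip0_comp_integrable[OF _ continuous_face_ends(2) face_ends_in_cube(2)]
    by (auto simp: lift_def \<Lambda>_def fun_eq_iff)
  then show ?thesis
    using \<Lambda>[OF continuous_face_ends(1) face_ends_in_cube(1)] \<Lambda>[OF continuous_face_ends(2) face_ends_in_cube(2)]
    by (simp add: subspace_scale[OF F.subspace] subspace_diff[OF F.subspace])
qed

lemma lift_coordinate:
  assumes "(\<lambda>x. if x \<in> cube then x j else 0) \<in> Lip0 K 0"
  shows "lift i (\<lambda>x. if x \<in> cube then x j else 0) = (if j = i then 1 else 0)"
proof -
  interpret prob_space P by (rule prob_space_P)
  show ?thesis
    using assms face_ends_in_cube w_pos[of i] by (simp add: lift_def e_def prob_space)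
qed

section \<open>Differentiating the mean of translates\<close>

definition shifted_mean :: "((nat \<Rightarrow> real) \<Rightarrow> real) \<Rightarrow> (nat \<Rightarrow> real) \<Rightarrow> real"
  where "shifted_mean f c = (\<integral>x. f (cl x + c) \<partial>P)"

lemma cl_update: "cl (X(i := s)) = face i X + max 0 (min (w i) s) *\<^sub>R e i"
  by (auto simp: cl_def face_def e_def fun_eq_iff)

lemma face_update: "face i (X(i := s)) = face i X"
  by (auto simp: cl_def face_def fun_eq_iff)

text \<open>On each line in direction \<open>e i\<close> the increment reduces to two end pieces of
  length \<open>h\<close>, whose values are compared with the unshifted faces that define
  \<open>lift i\<close>. The error is of second order in \<open>c\<close> and \<open>h\<close>
  jointly, which is what allows directions to be added later.\<close>

lemma shifted_mean_increment_nonneg: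
  assumes f: "f \<in> Lip0 K 0" and c: "\<And>j. \<bar>c j\<bar> \<le> w j / 2" and h: "0 \<le> h" "h \<le> w i / 2"
  shows "\<bar>shifted_mean f (c + h *\<^sub>R e i) - shifted_mean f c - h * lift i f\<bar>
    \<le> 2 * h * (Lip_norm K f * (p c + h)) / w i"
proof -
  interpret prob_space P by (rule prob_space_P)
  have wi: "0 < w i" by (rule w_pos)
  have c1: "\<bar>c j\<bar> \<le> w j" for j using c[of j] w_pos[of j] by linarith
  have c2: "\<bar>(c + h *\<^sub>R e i) j\<bar> \<le> w j" for j
    using c[of j] h w_pos[of j] by (auto simp: e_def abs_le_iff)
  have cs: "summable (\<lambda>j. \<bar>c j\<bar>)"
    by (rule summable_comparison_test'[OF summable_w, of 0]) (use c1 in auto)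
  define g where "g x = f (face i x + w i *\<^sub>R e i) - f (face i x)" for x
  \<comment> \<open>The integral of \<open>R\<close> is the defect to be estimated; with the other
    coordinates fixed it involves \<open>f\<close> along a line only.\<close>
  define R where "R x = f (cl x + (c + h *\<^sub>R e i)) - f (cl x + c) - (h / w i) * g x" for x
  have int: "integrable P (\<lambda>x. f (cl x + (c + h *\<^sub>R e i)))" "integrable P (\<lambda>x. f (cl x + c))" "integrable P g"
    unfolding g_def
    by (intro Bochner_Integration.integrable_diff Lip0_comp_integrable[OF f] continuous_cl_add continuous_face_ends
        cl_add_in_cube face_ends_in_cube c1 c2)+
  have R: "integrable P R" unfolding R_def using int by auto
  have "\<bar>\<integral>s. R (X(i := s)) \<partial>uniform_measure lborel {0..w i}\<bar>
      \<le> 2 * h * (Lip_norm K f * (p c + h)) / w i" for X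
  proof -
    define q where "q s = f (face i X + c + s *\<^sub>R e i)" for s
    have in_cube: "face i X + c + s *\<^sub>R e i \<in> cube" if "0 \<le> s" "s \<le> w i + h" for s
      using that c[of i] c1 h wi by (intro face_in_cube) (auto simp: abs_le_iff)
    have q: "\<bar>q s - q s'\<bar> \<le> Lip_norm K f * \<bar>s - s'\<bar>" if "0 \<le> s" "s \<le> w i + h" "0 \<le> s'" "s' \<le> w i + h" for s s'
    proof -
      have "\<bar>q s - q s'\<bar> \<le> Lip_norm K f * p ((s - s') *\<^sub>R e i)"
        using Lip0_diff_le[OF f in_cube[OF that(1,2)] in_cube[OF that(3,4)]]
        by (simp add: q_def scaleR_diff_left)
      also have "\<dots> \<le> Lip_norm K f * \<bar>s - s'\<bar>"
        by (intro mult_left_mono norm_unit Lip_norm_ge_0[OF f])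
      finally show ?thesis .
    qed
    have contq: "continuous_on {0..w i + h} q"
      unfolding continuous_on_iff
    proof (intro ballI allI impI)
      fix s r :: real assume s: "s \<in> {0..w i + h}" and r: "0 < r"
      define L where "L = Lip_norm K f + 1"
      have L: "0 < L" "Lip_norm K f \<le> L" using Lip_norm_ge_0[OF f] by (auto simp: L_def)
      have "dist (q s') (q s) < r" if "s' \<in> {0..w i + h}" "dist s' s < r / L" for s'
      proof -
        have "\<bar>q s' - q s\<bar> \<le> Lip_norm K f * \<bar>s' - s\<bar>" using q s that by simp
        also have "\<dots> \<le> L * \<bar>s' - s\<bar>" using L by (intro mult_right_mono) auto
        also have "\<dots> < r" using that(2) L by (simp add: dist_real_def field_simps)
        finally show ?thesis by (simp add: dist_real_def)
      qed
      then show "\<exists>d>0. \<forall>s'\<in>{0..w i + h}. dist s' s < d \<longrightarrow> dist (q s') (q s) < r"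
        using r L by (intro exI[of _ "r / L"]) auto
    qed
    have near: "\<bar>q s - f (face i X + t *\<^sub>R e i)\<bar> \<le> Lip_norm K f * (p c + h)"
      if "0 \<le> s" "s \<le> w i + h" "0 \<le> t" "t \<le> w i" "\<bar>s - t\<bar> \<le> h" for s t
    proof -
      have t: "face i X + t *\<^sub>R e i \<in> cube"
        using face_in_cube[of 0 i t X] that w_pos by (auto simp: less_imp_le)
      have "\<bar>q s - f (face i X + t *\<^sub>R e i)\<bar> \<le> Lip_norm K f * p (c + (s - t) *\<^sub>R e i)"
        using Lip0_diff_le[OF f in_cube[OF that(1,2)] t]
        by (simp add: q_def scaleR_diff_left algebra_simps)
      also have "\<dots> \<le> Lip_norm K f * (p c + h)"
        using norm_triangle[of c "(s - t) *\<^sub>R e i"] cs summable_unit norm_unit[of "s - t" i] that(5)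
        by (intro mult_left_mono Lip_norm_ge_0[OF f]) auto
      finally show ?thesis .
    qed
    \<comment> \<open>These values belong to the faces before the shift, as in
      \<open>lift i\<close>; the shift by \<open>c\<close> goes into the error.\<close>
    define A where "A = f (face i X + w i *\<^sub>R e i)"
    define B where "B = f (face i X)"
    have bound: "\<bar>integral {0..w i} (\<lambda>s. q (s + h) - q s) - h * (A - B)\<bar> \<le> 2 * h * (Lip_norm K f * (p c + h))"
    proof (rule integral_shift_difference[OF wi h(1) contq])
      show "\<bar>q s - A\<bar> \<le> Lip_norm K f * (p c + h)" if "w i \<le> s" "s \<le> w i + h" for s
        unfolding A_def by (rule near) (use that wi h in auto)
      show "\<bar>q s - B\<bar> \<le> Lip_norm K f * (p c + h)" if "0 \<le> s" "s \<le> h" for s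
        using near[of s 0] that wi h by (auto simp: B_def)
    qed
    define r where "r s = q (s + h) - q s - (h / w i) * (A - B)" for s
    have contr: "continuous_on {0..w i} (\<lambda>s. q (s + h) - q s)"
      using h wi by (intro continuous_intros continuous_on_compose2[OF contq]) auto
    have "R (X(i := s)) = r (max 0 (min (w i) s))" for s
      by (simp add: R_def r_def g_def q_def A_def B_def cl_update face_update algebra_simps scaleR_add_left)
    then have "(\<integral>s. R (X(i := s)) \<partial>uniform_measure lborel {0..w i}) = integral {0..w i} r / w i"
      using uniform_integral[OF wi, of r] contr by (simp add: r_def continuous_on_diff)
    also have "integral {0..w i} r = integral {0..w i} (\<lambda>s. q (s + h) - q s) - h * (A - B)"
      unfolding r_def using wi contr
      by (subst Henstock_Kurzweil_Integration.integral_diff) (auto intro: integrable_continuous_interval)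
    also have "\<bar>\<dots> / w i\<bar> \<le> 2 * h * (Lip_norm K f * (p c + h)) / w i"
      using bound wi by (simp add: abs_divide divide_right_mono)
    finally show ?thesis .
  qed
  then have "\<bar>\<integral>x. R x \<partial>P\<bar> \<le> 2 * h * (Lip_norm K f * (p c + h)) / w i"
    unfolding P_def by (intro PiM_abs_integral_le[OF prob_space_uniform R[unfolded P_def]])
  moreover have "(\<integral>x. R x \<partial>P) = shifted_mean f (c + h *\<^sub>R e i) - shifted_mean f c - h * lift i f"
  proof -
    have "(\<integral>x. R x \<partial>P) = (\<integral>x. f (cl x + (c + h *\<^sub>R e i)) \<partial>P) - (\<integral>x. f (cl x + c) \<partial>P) - (h / w i) * (\<integral>x. g x \<partial>P)"
      unfolding R_def using int by simp
    then show ?thesis using f by (simp add: shifted_mean_def lift_def g_def)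
  qed
  ultimately show ?thesis by simp
qed

text \<open>A negative step is a positive step from the end point read backwards. The quarters keep
  that end point within the halves required there, and its norm contributes the second
  \<open>\<bar>h\<bar>\<close>.\<close>

lemma shifted_mean_increment:
  assumes f: "f \<in> Lip0 K 0" and c: "\<And>j. \<bar>c j\<bar> \<le> w j / 4" and h: "\<bar>h\<bar> \<le> w i / 4"
  shows "\<bar>shifted_mean f (c + h *\<^sub>R e i) - shifted_mean f c - h * lift i f\<bar>
    \<le> 2 * \<bar>h\<bar> * (Lip_norm K f * (p c + 2 * \<bar>h\<bar>)) / w i"
proof -
  have c1: "\<bar>c j\<bar> \<le> w j" for j using c[of j] w_pos[of j] by linarith
  have cs: "summable (\<lambda>j. \<bar>c j\<bar>)"
    by (rule summable_comparison_test'[OF summable_w, of 0]) (use c1 in auto)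
  have L: "0 \<le> Lip_norm K f" by (rule Lip_norm_ge_0[OF f])
  have wi: "0 < w i" by (rule w_pos)
  have c2: "\<bar>c j\<bar> \<le> w j / 2" for j using c[of j] w_pos[of j] by linarith
  show ?thesis
  proof (cases "0 \<le> h")
    case True
    have "\<bar>shifted_mean f (c + h *\<^sub>R e i) - shifted_mean f c - h * lift i f\<bar>
        \<le> 2 * h * (Lip_norm K f * (p c + h)) / w i"
      by (rule shifted_mean_increment_nonneg[OF f c2 True]) (use h wi in auto)
    also have "\<dots> \<le> 2 * h * (Lip_norm K f * (p c + 2 * h)) / w i"
      using True L wi by (intro divide_right_mono mult_left_mono) auto
    finally show ?thesis using True by simp
  next
    case False
    define c' where "c' = c + h *\<^sub>R e i"
    have c': "\<bar>c' j\<bar> \<le> w j / 2" for j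
      using c2[of j] c[of j] h abs_triangle_ineq[of "c j" h] by (auto simp: c'_def e_def)
    have c_eq: "c = c' + (- h) *\<^sub>R e i" by (simp add: c'_def)
    have "\<bar>shifted_mean f c - shifted_mean f c' - (- h) * lift i f\<bar>
        \<le> 2 * (- h) * (Lip_norm K f * (p c' + (- h))) / w i"
      using shifted_mean_increment_nonneg[OF f c', of "- h" i] abs_le_D2[OF h] wi False unfolding c_eq[symmetric] by simp
    also have "\<dots> \<le> 2 * (- h) * (Lip_norm K f * (p c + 2 * (- h))) / w i"
    proof -
      have "p c' \<le> p c + \<bar>h\<bar>"
        unfolding c'_def using norm_triangle[of c "h *\<^sub>R e i"] cs summable_unit norm_unit[of h i] by force
      then show ?thesis
        using False L wi by (intro divide_right_mono mult_left_mono) auto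
    qed
    finally show ?thesis using False by (simp add: c'_def)
  qed
qed

text \<open>Coordinates are added one at a time. The base point of each new increment moves with
  \<open>s\<close>, but by homogeneity of \<open>p\<close> the error is quadratic in
  \<open>s\<close> and vanishes from the quotient.\<close>

lemma shifted_mean_directional_derivative:
  assumes f: "f \<in> Lip0 K 0" and I: "finite I"
  shows "((\<lambda>s. (shifted_mean f (s *\<^sub>R (\<lambda>j. if j \<in> I then c j else 0)) - shifted_mean f 0) / s)
    \<longlongrightarrow> (\<Sum>i\<in>I. c i * lift i f)) (at_right 0)"
  using I
proof (induction I rule: finite_induct)
  case empty
  have "(\<lambda>s. (shifted_mean f (s *\<^sub>R (\<lambda>j. if j \<in> {} then c j else 0)) - shifted_mean f 0) / s) = (\<lambda>s. 0)"
    by (auto simp: fun_eq_iff intro!: arg_cong[where f = "shifted_mean f"])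
  then show ?case by simp
next
  case (insert i I)
  define d where "d = (\<lambda>j. if j \<in> I then c j else 0)"
  have sum: "(\<lambda>j. if j \<in> insert i I then c j else 0) = d + c i *\<^sub>R e i"
    using insert.hyps by (auto simp: d_def e_def fun_eq_iff)
  have ds: "summable (\<lambda>j. \<bar>d j\<bar>)" unfolding d_def by (rule summable_finite_support[OF insert.hyps(1)])
  define \<Delta> where "\<Delta> s = (shifted_mean f (s *\<^sub>R d + (s * c i) *\<^sub>R e i) - shifted_mean f (s *\<^sub>R d)) / s" for s
  have small: "\<forall>\<^sub>F s in at_right 0. \<bar>s * c j\<bar> \<le> w j / 4" for j
  proof -
    have "((\<lambda>s. \<bar>s * c j\<bar>) \<longlongrightarrow> \<bar>0 * c j\<bar>) (at_right 0)" by (intro tendsto_intros)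
    then have "\<forall>\<^sub>F s in at_right 0. \<bar>s * c j\<bar> < w j / 4"
      by (rule order_tendstoD) (use w_pos in simp)
    then show ?thesis by eventually_elim simp
  qed
  have all_small: "\<forall>\<^sub>F s in at_right 0. \<forall>j\<in>I. \<bar>s * c j\<bar> \<le> w j / 4"
    using insert.hyps(1) small by (simp add: eventually_ball_finite)
  have "\<forall>\<^sub>F s in at_right 0. norm (\<Delta> s - c i * lift i f) \<le> s * (2 * \<bar>c i\<bar> * (Lip_norm K f * (p d + 2 * \<bar>c i\<bar>)) / w i)"
    using small[of i] all_small eventually_at_right_less[of 0]
  proof eventually_elim
    case (elim s)
    have sd: "\<bar>(s *\<^sub>R d) j\<bar> \<le> w j / 4" for j
      using elim w_pos[of j] by (auto simp: d_def)
    have "\<bar>shifted_mean f (s *\<^sub>R d + (s * c i) *\<^sub>R e i) - shifted_mean f (s *\<^sub>R d) - (s * c i) * lift i f\<bar>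
        \<le> 2 * \<bar>s * c i\<bar> * (Lip_norm K f * (p (s *\<^sub>R d) + 2 * \<bar>s * c i\<bar>)) / w i"
      by (rule shifted_mean_increment[OF f sd elim(1)])
    also have "p (s *\<^sub>R d) = s * p d" using norm_scale[of d s] ds elim by simp
    also have "2 * \<bar>s * c i\<bar> * (Lip_norm K f * (s * p d + 2 * \<bar>s * c i\<bar>)) / w i =
        s * (s * (2 * \<bar>c i\<bar> * (Lip_norm K f * (p d + 2 * \<bar>c i\<bar>)) / w i))"
      using elim by (simp add: abs_mult algebra_simps)
    finally have "\<bar>shifted_mean f (s *\<^sub>R d + (s * c i) *\<^sub>R e i) - shifted_mean f (s *\<^sub>R d) - (s * c i) * lift i f\<bar>
        \<le> s * (s * (2 * \<bar>c i\<bar> * (Lip_norm K f * (p d + 2 * \<bar>c i\<bar>)) / w i))" .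
    moreover have "\<Delta> s - c i * lift i f =
        (shifted_mean f (s *\<^sub>R d + (s * c i) *\<^sub>R e i) - shifted_mean f (s *\<^sub>R d) - (s * c i) * lift i f) / s"
      using elim by (simp add: \<Delta>_def field_simps)
    ultimately show ?case using elim(3)
      by (simp only: real_norm_def abs_divide abs_of_pos pos_divide_le_eq mult.commute)
  qed
  moreover have "((\<lambda>s. s * (2 * \<bar>c i\<bar> * (Lip_norm K f * (p d + 2 * \<bar>c i\<bar>)) / w i)) \<longlongrightarrow> 0) (at_right 0)"
    by (rule tendsto_eq_intros refl | simp)+
  ultimately have "((\<lambda>s. \<Delta> s - c i * lift i f) \<longlongrightarrow> 0) (at_right 0)"
    by (rule Lim_null_comparison)
  then have \<Delta>: "(\<Delta> \<longlongrightarrow> c i * lift i f) (at_right 0)" by (rule LIM_zero_cancel)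
  have "((\<lambda>s. \<Delta> s + (shifted_mean f (s *\<^sub>R d) - shifted_mean f 0) / s)
      \<longlongrightarrow> c i * lift i f + (\<Sum>i\<in>I. c i * lift i f)) (at_right 0)"
    by (rule tendsto_add[OF \<Delta> insert.IH[folded d_def]])
  moreover have "\<Delta> s + (shifted_mean f (s *\<^sub>R d) - shifted_mean f 0) / s =
      (shifted_mean f (s *\<^sub>R (d + c i *\<^sub>R e i)) - shifted_mean f 0) / s" for s
    by (simp add: \<Delta>_def scaleR_add_right add_divide_distrib[symmetric])
  ultimately show ?case unfolding sum sum.insert[OF insert.hyps] by (simp only:)
qed

text \<open>The Godefroy-Kalton lifting in coordinates: pairing with a 1-Lipschitz function gives a
  directional derivative of its mean, and every difference quotient is bounded by \<open>p\<close>
  of the direction. A one-sided limit is enough for that.\<close>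

theorem free_norm_lift_le:
  assumes I: "finite I"
  shows "free_norm K 0 (\<Sum>i\<in>I. c i *\<^sub>R lift i) \<le> p (\<lambda>j. if j \<in> I then c j else 0)"
proof (rule free_norm_le[OF zero_in_K])
  interpret F: normed_carrier "free_space K 0" "free_norm K 0"
    by (rule normed_carrier_free_space[OF zero_in_K])
  have "(\<Sum>i\<in>I. c i *\<^sub>R lift i) \<in> free_space K 0"
    by (intro subspace_sum[OF F.subspace] subspace_scale[OF F.subspace] lift_in_free_space)
  then show "(\<Sum>i\<in>I. c i *\<^sub>R lift i) \<in> Lip0_dual K 0"
    using free_space_subset_dual[OF zero_in_K] by blast
  fix f assume f: "f \<in> Lip0 K 0" and L: "Lip_norm K f \<le> 1"
  interpret prob_space P by (rule prob_space_P)
  define d where "d = (\<lambda>j. if j \<in> I then c j else 0)"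
  have ds: "summable (\<lambda>j. \<bar>d j\<bar>)" unfolding d_def by (rule summable_finite_support[OF I])
  have lim: "((\<lambda>s. \<bar>(shifted_mean f (s *\<^sub>R d) - shifted_mean f 0) / s\<bar>)
      \<longlongrightarrow> \<bar>\<Sum>i\<in>I. c i * lift i f\<bar>) (at_right 0)"
    unfolding d_def by (intro tendsto_rabs shifted_mean_directional_derivative[OF f I])
  have "\<forall>\<^sub>F s in at_right 0. \<bar>s * c j\<bar> \<le> w j" for j
  proof -
    have "((\<lambda>s. \<bar>s * c j\<bar>) \<longlongrightarrow> \<bar>0 * c j\<bar>) (at_right 0)" by (intro tendsto_intros)
    then have "\<forall>\<^sub>F s in at_right 0. \<bar>s * c j\<bar> < w j"
      by (rule order_tendstoD) (use w_pos in simp)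
    then show ?thesis by eventually_elim simp
  qed
  then have "\<forall>\<^sub>F s in at_right 0. \<forall>j\<in>I. \<bar>s * c j\<bar> \<le> w j"
    using I by (simp add: eventually_ball_finite)
  then have "\<forall>\<^sub>F s in at_right 0. \<bar>(shifted_mean f (s *\<^sub>R d) - shifted_mean f 0) / s\<bar> \<le> p d"
    using eventually_at_right_less[of 0]
  proof eventually_elim
    case (elim s)
    have sd: "\<bar>(s *\<^sub>R d) j\<bar> \<le> w j" "\<bar>(0 :: nat \<Rightarrow> real) j\<bar> \<le> w j" for j
      using elim w_pos[of j] by (auto simp: d_def)
    have int: "integrable P (\<lambda>x. f (cl x + s *\<^sub>R d))" "integrable P (\<lambda>x. f (cl x + 0))"
      by (intro Lip0_comp_integrable[OF f] continuous_cl_add cl_add_in_cube sd)+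
    have "\<bar>\<integral>x. f (cl x + s *\<^sub>R d) - f (cl x + 0) \<partial>P\<bar> \<le> p (s *\<^sub>R d)"
    proof (rule abs_expectation_le)
      show "integrable P (\<lambda>x. f (cl x + s *\<^sub>R d) - f (cl x + 0))" using int by simp
      fix x
      have "p (s *\<^sub>R d) \<ge> 0" using norm_ge_0[of "s *\<^sub>R d"] subspace_scale[OF subspace, of d s] ds by simp
      moreover have "\<bar>f (cl x + s *\<^sub>R d) - f (cl x + 0)\<bar> \<le> Lip_norm K f * p ((cl x + s *\<^sub>R d) - (cl x + 0))"
        by (intro Lip0_diff_le[OF f] cl_add_in_cube sd)
      ultimately show "\<bar>f (cl x + s *\<^sub>R d) - f (cl x + 0)\<bar> \<le> p (s *\<^sub>R d)"
        using L mult_right_mono[OF L] by fastforce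
    qed
    moreover have "p (s *\<^sub>R d) = s * p d" using norm_scale[of d s] ds elim by simp
    ultimately have "\<bar>shifted_mean f (s *\<^sub>R d) - shifted_mean f 0\<bar> \<le> s * p d"
      using int unfolding shifted_mean_def by simp
    then show ?case using elim by (simp add: abs_divide divide_le_eq mult.commute)
  qed
  then have "\<bar>\<Sum>i\<in>I. c i * lift i f\<bar> \<le> p d"
    by (intro tendsto_upperbound[OF lim]) auto
  then show "\<bar>(\<Sum>i\<in>I. c i *\<^sub>R lift i) f\<bar> \<le> p (\<lambda>j. if j \<in> I then c j else 0)"
    by (simp add: d_def sum_fun_apply)
qed

end

section \<open>Operators of finite rank\<close>

text \<open>A form of weak-star continuity on the unit ball. Finite combinations of point
  evaluations are continuous in the sup norm, and approximation in norm costs little on the ball. A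
  general element of \<open>Lip0_dual\<close> need not behave like this.\<close>

lemma free_space_weakly_continuous:
  assumes z: "z \<in> mspace M" and \<mu>: "\<mu> \<in> free_space M z" and r: "0 < r"
  obtains d where "0 < d" "\<And>f. f \<in> Lip0 M z \<Longrightarrow> Lip_norm M f \<le> 1 \<Longrightarrow>
    (\<And>x. x \<in> mspace M \<Longrightarrow> \<bar>f x\<bar> \<le> d) \<Longrightarrow> \<bar>\<mu> f\<bar> \<le> r"
proof -
  obtain \<nu> where \<nu>: "\<nu> \<in> span (point_evaluation M z ` mspace M)" "free_norm M z (\<mu> - \<nu>) < r / 2"
    using \<mu> r unfolding in_free_space_iff[OF z] by (meson half_gt_zero)
  have "\<exists>C\<ge>0. \<forall>f\<in>Lip0 M z. \<forall>d. (\<forall>x\<in>mspace M. \<bar>f x\<bar> \<le> d) \<longrightarrow> \<bar>\<nu> f\<bar> \<le> C * d"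
    using \<nu>(1)
  proof (induction rule: span_induct_alt)
    case base
    then show ?case by (intro exI[of _ 0]) auto
  next
    case (step c \<phi> \<psi>)
    then obtain x C where x: "x \<in> mspace M" "\<phi> = point_evaluation M z x"
      and C: "0 \<le> C" "\<And>f d. f \<in> Lip0 M z \<Longrightarrow> \<forall>x\<in>mspace M. \<bar>f x\<bar> \<le> d \<Longrightarrow> \<bar>\<psi> f\<bar> \<le> C * d"
      by blast
    have "\<bar>(c *\<^sub>R \<phi> + \<psi>) f\<bar> \<le> (\<bar>c\<bar> + C) * d" if f: "f \<in> Lip0 M z" "\<forall>x\<in>mspace M. \<bar>f x\<bar> \<le> d" for f d
    proof -
      have "\<bar>c * f x\<bar> \<le> \<bar>c\<bar> * d" using f x by (simp add: abs_mult mult_left_mono)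
      moreover have "\<phi> f = f x" using f(1) by (simp add: x(2) point_evaluation_def)
      ultimately show ?thesis using C(2)[OF f] by (simp add: distrib_right)
    qed
    then show ?case using C(1) by (intro exI[of _ "\<bar>c\<bar> + C"]) auto
  qed
  then obtain C where C: "0 \<le> C" "\<And>f d. f \<in> Lip0 M z \<Longrightarrow> \<forall>x\<in>mspace M. \<bar>f x\<bar> \<le> d \<Longrightarrow> \<bar>\<nu> f\<bar> \<le> C * d"
    by blast
  have dual: "\<mu> \<in> Lip0_dual M z" "\<nu> \<in> Lip0_dual M z"
    using \<mu> \<nu> free_space_subset_dual[OF z] span_point_evaluation_subset[OF z] by blast+
  interpret L: normed_carrier "Lip0 M z" "Lip_norm M" using normed_carrier_Lip0[OF z] .
  interpret D: normed_carrier "Lip0_dual M z" "free_norm M z"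
    unfolding Lip0_dual_def free_norm_def by (rule L.normed_carrier_dual)
  show thesis
  proof
    \<comment> \<open>Half of \<open>r\<close> goes to approximating \<open>\<mu>\<close> by
      \<open>\<nu>\<close>, the other half to \<open>\<nu>\<close> itself.\<close>
    show "0 < r / (2 * (C + 1))" using r C by simp
    fix f assume f: "f \<in> Lip0 M z" "Lip_norm M f \<le> 1"
      and small: "\<And>x. x \<in> mspace M \<Longrightarrow> \<bar>f x\<bar> \<le> r / (2 * (C + 1))"
    have sub: "\<mu> - \<nu> \<in> Lip0_dual M z" by (rule subspace_diff[OF D.subspace dual])
    have "\<bar>(\<mu> - \<nu>) f\<bar> \<le> free_norm M z (\<mu> - \<nu>) * Lip_norm M f"
      by (rule free_norm_bound[OF z sub f(1)])
    also have "\<dots> \<le> free_norm M z (\<mu> - \<nu>) * 1"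
      by (intro mult_left_mono f(2) D.norm_ge_0 sub)
    finally have "\<bar>\<mu> f - \<nu> f\<bar> \<le> r / 2" using \<nu>(2) by simp
    moreover have "\<bar>\<nu> f\<bar> \<le> C * (r / (2 * (C + 1)))" using C(2)[OF f(1)] small by blast
    moreover have "C * (r / (2 * (C + 1))) \<le> r / 2" using C(1) r by (simp add: field_simps)
    ultimately show "\<bar>\<mu> f\<bar> \<le> r" by linarith
  qed
qed

section \<open>Finite dimension and compactness in a normed carrier\<close>

context normed_carrier
begin

lemma norm_sum_le:
  assumes "finite B" "\<And>b. b \<in> B \<Longrightarrow> g b \<in> X"
  shows "n (\<Sum>b\<in>B. g b) \<le> (\<Sum>b\<in>B. n (g b))"
  using assms
proof (induction B rule: finite_induct)
  case (insert b B)
  have "(\<Sum>b\<in>B. g b) \<in> X" using insert.prems by (intro subspace_sum[OF subspace]) auto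
  then show ?case
    using insert norm_triangle[of "g b" "\<Sum>b\<in>B. g b"] by auto
qed (simp add: norm_zero)

lemma norm_diff_abs_le:
  assumes "x \<in> X" "y \<in> X" shows "\<bar>n x - n y\<bar> \<le> n (x - y)"
  using norm_triangle[of "x - y" y] norm_triangle[of "y - x" x] norm_minus_commute[OF assms]
    subspace_diff[OF subspace] assms by auto

text \<open>By compactness of the unit sphere of coefficient vectors, taken inside a product space.\<close>

lemma coefficients_bounded:
  assumes B: "finite B" "B \<subseteq> X" "independent B"
  obtains C where "0 \<le> C" "\<And>c b. b \<in> B \<Longrightarrow> \<bar>c b\<bar> \<le> C * n (\<Sum>b\<in>B. c b *\<^sub>R b)"
proof (cases "B = {}")
  case True
  then show thesis using that[of 0] by simp
next
  case False
  define N where "N c = n (\<Sum>b\<in>B. c b *\<^sub>R b)" for c :: "'v \<Rightarrow> real"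
  have inX: "(\<Sum>b\<in>B. c b *\<^sub>R b) \<in> X" for c :: "'v \<Rightarrow> real"
    using B(2) by (intro subspace_sum[OF subspace] subspace_scale[OF subspace]) auto
  \<comment> \<open>Coefficient vectors are functions on the whole type, pinned to 0 off
    \<open>B\<close>, so that Tychonoff applies; \<open>S\<close> is the unit sphere of the maximum
    norm.\<close>
  define Q where "Q = PiE UNIV (\<lambda>b. if b \<in> B then {-1..1} else {0 :: real})"
  define S where "S = Q \<inter> (\<Union>b\<in>B. {c. \<bar>c b\<bar> = 1})"
  have "compactin (product_topology (\<lambda>i. euclidean) UNIV) Q"
    unfolding Q_def by (auto simp: compactin_PiE)
  then have "compact Q" by (simp add: euclidean_product_topology)
  moreover have "closed (\<Union>b\<in>B. {c :: 'v \<Rightarrow> real. \<bar>c b\<bar> = 1})"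
    using B(1) by (intro closed_UN ballI closed_Collect_eq continuous_intros continuous_on_product_coordinates)
  ultimately have "compact S" unfolding S_def by (rule compact_Int_closed)
  moreover have "(\<lambda>b. if b \<in> B then 1 else 0) \<in> S"
    using False by (auto simp: S_def Q_def PiE_iff)
  then have "S \<noteq> {}" by blast
  moreover have "continuous_on S N"
  proof (rule continuous_on_subset[OF _ subset_UNIV], unfold continuous_on_def, intro ballI)
    fix c :: "'v \<Rightarrow> real"
    have "((\<lambda>d. \<Sum>b\<in>B. \<bar>d b - c b\<bar> * n b) \<longlongrightarrow> (\<Sum>b\<in>B. \<bar>c b - c b\<bar> * n b)) (at c within UNIV)"
      by (intro tendsto_intros continuous_on_product_coordinates[unfolded continuous_on_def, rule_format]) simp
    then have "((\<lambda>d. \<Sum>b\<in>B. \<bar>d b - c b\<bar> * n b) \<longlongrightarrow> 0) (at c within UNIV)" by simp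
    moreover have "norm (N d - N c) \<le> (\<Sum>b\<in>B. \<bar>d b - c b\<bar> * n b)" for d
    proof -
      have "\<bar>N d - N c\<bar> \<le> n ((\<Sum>b\<in>B. d b *\<^sub>R b) - (\<Sum>b\<in>B. c b *\<^sub>R b))"
        unfolding N_def by (rule norm_diff_abs_le[OF inX inX])
      also have "\<dots> = n (\<Sum>b\<in>B. (d b - c b) *\<^sub>R b)"
        by (simp add: sum_subtractf scaleR_diff_left)
      also have "\<dots> \<le> (\<Sum>b\<in>B. n ((d b - c b) *\<^sub>R b))"
        using B by (intro norm_sum_le subspace_scale[OF subspace]) auto
      finally show ?thesis using B norm_scale by (simp add: subset_iff)
    qed
    ultimately have "((\<lambda>d. N d - N c) \<longlongrightarrow> 0) (at c within UNIV)"
      by (intro Lim_null_comparison[of "\<lambda>d. N d - N c"] always_eventually) auto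
    then show "(N \<longlongrightarrow> N c) (at c within UNIV)" by (rule LIM_zero_cancel)
  qed
  ultimately obtain c0 where c0: "c0 \<in> S" "\<And>c. c \<in> S \<Longrightarrow> N c0 \<le> N c"
    using continuous_attains_inf[of S N] by blast
  have "N c0 \<noteq> 0"
  proof
    assume "N c0 = 0"
    then have "(\<Sum>b\<in>B. c0 b *\<^sub>R b) = 0" using norm_eq_0_iff[OF inX] by (simp add: N_def)
    then have "\<forall>b\<in>B. c0 b = 0" using independentD[OF B(3,1) subset_refl] by blast
    then show False using c0(1) by (auto simp: S_def)
  qed
  then have m: "0 < N c0" using norm_ge_0[OF inX] by (simp add: N_def less_le)
  show thesis
  proof
    show "0 \<le> 1 / N c0" using m by simp
    fix c :: "'v \<Rightarrow> real" and b assume b: "b \<in> B"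
    define m where "m = Max ((\<lambda>b. \<bar>c b\<bar>) ` B)"
    have le: "\<bar>c b\<bar> \<le> m" if "b \<in> B" for b using that B(1) by (simp add: m_def)
    show "\<bar>c b\<bar> \<le> 1 / N c0 * n (\<Sum>b\<in>B. c b *\<^sub>R b)"
    proof (cases "m = 0")
      case True
      then show ?thesis using le[OF b] norm_ge_0[OF inX] \<open>0 < N c0\<close> by simp
    next
      case False
      then have mpos: "0 < m" using le[OF b] by linarith
      define c' where "c' b = (if b \<in> B then c b / m else 0)" for b
      have "m \<in> (\<lambda>b. \<bar>c b\<bar>) ` B" unfolding m_def using b B(1) by (intro Max_in) auto
      then obtain b1 where b1: "b1 \<in> B" "\<bar>c b1\<bar> = m" by auto
      have "c' \<in> S"
        unfolding S_def Q_def
      proof (intro IntI PiE_I UN_I[OF b1(1)])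
        show "c' b \<in> (if b \<in> B then {-1..1} else {0})" for b
          using le[of b] mpos by (auto simp: c'_def abs_le_iff divide_le_eq le_divide_eq minus_le_iff)
        show "c' \<in> {c. \<bar>c b1\<bar> = 1}" using b1 mpos by (simp add: c'_def)
      qed simp
      then have "N c0 \<le> N c'" by (rule c0(2))
      also have "N c' = n ((1 / m) *\<^sub>R (\<Sum>b\<in>B. c b *\<^sub>R b))"
        unfolding N_def scaleR_sum_right by (intro arg_cong[where f = n] sum.cong) (auto simp: c'_def)
      also have "\<dots> = n (\<Sum>b\<in>B. c b *\<^sub>R b) / m" using norm_scale[OF inX, of "1 / m" c] mpos by simp
      finally have "m \<le> n (\<Sum>b\<in>B. c b *\<^sub>R b) / N c0"
        using mpos \<open>0 < N c0\<close> by (simp add: field_simps)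
      then show ?thesis using le[OF b] by simp
    qed
  qed
qed

text \<open>The basis is drawn from the range of \<open>T\<close>, because the finite set in
  \<open>finite_rank_operators\<close> may lie outside \<open>X\<close>, where \<open>n\<close>
  carries no information. Equivalence of norms on its span then bounds the coefficients.\<close>

lemma finite_rank_operator_coefficients:
  assumes T: "T \<in> finite_rank_operators X n"
  obtains B C where "finite B" "B \<subseteq> X" "0 \<le> C"
    "\<And>x. x \<in> X \<Longrightarrow> \<exists>c. T x = (\<Sum>b\<in>B. c b *\<^sub>R b) \<and> (\<forall>b\<in>B. \<bar>c b\<bar> \<le> C * n x)"
proof -
  obtain B0 D where lin: "linear_map_on X T" and TX: "T ` X \<subseteq> X" and B0: "finite B0" "T ` X \<subseteq> span B0"
    and D: "\<And>x. x \<in> X \<Longrightarrow> n (T x) \<le> D * n x"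
    using T unfolding finite_rank_operators_def bounded_operators_def by auto
  obtain B where B: "B \<subseteq> T ` X" "independent B" "T ` X \<subseteq> span B"
    using maximal_independent_subset[of "T ` X"] by blast
  have fin: "finite B" using independent_span_bound[OF B0(1) B(2)] B(1) B0(2) by blast
  have BX: "B \<subseteq> X" using B(1) TX by blast
  obtain C where C: "0 \<le> C" "\<And>c b. b \<in> B \<Longrightarrow> \<bar>c b\<bar> \<le> C * n (\<Sum>b\<in>B. c b *\<^sub>R b)"
    using coefficients_bounded[OF fin BX B(2)] by blast
  show thesis
  proof (rule that[OF fin BX])
    show "0 \<le> C * \<bar>D\<bar>" using C(1) by simp
    fix x assume x: "x \<in> X"
    then have "T x \<in> range (\<lambda>c. \<Sum>b\<in>B. c b *\<^sub>R b)"
      using B(3) unfolding span_finite[OF fin] by blast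
    then obtain c where c: "T x = (\<Sum>b\<in>B. c b *\<^sub>R b)" by blast
    have "\<bar>c b\<bar> \<le> C * \<bar>D\<bar> * n x" if "b \<in> B" for b
    proof -
      have "\<bar>c b\<bar> \<le> C * n (T x)" using C(2)[OF that, of c] by (simp add: c)
      also have "\<dots> \<le> C * (\<bar>D\<bar> * n x)"
        by (intro mult_left_mono C(1) order_trans[OF D[OF x]] mult_right_mono abs_ge_self norm_ge_0[OF x])
      finally show ?thesis by (simp add: mult.assoc)
    qed
    with c show "\<exists>c. T x = (\<Sum>b\<in>B. c b *\<^sub>R b) \<and> (\<forall>b\<in>B. \<bar>c b\<bar> \<le> C * \<bar>D\<bar> * n x)" by blast
  qed
qed

text \<open>An open set around 0 swallows all but finitely many of the finite sets
  \<open>G k\<close>, so finitely many further members complete a subcover.\<close>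

lemma compactin_null_union:
  assumes fin: "\<And>k. finite (G k)" and GX: "\<And>k. G k \<subseteq> X"
    and le: "\<And>k x. x \<in> G k \<Longrightarrow> n x \<le> r k" and r: "r \<longlonglongrightarrow> (0 :: real)"
  shows "compactin (mtopology_of (norm_metric X n)) (insert 0 (\<Union>k. G k))"
  unfolding compactin_def
proof (intro conjI allI impI)
  interpret N: Metric_space X "mdist (norm_metric X n)"
    using Metric_space_mspace_mdist[of "norm_metric X n"] by (simp add: mspace_norm_metric)
  have top: "mtopology_of (norm_metric X n) = N.mtopology"
    by (simp add: mtopology_of_def mspace_norm_metric)
  have zero: "0 \<in> X" by (rule subspace_0[OF subspace])
  show sub: "insert 0 (\<Union>k. G k) \<subseteq> topspace (mtopology_of (norm_metric X n))"
    using GX zero by (auto simp: top)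
  fix \<U> assume \<U>: "Ball \<U> (openin (mtopology_of (norm_metric X n))) \<and> insert 0 (\<Union>k. G k) \<subseteq> \<Union>\<U>"
  then obtain U where U: "U \<in> \<U>" "0 \<in> U" by blast
  then have "openin N.mtopology U" using \<U> unfolding top by blast
  then obtain s where s: "0 < s" "N.mball 0 s \<subseteq> U"
    using U(2) unfolding N.openin_mtopology by blast
  have "\<forall>\<^sub>F k in sequentially. r k < s" using r s(1) by (rule order_tendstoD)
  then obtain m where m: "\<And>k. m \<le> k \<Longrightarrow> r k < s" unfolding eventually_sequentially by blast
  have "G k \<subseteq> U" if "m \<le> k" for k
  proof
    fix x assume x: "x \<in> G k"
    then have xX: "x \<in> X" using GX by blast
    have "n (0 - x) = n x" using norm_minus_commute[OF zero xX] by simp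
    then have "mdist (norm_metric X n) 0 x < s"
      using le[OF x] m[OF that] mdist_norm_metric[OF zero xX] by simp
    then show "x \<in> U" using s(2) xX zero by (auto simp: N.in_mball)
  qed
  then have rest: "insert 0 (\<Union>k. G k) \<subseteq> U \<union> (\<Union>k<m. G k)"
    using U(2) by (auto simp: not_less[symmetric])
  have "finite (\<Union>k<m. G k)" using fin by blast
  moreover have "(\<Union>k<m. G k) \<subseteq> \<Union>\<U>" using \<U> by blast
  ultimately obtain F where F: "finite F" "F \<subseteq> \<U>" "(\<Union>k<m. G k) \<subseteq> \<Union>F"
    using finite_subset_Union by metis
  have "insert 0 (\<Union>k. G k) \<subseteq> \<Union>(insert U F)"
    unfolding Union_insert by (rule order_trans[OF rest Un_mono[OF order_refl F(3)]])
  then show "\<exists>\<F>. finite \<F> \<and> \<F> \<subseteq> \<U> \<and> insert 0 (\<Union>k. G k) \<subseteq> \<Union>\<F>"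
    using U(1) F(1,2) by (intro exI[of _ "insert U F"]) simp
qed

text \<open>The functionals \<open>\<beta> k\<close> play the role of traces: they converge, uniformly on operators that are
  small on a fixed compact set, to a functional that separates the identity from the finite rank
  operators.\<close>

lemma not_approximation_propertyI:
  fixes \<beta> :: "nat \<Rightarrow> ('v \<Rightarrow> 'v) \<Rightarrow> real"
  assumes s: "0 < s" "s < 1"
    and a: "a \<in> X" and \<Psi>: "\<And>k. finite (\<Psi> k)" "\<And>k. \<Psi> k \<subseteq> X"
    and \<Psi>_le: "\<And>k x. x \<in> \<Psi> k \<Longrightarrow> n x \<le> D * s ^ (2 * k)"
    and minus_id: "\<And>k T. \<beta> k (\<lambda>x. T x - x) = \<beta> k T - 1"
    and start: "\<And>S. linear_map_on X S \<Longrightarrow> S ` X \<subseteq> X \<Longrightarrow> \<bar>\<beta> 0 S\<bar> \<le> n (S a)"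
    and step: "\<And>S k r. linear_map_on X S \<Longrightarrow> S ` X \<subseteq> X \<Longrightarrow> (\<And>x. x \<in> \<Psi> k \<Longrightarrow> n (S x) \<le> r) \<Longrightarrow>
      \<bar>\<beta> (Suc k) S - \<beta> k S\<bar> \<le> r"
    and null: "\<And>T. T \<in> finite_rank_operators X n \<Longrightarrow> (\<lambda>k. \<beta> k T) \<longlonglongrightarrow> 0"
  shows "\<not> approximation_property X n"
proof
  assume AP: "approximation_property X n"
  \<comment> \<open>The decay \<open>s ^ (2 * k)\<close> is shared: one factor \<open>s ^ k\<close>
    is spent on rescaling, which makes the increments of \<open>\<beta>\<close> summable, and the
    other keeps the rescaled vectors a null sequence.\<close>
  define G where "G k = (\<lambda>x. (1 / s ^ k) *\<^sub>R x) ` \<Psi> k" for k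
  have GX: "G k \<subseteq> X" for k using \<Psi>(2) subspace_scale[OF subspace] by (auto simp: G_def)
  have G_le: "n x \<le> D * s ^ k" if "x \<in> G k" for x k
  proof -
    obtain y where y: "y \<in> \<Psi> k" "x = (1 / s ^ k) *\<^sub>R y" using \<open>x \<in> G k\<close> by (auto simp: G_def)
    then have "n x = n y / s ^ k" using norm_scale[of y "1 / s ^ k"] \<Psi>(2) s by (auto simp: subset_iff)
    also have "\<dots> \<le> (D * s ^ (2 * k)) / s ^ k" using \<Psi>_le[OF y(1)] s by (intro divide_right_mono) auto
    also have "\<dots> = D * s ^ k" using s by (simp add: mult_2 power_add)
    finally show ?thesis .
  qed
  have "(\<lambda>k. D * s ^ k) \<longlonglongrightarrow> D * 0" using s by (intro tendsto_mult_left LIMSEQ_power_zero) auto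
  then have "compactin (mtopology_of (norm_metric X n)) (insert 0 (\<Union>k. G k))"
    using \<Psi>(1) by (intro compactin_null_union[OF _ GX G_le]) (auto simp: G_def)
  moreover have "compactin (mtopology_of (norm_metric X n)) {a}"
    using a by (simp add: mspace_norm_metric)
  ultimately have comp: "compactin (mtopology_of (norm_metric X n)) (insert 0 (\<Union>k. G k) \<union> {a})"
    by (rule compactin_Un)
  \<comment> \<open>The increments then add up to at most r / (1 - s) = 1/4 and the start to at most
    1/4, which stays below the value 1 at the identity.\<close>
  define r where "r = (1 - s) / 4"
  have r: "0 < r" using s by (simp add: r_def)
  obtain T where T: "T \<in> finite_rank_operators X n"
    and close: "\<And>x. x \<in> insert 0 (\<Union>k. G k) \<union> {a} \<Longrightarrow> n (T x - x) < r"
    using AP[unfolded approximation_property_iff, rule_format, OF comp r] by blast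
  \<comment> \<open>Operators are \<open>undefined\<close> off \<open>X\<close>, so \<open>S\<close>
    need not be one of the \<open>bounded_operators\<close>; this is why \<open>start\<close> and
    \<open>step\<close> speak of linearity and invariance on \<open>X\<close>.\<close>
  define S where "S x = T x - x" for x
  have TX: "T x \<in> X" if "x \<in> X" for x
    using T that unfolding finite_rank_operators_def bounded_operators_def by auto
  have linT: "linear_map_on X T"
    using T unfolding finite_rank_operators_def bounded_operators_def by auto
  have lin: "linear_map_on X S"
    using linT unfolding linear_map_on_def S_def by (auto simp: algebra_simps)
  have SX: "S ` X \<subseteq> X" using TX subspace_diff[OF subspace] by (auto simp: S_def)
  have step': "\<bar>\<beta> (Suc k) S - \<beta> k S\<bar> \<le> s ^ k * r" for k
  proof (rule step[OF lin SX])
    fix x assume x: "x \<in> \<Psi> k"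
    then have xX: "x \<in> X" using \<Psi>(2) by blast
    have "(1 / s ^ k) *\<^sub>R x \<in> G k" using x by (auto simp: G_def)
    then have "n (S ((1 / s ^ k) *\<^sub>R x)) < r" using close unfolding S_def by blast
    moreover have "S ((1 / s ^ k) *\<^sub>R x) = (1 / s ^ k) *\<^sub>R S x"
      using lin xX unfolding linear_map_on_def by blast
    moreover have "S x \<in> X" using SX xX by blast
    ultimately have "n (S x) / s ^ k < r" using norm_scale[of "S x" "1 / s ^ k"] s by simp
    then show "n (S x) \<le> s ^ k * r" using s by (simp add: divide_less_eq mult.commute)
  qed
  have sum_bound: "\<bar>\<beta> k S\<bar> \<le> r + (\<Sum>l<k. s ^ l * r)" for k
  proof (induction k)
    case 0
    have "n (S a) < r" using close[of a] by (simp add: S_def)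
    then show ?case using start[OF lin SX] by simp
  next
    case (Suc k)
    then show ?case using step'[of k] by simp
  qed
  have geometric: "(\<Sum>l<k. s ^ l * r) \<le> 1 / 4" for k
  proof -
    have "(\<Sum>l<k. s ^ l * r) = (\<Sum>l<k. s ^ l) * r" by (simp add: sum_distrib_right)
    also have "(\<Sum>l<k. s ^ l) = (1 - s ^ k) / (1 - s)" using s by (simp add: sum_gp_strict)
    also have "\<dots> * r = (1 - s ^ k) / 4" using s by (simp add: r_def)
    also have "\<dots> \<le> 1 / 4" using s by simp
    finally show ?thesis .
  qed
  have "r \<le> 1 / 4" using s by (simp add: r_def)
  then have bound: "\<bar>\<beta> k S\<bar> \<le> 1 / 2" for k
    using sum_bound[of k] geometric[of k] by linarith
  have "1 / 2 \<le> \<beta> k T" for k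
  proof -
    have "\<beta> k S = \<beta> k T - 1" unfolding S_def by (rule minus_id)
    then show ?thesis using bound[of k] by linarith
  qed
  then have "1 / 2 \<le> (0 :: real)" by (intro LIMSEQ_le_const[OF null[OF T]]) blast
  then show False by simp
qed

end

text \<open>Images of the unit ball are combinations of finitely many fixed elements with bounded
  coefficients, so the least of their moduli of continuity serves for all images at once. This
  uniformity forces the averages of diagonal entries to 0.\<close>

lemma finite_rank_uniformly_weakly_continuous:
  assumes z: "z \<in> mspace M" and T: "T \<in> finite_rank_operators (free_space M z) (free_norm M z)" and r: "0 < r"
  obtains d where "0 < d" "\<And>\<mu> f. \<mu> \<in> free_space M z \<Longrightarrow> free_norm M z \<mu> \<le> 1 \<Longrightarrow> f \<in> Lip0 M z \<Longrightarrow>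
    Lip_norm M f \<le> 1 \<Longrightarrow> (\<And>x. x \<in> mspace M \<Longrightarrow> \<bar>f x\<bar> \<le> d) \<Longrightarrow> \<bar>T \<mu> f\<bar> \<le> r"
proof -
  interpret F: normed_carrier "free_space M z" "free_norm M z"
    by (rule normed_carrier_free_space[OF z])
  obtain B C where B: "finite B" "B \<subseteq> free_space M z" "0 \<le> C"
    and C: "\<And>x. x \<in> free_space M z \<Longrightarrow> \<exists>c. T x = (\<Sum>b\<in>B. c b *\<^sub>R b) \<and> (\<forall>b\<in>B. \<bar>c b\<bar> \<le> C * free_norm M z x)"
    using F.finite_rank_operator_coefficients[OF T] by blast
  define r' where "r' = r / (C * card B + 1)"
  have pos: "0 < C * card B + 1" using B(3) by (simp add: add_nonneg_pos)
  then have r': "0 < r'" using r by (simp add: r'_def)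
  have "\<exists>d>0. \<forall>f. f \<in> Lip0 M z \<longrightarrow> Lip_norm M f \<le> 1 \<longrightarrow> (\<forall>x\<in>mspace M. \<bar>f x\<bar> \<le> d) \<longrightarrow> \<bar>b f\<bar> \<le> r'"
    if "b \<in> B" for b
  proof -
    have b: "b \<in> free_space M z" using that B(2) by blast
    show ?thesis by (rule free_space_weakly_continuous[OF z b r']) blast
  qed
  then obtain d where d: "\<And>b. b \<in> B \<Longrightarrow> 0 < d b"
    "\<And>b f. b \<in> B \<Longrightarrow> f \<in> Lip0 M z \<Longrightarrow> Lip_norm M f \<le> 1 \<Longrightarrow> \<forall>x\<in>mspace M. \<bar>f x\<bar> \<le> d b \<Longrightarrow> \<bar>b f\<bar> \<le> r'"
    by metis
  \<comment> \<open>The inserted 1 keeps the minimum defined when \<open>B\<close> is empty.\<close>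
  define d0 where "d0 = Min (insert 1 (d ` B))"
  have d0: "0 < d0" "\<And>b. b \<in> B \<Longrightarrow> d0 \<le> d b" using B(1) d(1) by (auto simp: d0_def)
  show thesis
  proof (rule that[OF d0(1)])
    fix \<mu> f assume \<mu>: "\<mu> \<in> free_space M z" "free_norm M z \<mu> \<le> 1" and f: "f \<in> Lip0 M z" "Lip_norm M f \<le> 1"
      and small: "\<And>x. x \<in> mspace M \<Longrightarrow> \<bar>f x\<bar> \<le> d0"
    obtain c where c: "T \<mu> = (\<Sum>b\<in>B. c b *\<^sub>R b)" "\<And>b. b \<in> B \<Longrightarrow> \<bar>c b\<bar> \<le> C * free_norm M z \<mu>"
      using C[OF \<mu>(1)] by blast
    have "\<bar>c b * b f\<bar> \<le> C * r'" if "b \<in> B" for b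
    proof -
      have "\<bar>c b\<bar> \<le> C" using c(2)[OF that] mult_left_mono[OF \<mu>(2) B(3)] by simp
      moreover have "\<bar>b f\<bar> \<le> r'" using d(2)[OF that f] small d0(2)[OF that] by (meson order_trans)
      ultimately show ?thesis using B(3) by (simp add: abs_mult mult_mono)
    qed
    then have "\<bar>T \<mu> f\<bar> \<le> (\<Sum>b\<in>B. C * r')"
      unfolding c(1) sum_fun_apply by (intro order_trans[OF sum_abs] sum_mono) simp
    also have "\<dots> = (C * card B) * r'" by simp
    also have "\<dots> \<le> (C * card B + 1) * r'" using r' by (intro mult_right_mono) auto
    also have "\<dots> = r" using pos by (simp add: r'_def)
    finally show "\<bar>T \<mu> f\<bar> \<le> r" .
  qed
qed

section \<open>The cube of a Davie space\<close>

lemma sum_lessThan_shift: "(\<Sum>j<m. h (a + j)) = sum h {a..<a + m}" for h :: "nat \<Rightarrow> 'a::comm_monoid_add"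
  by (induction m) auto

lemma sum_two_levels:
  "(\<Sum>i\<in>{2 ^ k..<2 ^ (k + 2)}. h i) = (\<Sum>j<2 ^ k. h (2 ^ k + j)) + (\<Sum>j<2 ^ (k + 1). h (2 ^ (k + 1) + j))"
  for h :: "nat \<Rightarrow> 'a::comm_monoid_add"
proof -
  have e: "(2 :: nat) ^ k + 2 ^ k = 2 ^ (k + 1)" "(2 :: nat) ^ (k + 1) + 2 ^ (k + 1) = 2 ^ (k + 2)" by simp_all
  show ?thesis
    unfolding sum_lessThan_shift e by (rule sum.atLeastLessThan_concat[symmetric]) auto
qed

text \<open>Level \<open>k\<close> consists of the indices from \<open>2 ^ k\<close> up to, but
  excluding, \<open>2 ^ (k + 1)\<close>. Index 0 lies on no level, so the norm treats it
  separately.\<close>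

lemma dyadic_level:
  assumes "0 < (i :: nat)" obtains k j where "j < 2 ^ k" "i = 2 ^ k + j"
proof -
  obtain k where "2 ^ k \<le> i" "i < 2 ^ (k + 1)" using ex_power_ivl1[of 2 i] assms by auto
  then show thesis by (intro that[of "i - 2 ^ k" k]) auto
qed

lemma dyadic_level_unique:
  assumes "(i :: nat) < 2 ^ m" "2 ^ k \<le> 2 ^ m + i" "2 ^ m + i < 2 ^ (k + 1)" shows "m = k"
proof -
  have "(2 :: nat) ^ m < 2 ^ (k + 1)" "(2 :: nat) ^ k < 2 ^ (m + 1)" using assms by auto
  then have "m < k + 1" "k < m + 1" by (meson one_less_numeral_iff power_less_imp_less_exp semiring_norm(76))+
  then show ?thesis by simp
qed

lemma linear_map_on_sum:
  assumes "subspace X" "linear_map_on X S" "\<And>a. a \<in> A \<Longrightarrow> x a \<in> X"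
  shows "S (\<Sum>a\<in>A. c a *\<^sub>R x a) = (\<Sum>a\<in>A. c a *\<^sub>R S (x a))"
  using assms(3)
proof (induction A rule: infinite_finite_induct)
  case (infinite A)
  have "S (0 *\<^sub>R 0) = 0 *\<^sub>R S 0" using assms(1,2) subspace_0 unfolding linear_map_on_def by blast
  then show ?case using infinite by simp
next
  case empty
  have "S (0 *\<^sub>R 0) = 0 *\<^sub>R S 0" using assms(1,2) subspace_0 unfolding linear_map_on_def by blast
  then show ?case by simp
next
  case (insert a A)
  have a: "x a \<in> X" "c a *\<^sub>R x a \<in> X" using insert.prems by (auto intro: subspace_scale[OF assms(1)])
  have rest: "(\<Sum>a\<in>A. c a *\<^sub>R x a) \<in> X"
    using insert.prems by (intro subspace_sum[OF assms(1)] subspace_scale[OF assms(1)]) auto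
  have "S (c a *\<^sub>R x a + (\<Sum>a\<in>A. c a *\<^sub>R x a)) = c a *\<^sub>R S (x a) + S (\<Sum>a\<in>A. c a *\<^sub>R x a)"
    using assms(2) a rest unfolding linear_map_on_def by simp
  then show ?case using insert by simp
qed

lemma Lip0_dual_sum:
  assumes z: "z \<in> mspace M" and \<mu>: "\<mu> \<in> Lip0_dual M z" and f: "\<And>a. a \<in> A \<Longrightarrow> f a \<in> Lip0 M z"
  shows "\<mu> (\<Sum>a\<in>A. c a *\<^sub>R f a) = (\<Sum>a\<in>A. c a * \<mu> (f a))"
proof -
  interpret normed_carrier "Lip0 M z" "Lip_norm M" using normed_carrier_Lip0[OF z] .
  have "linear_map_on (Lip0 M z) \<mu>" using \<mu> by (simp add: Lip0_dual_def dual_space_def)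
  from linear_map_on_sum[OF subspace this f] show ?thesis by simp
qed

section \<open>Linear functionals as Lipschitz functions on the cube\<close>

context norm_cube
begin

definition cut :: "((nat \<Rightarrow> real) \<Rightarrow> real) \<Rightarrow> (nat \<Rightarrow> real) \<Rightarrow> real"
  where "cut \<phi> = (\<lambda>x. if x \<in> cube then \<phi> x else 0)"

lemma cut_in_Lip0:
  assumes diff: "\<And>x y. \<phi> (x - y) = \<phi> x - \<phi> y"
    and le: "\<And>x. summable (\<lambda>i. \<bar>x i\<bar>) \<Longrightarrow> \<bar>\<phi> x\<bar> \<le> p x"
  shows "cut \<phi> \<in> Lip0 K 0" "Lip_norm K (cut \<phi>) \<le> 1"
proof -
  have *: "\<bar>cut \<phi> x - cut \<phi> y\<bar> \<le> 1 * mdist K x y" if "x \<in> mspace K" "y \<in> mspace K" for x y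
  proof -
    have xy: "x \<in> cube" "y \<in> cube" using that mspace_K by auto
    have "summable (\<lambda>i. \<bar>(x - y) i\<bar>)"
      using subspace_diff[OF subspace, of x y] xy cube_summable by simp
    then have "\<bar>\<phi> (x - y)\<bar> \<le> p (x - y)" by (rule le)
    then show ?thesis unfolding diff using xy by (simp only: cut_def mdist_K if_True mult_1)
  qed
  have "\<phi> 0 = 0" using diff[of 0 0] by simp
  then show "cut \<phi> \<in> Lip0 K 0"
    by (intro Lip0_I[OF *]) (auto simp: cut_def mspace_K)
  show "Lip_norm K (cut \<phi>) \<le> 1"
    by (rule Lip_norm_least[OF _ *]) auto
qed

abbreviation coord :: "nat \<Rightarrow> (nat \<Rightarrow> real) \<Rightarrow> real" where "coord i \<equiv> cut (\<lambda>x. x i)"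

lemma coord_in_Lip0: "coord i \<in> Lip0 K 0" "Lip_norm K (coord i) \<le> 1"
  by (rule cut_in_Lip0; use coordinate_le_norm in simp)+

lemma lift_coord: "lift i (coord j) = (if j = i then 1 else 0)"
  using lift_coordinate[of j i] coord_in_Lip0(1)[of j] by (simp add: cut_def)

end

section \<open>The norm built from the balanced systems\<close>

locale davie =
  fixes \<sigma> \<tau> :: "nat \<Rightarrow> nat \<Rightarrow> nat \<Rightarrow> real"
  assumes balanced: "balanced_systems k (\<sigma> k) (\<tau> k)"
    and cross: "g < 2 ^ (k + 2) \<Longrightarrow> h < 2 ^ (k + 3) \<Longrightarrow>
      \<bar>(\<Sum>j<2 ^ (k + 1). \<tau> k j g * \<sigma> (k + 1) j h) / 2 ^ (k + 1)\<bar> \<le> 35 * (3 / 4) ^ k"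
begin

text \<open>Consecutive rows overlap: level \<open>m\<close> is seen through
  \<open>\<sigma> m\<close> in the rows of level \<open>m\<close> and, if \<open>m\<close> is
  positive, through \<open>\<tau> (m - 1)\<close> in the rows of level \<open>m - 1\<close>.\<close>

definition row :: "nat \<Rightarrow> nat \<Rightarrow> (nat \<Rightarrow> real) \<Rightarrow> real"
  where "row k g x = (\<Sum>j<2 ^ k. \<sigma> k j g * x (2 ^ k + j)) + (\<Sum>j<2 ^ (k + 1). \<tau> k j g * x (2 ^ (k + 1) + j))"

definition p :: "(nat \<Rightarrow> real) \<Rightarrow> real"
  where "p x = Sup (insert \<bar>x 0\<bar> {\<bar>row k g x\<bar> | k g. g < 2 ^ (k + 2)})"

lemma row_diff: "row k g (x - y) = row k g x - row k g y"
  by (simp add: row_def sum_subtractf right_diff_distrib)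

lemma row_add: "row k g (x + y) = row k g x + row k g y"
  by (simp add: row_def sum.distrib distrib_left)

lemma row_scale: "row k g (c *\<^sub>R x) = c * row k g x"
  by (simp add: row_def sum_distrib_left distrib_left mult_ac)

lemma row_le_sum:
  assumes "summable (\<lambda>i. \<bar>x i\<bar>)" shows "\<bar>row k g x\<bar> \<le> (\<Sum>i. \<bar>x i\<bar>)"
proof -
  have "\<bar>row k g x\<bar> \<le> \<bar>\<Sum>j<2 ^ k. \<sigma> k j g * x (2 ^ k + j)\<bar> + \<bar>\<Sum>j<2 ^ (k + 1). \<tau> k j g * x (2 ^ (k + 1) + j)\<bar>"
    unfolding row_def by (rule abs_triangle_ineq)
  also have "\<dots> \<le> (\<Sum>j<2 ^ k. \<bar>x (2 ^ k + j)\<bar>) + (\<Sum>j<2 ^ (k + 1). \<bar>x (2 ^ (k + 1) + j)\<bar>)"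
    by (intro add_mono order_trans[OF sum_abs] sum_mono)
      (simp_all add: abs_mult balanced_systemsD(1,2)[OF balanced])
  also have "\<dots> = (\<Sum>i\<in>{2 ^ k..<2 ^ (k + 2)}. \<bar>x i\<bar>)"
    by (rule sum_two_levels[symmetric])
  also have "\<dots> \<le> (\<Sum>i. \<bar>x i\<bar>)"
    by (rule sum_le_suminf[OF assms]) auto
  finally show ?thesis .
qed

lemma bdd_above_rows:
  assumes "summable (\<lambda>i. \<bar>x i\<bar>)"
  shows "bdd_above (insert \<bar>x 0\<bar> {\<bar>row k g x\<bar> | k g. g < 2 ^ (k + 2)})"
  using row_le_sum[OF assms] by (intro bdd_above_insert[THEN iffD2] bdd_aboveI[of _ "\<Sum>i. \<bar>x i\<bar>"]) auto

lemma row_le_norm: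
  assumes "summable (\<lambda>i. \<bar>x i\<bar>)" "g < 2 ^ (k + 2)" shows "\<bar>row k g x\<bar> \<le> p x"
  unfolding p_def by (rule cSup_upper[OF _ bdd_above_rows[OF assms(1)]]) (use assms(2) in blast)

lemma first_le_norm:
  assumes "summable (\<lambda>i. \<bar>x i\<bar>)" shows "\<bar>x 0\<bar> \<le> p x"
  unfolding p_def by (rule cSup_upper[OF _ bdd_above_rows[OF assms(1)]]) simp

lemma norm_le:
  assumes "\<bar>x 0\<bar> \<le> B" "\<And>k g. g < 2 ^ (k + 2) \<Longrightarrow> \<bar>row k g x\<bar> \<le> B" shows "p x \<le> B"
  unfolding p_def by (rule cSup_least) (use assms in auto)

text \<open>Fourier inversion: the chosen column is orthogonal to all other columns of both systems,
  so pairing it with the rows isolates one coordinate. As a signed average of row values, the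
  coordinate is at most \<open>p x\<close>.\<close>

lemma coordinate_eq_\<sigma>:
  assumes j: "j < 2 ^ k"
  shows "x (2 ^ k + j) = (\<Sum>g<2 ^ (k + 2). \<sigma> k j g * row k g x) / 2 ^ (k + 2)"
proof -
  have "(\<Sum>g<2 ^ (k + 2). \<sigma> k j g * row k g x) =
      (\<Sum>g<2 ^ (k + 2). \<Sum>i<2 ^ k. (\<sigma> k j g * \<sigma> k i g) * x (2 ^ k + i)) +
      (\<Sum>g<2 ^ (k + 2). \<Sum>i<2 ^ (k + 1). (\<sigma> k j g * \<tau> k i g) * x (2 ^ (k + 1) + i))"
    by (simp only: row_def distrib_left sum.distrib sum_distrib_left mult.assoc)
  also have "\<dots> = (\<Sum>i<2 ^ k. (\<Sum>g<2 ^ (k + 2). \<sigma> k j g * \<sigma> k i g) * x (2 ^ k + i)) +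
      (\<Sum>i<2 ^ (k + 1). (\<Sum>g<2 ^ (k + 2). \<sigma> k j g * \<tau> k i g) * x (2 ^ (k + 1) + i))"
    by (subst (1 2) sum.swap) (simp only: sum_distrib_right)
  also have "\<dots> = (\<Sum>i<2 ^ k. (if i = j then 2 ^ (k + 2) * x (2 ^ k + j) else 0)) + (\<Sum>i<(2 :: nat) ^ (k + 1). 0 :: real)"
  proof (intro arg_cong2[where f = "(+)"] sum.cong refl)
    fix i :: nat assume "i \<in> {..<2 ^ k}"
    then show "(\<Sum>g<2 ^ (k + 2). \<sigma> k j g * \<sigma> k i g) * x (2 ^ k + i) = (if i = j then 2 ^ (k + 2) * x (2 ^ k + j) else 0)"
      using balanced_systemsD(3)[OF balanced j, of i] by auto
  next
    fix i :: nat assume "i \<in> {..<2 ^ (k + 1)}"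
    then show "(\<Sum>g<2 ^ (k + 2). \<sigma> k j g * \<tau> k i g) * x (2 ^ (k + 1) + i) = 0"
      using balanced_systemsD(5)[OF balanced j, of i] by simp
  qed
  also have "\<dots> = 2 ^ (k + 2) * x (2 ^ k + j)" using j by simp
  finally show ?thesis by simp
qed

lemma coordinate_eq_\<tau>:
  assumes j: "j < 2 ^ (k + 1)"
  shows "x (2 ^ (k + 1) + j) = (\<Sum>g<2 ^ (k + 2). \<tau> k j g * row k g x) / 2 ^ (k + 2)"
proof -
  have "(\<Sum>g<2 ^ (k + 2). \<tau> k j g * row k g x) =
      (\<Sum>g<2 ^ (k + 2). \<Sum>i<2 ^ k. (\<tau> k j g * \<sigma> k i g) * x (2 ^ k + i)) +
      (\<Sum>g<2 ^ (k + 2). \<Sum>i<2 ^ (k + 1). (\<tau> k j g * \<tau> k i g) * x (2 ^ (k + 1) + i))"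
    by (simp only: row_def distrib_left sum.distrib sum_distrib_left mult.assoc)
  also have "\<dots> = (\<Sum>i<2 ^ k. (\<Sum>g<2 ^ (k + 2). \<sigma> k i g * \<tau> k j g) * x (2 ^ k + i)) +
      (\<Sum>i<2 ^ (k + 1). (\<Sum>g<2 ^ (k + 2). \<tau> k j g * \<tau> k i g) * x (2 ^ (k + 1) + i))"
    by (subst (1 2) sum.swap) (simp only: sum_distrib_right mult.commute[of "\<tau> k j _" "\<sigma> k _ _"])
  also have "\<dots> = (\<Sum>i<(2 :: nat) ^ k. 0 :: real) + (\<Sum>i<2 ^ (k + 1). (if i = j then 2 ^ (k + 2) * x (2 ^ (k + 1) + j) else 0))"
  proof (intro arg_cong2[where f = "(+)"] sum.cong refl)
    fix i :: nat assume "i \<in> {..<2 ^ (k + 1)}"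
    then show "(\<Sum>g<2 ^ (k + 2). \<tau> k j g * \<tau> k i g) * x (2 ^ (k + 1) + i) = (if i = j then 2 ^ (k + 2) * x (2 ^ (k + 1) + j) else 0)"
      using balanced_systemsD(4)[OF balanced j, of i] by auto
  next
    fix i :: nat assume "i \<in> {..<2 ^ k}"
    then show "(\<Sum>g<2 ^ (k + 2). \<sigma> k i g * \<tau> k j g) * x (2 ^ k + i) = 0"
      using balanced_systemsD(5)[OF balanced _ j, of i] by simp
  qed
  also have "\<dots> = 2 ^ (k + 2) * x (2 ^ (k + 1) + j)" using j by simp
  finally show ?thesis by simp
qed

lemma coordinate_le:
  assumes x: "summable (\<lambda>i. \<bar>x i\<bar>)" shows "\<bar>x i\<bar> \<le> p x"
proof (cases "i = 0")
  case True
  then show ?thesis using first_le_norm[OF x] by simp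
next
  case False
  then obtain k j where kj: "j < 2 ^ k" "i = 2 ^ k + j" using dyadic_level by blast
  have "\<bar>\<Sum>g<2 ^ (k + 2). \<sigma> k j g * row k g x\<bar> \<le> (\<Sum>g<(2 :: nat) ^ (k + 2). p x)"
    by (intro order_trans[OF sum_abs] sum_mono)
      (use row_le_norm[OF x] in \<open>simp add: abs_mult balanced_systemsD(1)[OF balanced]\<close>)
  then show ?thesis
    unfolding kj(2) coordinate_eq_\<sigma>[OF kj(1), of x] by (simp add: abs_divide divide_le_eq mult.commute)
qed

sublocale norm_cube p "\<lambda>i. (1 / 2) ^ i"
proof
  show "subspace {x :: nat \<Rightarrow> real. summable (\<lambda>i. \<bar>x i\<bar>)}"
  proof (rule subspaceI)
    fix x y :: "nat \<Rightarrow> real" and c :: real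
    assume x: "x \<in> {x. summable (\<lambda>i. \<bar>x i\<bar>)}"
    show "c *\<^sub>R x \<in> {x. summable (\<lambda>i. \<bar>x i\<bar>)}" using x by (simp add: abs_mult summable_mult)
    assume y: "y \<in> {x. summable (\<lambda>i. \<bar>x i\<bar>)}"
    show "x + y \<in> {x. summable (\<lambda>i. \<bar>x i\<bar>)}"
      using x y by (auto intro!: summable_rabs_comparison_test[OF _ summable_add[of "\<lambda>i. \<bar>x i\<bar>" "\<lambda>i. \<bar>y i\<bar>"]])
  qed simp
  fix x y :: "nat \<Rightarrow> real" and c :: real
  have zero: "summable (\<lambda>i. \<bar>(0 :: nat \<Rightarrow> real) i\<bar>)" by simp
  have nonneg: "0 \<le> p x" if "summable (\<lambda>i. \<bar>x i\<bar>)" for x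
    using first_le_norm[OF that] by linarith
  have scale_le: "p (c *\<^sub>R x) \<le> \<bar>c\<bar> * p x" if "summable (\<lambda>i. \<bar>x i\<bar>)" for c x
    using first_le_norm[OF that] row_le_norm[OF that]
    by (intro norm_le) (auto simp: abs_mult row_scale intro!: mult_left_mono)
  assume "x \<in> {x. summable (\<lambda>i. \<bar>x i\<bar>)}"
  then have x: "summable (\<lambda>i. \<bar>x i\<bar>)" by simp
  show "0 \<le> p x" by (rule nonneg[OF x])
  show "p x = 0 \<longleftrightarrow> x = 0"
  proof
    assume "p x = 0"
    then show "x = 0" using coordinate_le[OF x] by (auto simp: fun_eq_iff)
  next
    assume "x = 0"
    moreover have "p 0 \<le> 0" by (rule norm_le) (auto simp: row_def)
    ultimately show "p x = 0" using nonneg[of 0, OF zero] by (simp only: order_antisym)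
  qed
  show "p (c *\<^sub>R x) = \<bar>c\<bar> * p x"
  proof (cases "c = 0")
    case True
    then show ?thesis using scale_le[OF x, of c] nonneg[of 0, OF zero] by simp
  next
    case False
    have cx: "summable (\<lambda>i. \<bar>(c *\<^sub>R x) i\<bar>)" using x by (simp add: abs_mult summable_mult)
    have "p x \<le> \<bar>1 / c\<bar> * p (c *\<^sub>R x)"
    proof -
      have "(1 / c) *\<^sub>R (c *\<^sub>R x) = x" using False by simp
      then show ?thesis using scale_le[where x = "c *\<^sub>R x" and c = "1 / c", OF cx] by (simp only:)
    qed
    then show ?thesis using scale_le[OF x, of c] False by (simp add: field_simps)
  qed
  assume "y \<in> {x. summable (\<lambda>i. \<bar>x i\<bar>)}"
  then have y: "summable (\<lambda>i. \<bar>y i\<bar>)" by simp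
  show "p (x + y) \<le> p x + p y"
  proof (rule norm_le)
    show "\<bar>(x + y) 0\<bar> \<le> p x + p y" using first_le_norm[OF x] first_le_norm[OF y] by simp
    show "\<bar>row k g (x + y)\<bar> \<le> p x + p y" if "g < 2 ^ (k + 2)" for k g
      using row_le_norm[OF x that] row_le_norm[OF y that] by (simp add: row_add)
  qed
next
  show "summable (\<lambda>i. (1 / 2 :: real) ^ i)" by (rule summable_geometric) simp
  fix x :: "nat \<Rightarrow> real" and i assume x: "summable (\<lambda>i. \<bar>x i\<bar>)"
  show "p x \<le> (\<Sum>i. \<bar>x i\<bar>)"
  proof (rule norm_le[OF _ row_le_sum[OF x]])
    show "\<bar>x 0\<bar> \<le> (\<Sum>i. \<bar>x i\<bar>)" using sum_le_suminf[OF x, of "{0}"] by simp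
  qed
  show "\<bar>x i\<bar> \<le> p x" by (rule coordinate_le[OF x])
qed simp

section \<open>The traces and the vectors behind their increments\<close>

lemma row_in_Lip0:
  assumes "g < 2 ^ (k + 2)"
  shows "cut (row k g) \<in> Lip0 K 0" "Lip_norm K (cut (row k g)) \<le> 1"
  by (rule cut_in_Lip0; use row_diff row_le_norm[OF _ assms] in simp)+

text \<open>Orthogonality expresses each coordinate of level \<open>k + 1\<close> through the rows of level \<open>k\<close> as well as
  through those of level \<open>k + 1\<close>, which is what makes \<open>\<beta> (k + 1) - \<beta> k\<close> small.\<close>

definition \<beta> :: "nat \<Rightarrow> ((((nat \<Rightarrow> real) \<Rightarrow> real) \<Rightarrow> real) \<Rightarrow> ((nat \<Rightarrow> real) \<Rightarrow> real) \<Rightarrow> real) \<Rightarrow> real"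
  where "\<beta> k S = (\<Sum>j<2 ^ k. S (lift (2 ^ k + j)) (coord (2 ^ k + j))) / 2 ^ k"

text \<open>Weights of a mean over level \<open>k + 1\<close> minus those of a mean over level
  \<open>k\<close>, arranged so that \<open>\<psi> k g\<close> carries the increment of
  \<open>\<beta>\<close> seen by row \<open>g\<close>. The formula is meant for indices of these two
  levels; below them the subtraction truncates.\<close>

definition coeff :: "nat \<Rightarrow> nat \<Rightarrow> nat \<Rightarrow> real"
  where "coeff k g i = (if i < 2 ^ (k + 1) then - (\<sigma> k (i - 2 ^ k) g / 2 ^ k)
    else \<tau> k (i - 2 ^ (k + 1)) g / 2 ^ (k + 1))"

definition \<psi> :: "nat \<Rightarrow> nat \<Rightarrow> ((nat \<Rightarrow> real) \<Rightarrow> real) \<Rightarrow> real"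
  where "\<psi> k g = (\<Sum>i\<in>{2 ^ k..<2 ^ (k + 2)}. coeff k g i *\<^sub>R lift i)"

lemma coeff_level:
  "j < 2 ^ k \<Longrightarrow> coeff k g (2 ^ k + j) = - (\<sigma> k j g / 2 ^ k)"
  "coeff k g (2 ^ (k + 1) + j) = \<tau> k j g / 2 ^ (k + 1)"
  by (simp_all add: coeff_def)

text \<open>Only rows of levels \<open>k - 1\<close>, \<open>k\<close> and \<open>k + 1\<close> meet
  the support. At level \<open>k\<close> the two means nearly cancel; at its neighbours one block
  remains, which the cross correlations control. Level \<open>k - 1\<close> is the worst, with 35 *
  4/3 < 47.\<close>

lemma norm_coeff_le:
  assumes g: "g < 2 ^ (k + 2)"
  shows "p (\<lambda>i. if i \<in> {2 ^ k..<2 ^ (k + 2)} then coeff k g i else 0) \<le> 47 * (3 / 4) ^ k"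
proof -
  define d where "d i = (if i \<in> {2 ^ k..<2 ^ (k + 2)} then coeff k g i else 0)" for i
  have d: "d (2 ^ m + j) = (if m = k then - (\<sigma> k j g / 2 ^ k) else if m = k + 1 then \<tau> k j g / 2 ^ (k + 1) else 0)"
    if j: "j < 2 ^ m" for m j
  proof -
    have levels: "m = k \<or> m = k + 1" if "2 ^ m + j \<in> {2 ^ k..<2 ^ (k + 2)}"
      using that dyadic_level_unique[OF j, of k] dyadic_level_unique[OF j, of "k + 1"]
      by (cases "2 ^ m + j < 2 ^ (k + 1)") auto
    consider "m = k" | "m = k + 1" | "m \<noteq> k" "m \<noteq> k + 1" by blast
    then show ?thesis
    proof cases
      case 1
      then have "2 ^ k + j < 2 ^ (k + 2)" using j by simp
      then show ?thesis using 1 j coeff_level(1)[of j k g] by (simp add: d_def)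
    next
      case 2
      then have "2 ^ (k + 1) + j < 2 ^ (k + 2)" "2 ^ k \<le> 2 ^ (k + 1) + j" using j by auto
      then show ?thesis using 2 coeff_level(2)[of k g j] by (simp add: d_def)
    next
      case 3
      then have "2 ^ m + j \<notin> {2 ^ k..<2 ^ (k + 2)}" using levels by blast
      then show ?thesis unfolding d_def if_not_P[OF 3(1)] if_not_P[OF 3(2)] by (rule if_not_P)
    qed
  qed
  have row_d: "row l h d =
      (\<Sum>j<2 ^ l. \<sigma> l j h * (if l = k then - (\<sigma> k j g / 2 ^ k) else if l = k + 1 then \<tau> k j g / 2 ^ (k + 1) else 0)) +
      (\<Sum>j<2 ^ (l + 1). \<tau> l j h * (if l + 1 = k then - (\<sigma> k j g / 2 ^ k) else if l + 1 = k + 1 then \<tau> k j g / 2 ^ (k + 1) else 0))" for l h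
    unfolding row_def by (intro arg_cong2[where f = "(+)"] sum.cong refl; subst d; simp)
  have weaken: "35 * (3 / 4) ^ k \<le> 47 * (3 / 4 :: real) ^ k" by simp
  have "p d \<le> 47 * (3 / 4) ^ k"
  proof (rule norm_le)
    show "\<bar>d 0\<bar> \<le> 47 * (3 / 4) ^ k" by (simp add: d_def)
    fix l h :: nat assume h: "h < 2 ^ (l + 2)"
    consider "l = k" | "l = k + 1" | "k = l + 1" | "l \<noteq> k" "l \<noteq> k + 1" "k \<noteq> l + 1" by blast
    then show "\<bar>row l h d\<bar> \<le> 47 * (3 / 4) ^ k"
    proof cases
      case 1
      have "row l h d = (\<Sum>j<2 ^ (k + 1). \<tau> k j h * \<tau> k j g) / 2 ^ (k + 1) - (\<Sum>j<2 ^ k. \<sigma> k j h * \<sigma> k j g) / 2 ^ k"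
        unfolding row_d 1 by (simp add: sum_negf sum_divide_distrib)
      also have "\<bar>\<dots>\<bar> \<le> 35 * (3 / 4) ^ k"
        by (rule balanced_systemsD(6)[OF balanced _ g]) (use h 1 in simp)
      finally show ?thesis using weaken by linarith
    next
      case 2
      have h': "h < 2 ^ (k + 3)" using h unfolding 2 by (simp add: power_add)
      have "row l h d = (\<Sum>j<2 ^ (k + 1). \<tau> k j g * \<sigma> (k + 1) j h) / 2 ^ (k + 1)"
        unfolding row_d 2 by (simp add: sum_divide_distrib mult.commute)
      also have "\<bar>\<dots>\<bar> \<le> 35 * (3 / 4) ^ k" by (rule cross[OF g h'])
      finally show ?thesis using weaken by linarith
    next
      case 3
      have g': "g < 2 ^ (l + 3)" using g unfolding 3 by (simp add: power_add)
      have "\<bar>row l h d\<bar> = \<bar>(\<Sum>j<2 ^ (l + 1). \<tau> l j h * \<sigma> (l + 1) j g) / 2 ^ (l + 1)\<bar>"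
        unfolding row_d 3 by (simp add: sum_divide_distrib sum_negf)
      also have "\<dots> \<le> 35 * (3 / 4) ^ l" by (rule cross[OF h g'])
      also have "\<dots> \<le> 47 * (3 / 4) ^ k" unfolding 3 by simp
      finally show ?thesis .
    next
      case 4
      then show ?thesis unfolding row_d by simp
    qed
  qed
  then show ?thesis unfolding d_def .
qed

interpretation F: normed_carrier "free_space K 0" "free_norm K 0"
  by (rule normed_carrier_free_space[OF zero_in_K])

lemma \<psi>_in_free_space: "\<psi> k g \<in> free_space K 0"
  unfolding \<psi>_def by (intro subspace_sum[OF F.subspace] subspace_scale[OF F.subspace] lift_in_free_space)

lemma norm_\<psi>_le: "g < 2 ^ (k + 2) \<Longrightarrow> free_norm K 0 (\<psi> k g) \<le> 47 * (3 / 4) ^ k"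
  unfolding \<psi>_def by (rule order_trans[OF free_norm_lift_le norm_coeff_le]) auto

lemma norm_lift_le: "free_norm K 0 (lift i) \<le> 1"
proof -
  have "(\<lambda>j. if j \<in> {i} then 1 else 0) = 1 *\<^sub>R e i" by (auto simp: e_def fun_eq_iff)
  then show ?thesis using free_norm_lift_le[of "{i}" "\<lambda>_. 1"] norm_unit[of 1 i] by simp
qed

lemma free_pairing_le:
  assumes "\<mu> \<in> free_space K 0" "f \<in> Lip0 K 0" "Lip_norm K f \<le> 1"
  shows "\<bar>\<mu> f\<bar> \<le> free_norm K 0 \<mu>"
proof -
  have "\<bar>\<mu> f\<bar> \<le> free_norm K 0 \<mu> * Lip_norm K f"
    using free_norm_bound[OF zero_in_K _ assms(2)] free_space_subset_dual[OF zero_in_K] assms(1) by blast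
  also have "\<dots> \<le> free_norm K 0 \<mu> * 1" by (intro mult_left_mono assms(3) F.norm_ge_0 assms(1))
  finally show ?thesis by simp
qed

lemma pairing_coord_\<sigma>:
  assumes \<mu>: "\<mu> \<in> free_space K 0" and j: "j < 2 ^ k"
  shows "\<mu> (coord (2 ^ k + j)) = (\<Sum>g<2 ^ (k + 2). \<sigma> k j g * \<mu> (cut (row k g))) / 2 ^ (k + 2)"
proof -
  have "coord (2 ^ k + j) = (\<Sum>g<2 ^ (k + 2). (\<sigma> k j g / 2 ^ (k + 2)) *\<^sub>R cut (row k g))"
    using coordinate_eq_\<sigma>[OF j] by (auto simp: fun_eq_iff sum_fun_apply cut_def sum_divide_distrib)
  moreover have "\<mu> (\<Sum>g<2 ^ (k + 2). (\<sigma> k j g / 2 ^ (k + 2)) *\<^sub>R cut (row k g)) =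
      (\<Sum>g<2 ^ (k + 2). (\<sigma> k j g / 2 ^ (k + 2)) * \<mu> (cut (row k g)))"
    using \<mu> free_space_subset_dual[OF zero_in_K] row_in_Lip0(1)
    by (intro Lip0_dual_sum[OF zero_in_K]) auto
  ultimately show ?thesis by (simp add: sum_divide_distrib)
qed

lemma pairing_coord_\<tau>:
  assumes \<mu>: "\<mu> \<in> free_space K 0" and j: "j < 2 ^ (k + 1)"
  shows "\<mu> (coord (2 ^ (k + 1) + j)) = (\<Sum>g<2 ^ (k + 2). \<tau> k j g * \<mu> (cut (row k g))) / 2 ^ (k + 2)"
proof -
  have "coord (2 ^ (k + 1) + j) = (\<Sum>g<2 ^ (k + 2). (\<tau> k j g / 2 ^ (k + 2)) *\<^sub>R cut (row k g))"
    using coordinate_eq_\<tau>[OF j] by (auto simp: fun_eq_iff sum_fun_apply cut_def sum_divide_distrib)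
  moreover have "\<mu> (\<Sum>g<2 ^ (k + 2). (\<tau> k j g / 2 ^ (k + 2)) *\<^sub>R cut (row k g)) =
      (\<Sum>g<2 ^ (k + 2). (\<tau> k j g / 2 ^ (k + 2)) * \<mu> (cut (row k g)))"
    using \<mu> free_space_subset_dual[OF zero_in_K] row_in_Lip0(1)
    by (intro Lip0_dual_sum[OF zero_in_K]) auto
  ultimately show ?thesis by (simp add: sum_divide_distrib)
qed

text \<open>Expanding coordinates of level \<open>k\<close> by \<open>\<sigma>\<close> and of level
  \<open>k + 1\<close> by \<open>\<tau>\<close> pairs both averages with the same functions
  \<open>cut (row k g)\<close>. Exchanging the sums collects the lifts belonging to each row into
  \<open>\<psi> k g\<close>.\<close>

lemma \<beta>_increment:
  assumes lin: "linear_map_on (free_space K 0) S" and S: "S ` free_space K 0 \<subseteq> free_space K 0"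
  shows "\<beta> (Suc k) S - \<beta> k S = (\<Sum>g<2 ^ (k + 2). S (\<psi> k g) (cut (row k g))) / 2 ^ (k + 2)"
proof -
  have Sl: "S (lift i) \<in> free_space K 0" for i using S lift_in_free_space by blast
  define R where "R i g = S (lift i) (cut (row k g))" for i g
  have S\<psi>: "S (\<psi> k g) (cut (row k g)) =
      (\<Sum>j<2 ^ k. - (\<sigma> k j g / 2 ^ k) * R (2 ^ k + j) g) +
      (\<Sum>j<2 ^ (k + 1). \<tau> k j g / 2 ^ (k + 1) * R (2 ^ (k + 1) + j) g)" for g
  proof -
    have "S (\<psi> k g) = (\<Sum>i\<in>{2 ^ k..<2 ^ (k + 2)}. coeff k g i *\<^sub>R S (lift i))"
      unfolding \<psi>_def by (rule linear_map_on_sum[OF F.subspace lin lift_in_free_space])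
    then have "S (\<psi> k g) (cut (row k g)) = (\<Sum>i\<in>{2 ^ k..<2 ^ (k + 2)}. coeff k g i * R i g)"
      by (simp add: sum_fun_apply R_def)
    also have "\<dots> = (\<Sum>j<2 ^ k. - (\<sigma> k j g / 2 ^ k) * R (2 ^ k + j) g) +
      (\<Sum>j<2 ^ (k + 1). \<tau> k j g / 2 ^ (k + 1) * R (2 ^ (k + 1) + j) g)"
      unfolding sum_two_levels
      by (intro arg_cong2[where f = "(+)"] sum.cong refl) (simp_all only: coeff_level lessThan_iff)
    finally show ?thesis .
  qed
  have "\<beta> k S = (\<Sum>j<2 ^ k. \<Sum>g<2 ^ (k + 2). (\<sigma> k j g / 2 ^ k) * R (2 ^ k + j) g) / 2 ^ (k + 2)"
    unfolding \<beta>_def R_def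
    by (simp add: pairing_coord_\<sigma>[OF Sl] sum_divide_distrib mult.commute)
  also have "(\<Sum>j<2 ^ k. \<Sum>g<2 ^ (k + 2). (\<sigma> k j g / 2 ^ k) * R (2 ^ k + j) g) =
      (\<Sum>g<2 ^ (k + 2). \<Sum>j<2 ^ k. (\<sigma> k j g / 2 ^ k) * R (2 ^ k + j) g)"
    by (rule sum.swap)
  finally have \<beta>0: "\<beta> k S = \<dots> / 2 ^ (k + 2)" .
  have "\<beta> (Suc k) S = (\<Sum>j<2 ^ (k + 1). \<Sum>g<2 ^ (k + 2). (\<tau> k j g / 2 ^ (k + 1)) * R (2 ^ (k + 1) + j) g) / 2 ^ (k + 2)"
    unfolding \<beta>_def R_def Suc_eq_plus1
    by (simp add: pairing_coord_\<tau>[OF Sl, simplified] sum_divide_distrib mult.commute)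
  also have "(\<Sum>j<2 ^ (k + 1). \<Sum>g<2 ^ (k + 2). (\<tau> k j g / 2 ^ (k + 1)) * R (2 ^ (k + 1) + j) g) =
      (\<Sum>g<2 ^ (k + 2). \<Sum>j<2 ^ (k + 1). (\<tau> k j g / 2 ^ (k + 1)) * R (2 ^ (k + 1) + j) g)"
    by (rule sum.swap)
  finally show ?thesis
    unfolding \<beta>0 S\<psi> by (simp add: sum.distrib sum_negf sum_subtractf diff_divide_distrib[symmetric] add.commute)
qed

theorem not_approximation_property_free_space: "\<not> approximation_property (free_space K 0) (free_norm K 0)"
proof (rule F.not_approximation_propertyI[where \<beta> = \<beta> and s = "7 / 8" and a = "lift 1" and D = 47
      and \<Psi> = "\<lambda>k. \<psi> k ` {..<2 ^ (k + 2)}"])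
  show "lift 1 \<in> free_space K 0" by (rule lift_in_free_space)
  show "\<psi> k ` {..<2 ^ (k + 2)} \<subseteq> free_space K 0" for k using \<psi>_in_free_space by blast
  show "free_norm K 0 \<mu> \<le> 47 * (7 / 8) ^ (2 * k)" if "\<mu> \<in> \<psi> k ` {..<2 ^ (k + 2)}" for k \<mu>
  proof -
    have "free_norm K 0 \<mu> \<le> 47 * (3 / 4) ^ k" using that norm_\<psi>_le by auto
    \<comment> \<open>The choice of 7/8: its square 49/64 lies just above 3/4 = 48/64.\<close>
    also have "\<dots> \<le> 47 * (49 / 64) ^ k" by (intro mult_left_mono power_mono) auto
    finally show ?thesis by (simp add: power_mult power2_eq_square)
  qed
  show "\<beta> k (\<lambda>\<mu>. T \<mu> - \<mu>) = \<beta> k T - 1" for k T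
    by (simp add: \<beta>_def sum_subtractf diff_divide_distrib lift_coord)
  \<comment> \<open>Level 0 consists of index 1 alone, so \<open>\<beta> 0\<close> is a single
    diagonal entry.\<close>
  show "\<bar>\<beta> 0 S\<bar> \<le> free_norm K 0 (S (lift 1))"
    if "linear_map_on (free_space K 0) S" "S ` free_space K 0 \<subseteq> free_space K 0" for S
  proof -
    have "S (lift 1) \<in> free_space K 0" using that(2) lift_in_free_space by blast
    from free_pairing_le[OF this coord_in_Lip0] show ?thesis by (simp add: \<beta>_def)
  qed
  show "\<bar>\<beta> (Suc k) S - \<beta> k S\<bar> \<le> r"
    if S: "linear_map_on (free_space K 0) S" "S ` free_space K 0 \<subseteq> free_space K 0"
      and r: "\<And>\<mu>. \<mu> \<in> \<psi> k ` {..<2 ^ (k + 2)} \<Longrightarrow> free_norm K 0 (S \<mu>) \<le> r" for S k r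
  proof -
    have "\<bar>S (\<psi> k g) (cut (row k g))\<bar> \<le> r" if g: "g < 2 ^ (k + 2)" for g
    proof -
      have "S (\<psi> k g) \<in> free_space K 0" using S(2) \<psi>_in_free_space by blast
      from free_pairing_le[OF this row_in_Lip0[OF g]] r[of "\<psi> k g"] g show ?thesis by simp
    qed
    then have "\<bar>\<Sum>g<2 ^ (k + 2). S (\<psi> k g) (cut (row k g))\<bar> \<le> (\<Sum>g<(2 :: nat) ^ (k + 2). r)"
      by (intro order_trans[OF sum_abs] sum_mono) simp
    then show ?thesis unfolding \<beta>_increment[OF S] by (simp add: abs_divide divide_le_eq mult.commute)
  qed
  show "(\<lambda>k. \<beta> k T) \<longlonglongrightarrow> 0" if T: "T \<in> finite_rank_operators (free_space K 0) (free_norm K 0)" for T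
    unfolding tendsto_iff
  proof (intro allI impI)
    fix r :: real assume "0 < r"
    then have r2: "0 < r / 2" by simp
    obtain d where d: "0 < d" "\<And>\<mu> f. \<mu> \<in> free_space K 0 \<Longrightarrow> free_norm K 0 \<mu> \<le> 1 \<Longrightarrow> f \<in> Lip0 K 0 \<Longrightarrow>
        Lip_norm K f \<le> 1 \<Longrightarrow> (\<And>x. x \<in> mspace K \<Longrightarrow> \<bar>f x\<bar> \<le> d) \<Longrightarrow> \<bar>T \<mu> f\<bar> \<le> r / 2"
      using finite_rank_uniformly_weakly_continuous[OF zero_in_K T r2] by blast
    \<comment> \<open>The sides of the cube shrink, so the coordinate functions of level
      \<open>k\<close> tend to 0 uniformly while remaining 1-Lipschitz; the crude exponent
      \<open>k\<close> in place of \<open>2 ^ k + j\<close> suffices.\<close>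
    have "(\<lambda>k. 2 * (1 / 2) ^ k :: real) \<longlonglongrightarrow> 2 * 0" by (intro tendsto_mult_left LIMSEQ_power_zero) simp
    then have "\<forall>\<^sub>F k in sequentially. 2 * (1 / 2) ^ k < d" by (rule order_tendstoD) (use d(1) in simp)
    then show "\<forall>\<^sub>F k in sequentially. dist (\<beta> k T) 0 < r"
    proof eventually_elim
      case (elim k)
      have "\<bar>T (lift (2 ^ k + j)) (coord (2 ^ k + j))\<bar> \<le> r / 2" for j
      proof (rule d(2)[OF lift_in_free_space norm_lift_le coord_in_Lip0])
        fix x assume "x \<in> mspace K"
        then have "x \<in> cube" by (simp add: mspace_K)
        then have "\<bar>coord (2 ^ k + j) x\<bar> \<le> 2 * (1 / 2) ^ (2 ^ k + j)" by (simp add: cut_def cube_def)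
        also have "(1 / 2 :: real) ^ (2 ^ k + j) \<le> (1 / 2) ^ k"
          by (intro power_decreasing) (auto intro: order_trans[OF less_imp_le[OF less_exp]])
        finally show "\<bar>coord (2 ^ k + j) x\<bar> \<le> d" using elim by simp
      qed
      then have "\<bar>\<Sum>j<2 ^ k. T (lift (2 ^ k + j)) (coord (2 ^ k + j))\<bar> \<le> (\<Sum>j<(2 :: nat) ^ k. r / 2)"
        by (intro order_trans[OF sum_abs] sum_mono)
      then have "\<bar>\<beta> k T\<bar> \<le> r / 2" by (simp add: \<beta>_def abs_divide divide_le_eq mult.commute)
      then show ?case using \<open>0 < r\<close> by simp
    qed
  qed
qed auto

end

lemma davie_exists: "\<exists>\<sigma> \<tau>. davie \<sigma> \<tau>"
  by (rule davie_systems, intro exI, rule davie.intro)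

theorem corollary5:
  shows "\<exists>(K :: (nat \<Rightarrow> real) metric) z.
    z \<in> mspace K \<and> compact_space (mtopology_of K) \<and>
    \<not> approximation_property (free_space K z) (free_norm K z)"
proof -
  obtain \<sigma> \<tau> where "davie \<sigma> \<tau>" using davie_exists by blast
  then interpret davie \<sigma> \<tau> .
  show ?thesis
    using zero_in_K compact_K not_approximation_property_free_space by blast
qed

end
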